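(* Let $\delta=1$ (resp. $\delta=-1$) and let $\eta\in\mathbb{R}$. Consider a system $$z_{1,t}=F(z,z_1,y,y_1),\qquad y_{1,t}=G(z,z_1,y,y_1)\qquad (z=u,\ z_1=u_x,\ y=v,\ y_1=v_x),$$ with $F,G$ smooth, satisfying $F_z^2+F_y^2+G_z^2+G_y^2\neq 0$ up to a set of measure zero. Then the system describes pseudospherical surfaces (resp. spherical surfaces) with associated smooth functions $f_{ij}(z,z_1,y,y_1)$ such that $f_{21}=\eta$ if and only if one of the following two cases occurs (locally, i.e. after possibly shrinking the domain): (i) The system is $$z_{1,t}=\tfrac1W\big[-(abz_1+a^2y_1)\phi''(\xi)+\eta(\mu h_{y_1}-\delta\lambda g_{y_1})\phi'(\xi)-\tfrac12(h^2-\delta g^2)_{y_1}\phi(\xi)\big],$$ $$y_{1,t}=\tfrac1W\big[(b^2z_1+aby_1)\phi''(\xi)-\eta(\mu h_{z_1}-\delta\lambda g_{z_1})\phi'(\xi)+\tfrac12(h^2-\delta g^2)_{z_1}\phi(\xi)\big],$$ where $a,b,\mu,\lambda\in\mathbb{R}$; $g(z_1,y_1)$, $h(z_1,y_1)$ and $\phi(\xi)$, $\xi=ay+bz$, are smooth functions such that $\phi$ is a strictly monotone function of $\xi$ and $$a^2+b^2\neq0,\quad \mu^2+\lambda^2\neq0,\quad W=g_{z_1}h_{y_1}-g_{y_1}h_{z_1}\neq0,\quad \mu g-\lambda h=ay_1+bz_1,\quad g\neq\lambda\eta\frac{\phi'(\xi)}{\phi(\xi)}.$$ In this case the associated functions are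 $$f_{11}=g,\ f_{12}=\lambda\phi'(\xi),\ f_{21}=\eta,\ f_{22}=\phi(\xi),\ f_{31}=h,\ f_{32}=\mu\phi'(\xi).$$ (ii) The system is $$z_{1,t}=-\frac{z_1}{\gamma}(p_{zy}+\tau p)-\frac{y_1}{\gamma}(p_{yy}+\beta p)+\frac{\eta}{\gamma^2}(\beta p_z-\tau p_y),$$ $$y_{1,t}=\frac{z_1}{\gamma}(p_{zz}+\alpha p)+\frac{y_1}{\gamma}(p_{zy}+\tau p)-\frac{\eta}{\gamma^2}(\tau p_z-\alpha p_y),$$ where $a_1,b_1,a_3,b_3\in\mathbb{R}$, $\gamma:=a_1b_3-b_1a_3\neq0$, $\alpha=a_3^2-\delta a_1^2$, $\beta=b_3^2-\delta b_1^2$, $\tau=a_3b_3-\delta a_1b_1$, and $p(z,y)$ is a smooth function such that $p_z$ and $p_y$ are not proportional. In this case the associated functions are $$f_{11}=a_1z_1+b_1y_1,\quad f_{12}=\tfrac1\gamma(b_1p_z-a_1p_y),\quad f_{21}=\eta,\quad f_{22}=p,\quad f_{31}=a_3z_1+b_3y_1,\quad f_{32}=\tfrac1\gamma(b_3p_z-a_3p_y).$$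
   Context: Subscripts $z,z_1,y,y_1$ on functions denote partial derivatives, and $z,z_1,y,y_1$ are treated as independent variables on an open connected subset of $\mathbb{R}^4$; primes denote derivatives with respect to $\xi$. "$p_z$ and $p_y$ not proportional" means linearly independent over $\mathbb{R}$ as functions. Definition. A system of PDEs for $u(x,t),v(x,t)$ describes pseudospherical surfaces (take $\delta=1$), resp. spherical surfaces (take $\delta=-1$), with associated functions $f_{ij}$, $1\le i\le 3$, $1\le j\le 2$, if the system is equivalent to (i.e. has exactly the same solutions $(u,v)$ as) the structure equations $d\omega_1=\omega_3\wedge\omega_2$, $d\omega_2=\omega_1\wedge\omega_3$, $d\omega_3=\delta\,\omega_1\wedge\omega_2$ of a surface with Gaussian curvature $K=-\delta$, where $\omega_i=f_{i1}dx+f_{i2}dt$ and $f_{ij}$ are evaluated on $u,v$ and their derivatives, with $\omega_1\wedge\omega_2\ne 0$, i.e. $f_{11}f_{22}-f_{12}f_{21}\neq0$. Everything is local and generic: non-vanishing conditions (including $f_{11}f_{22}-f_{12}f_{21}\ne0$) are understood up to a set of measure zero, and the domain may be replaced by a smaller open connected set. *)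

theory Defs
  imports "HOL-Analysis.Analysis"
begin

section \<open>Partial derivatives and smooth functions on open sets\<close>

definition partial :: "'a::euclidean_space \<Rightarrow> ('a \<Rightarrow> real) \<Rightarrow> 'a \<Rightarrow> real" where
  "partial e f = (\<lambda>x. frechet_derivative f (at x) e)"

text \<open>Meant for open \<open>S\<close>: the derivatives are two-sided, so only the values of \<open>f\<close> on \<open>S\<close> matter.\<close>

primrec Ck_on :: "nat \<Rightarrow> 'a::euclidean_space set \<Rightarrow> ('a \<Rightarrow> real) \<Rightarrow> bool" where
  "Ck_on 0 S f \<longleftrightarrow> continuous_on S f"
| "Ck_on (Suc k) S f \<longleftrightarrow>
     (\<forall>x\<in>S. f differentiable (at x)) \<and> (\<forall>e\<in>Basis. Ck_on k S (partial e f))"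

definition smooth_on :: "'a::euclidean_space set \<Rightarrow> ('a \<Rightarrow> real) \<Rightarrow> bool" where
  "smooth_on S f \<longleftrightarrow> (\<forall>k. Ck_on k S f)"


section \<open>Domains and generic conditions\<close>

text \<open>\<open>C\<close> holds on \<open>V\<close> up to a set of Lebesgue measure zero.\<close>

definition ae_on :: "'a::euclidean_space set \<Rightarrow> ('a \<Rightarrow> bool) \<Rightarrow> bool" where
  "ae_on V C \<longleftrightarrow> negligible {P \<in> V. \<not> C P}"

definition subdomain :: "'a::euclidean_space set \<Rightarrow> 'a set \<Rightarrow> bool" where
  "subdomain V U \<longleftrightarrow> open V \<and> connected V \<and> V \<noteq> {} \<and> V \<subseteq> U"

text \<open>
  The formal counterpart of ``locally and generically'': wherever one looks inside \<open>U\<close>,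
  the property holds after shrinking the domain.
\<close>

definition gen_locally :: "'a::euclidean_space set \<Rightarrow> ('a set \<Rightarrow> bool) \<Rightarrow> bool" where
  "gen_locally U P \<longleftrightarrow> (\<forall>V. subdomain V U \<longrightarrow> (\<exists>V'. subdomain V' V \<and> P V'))"


section \<open>Systems describing (pseudo)spherical surfaces\<close>

text \<open>
  Points of the plane are \<open>(x, t)\<close>; jets are \<open>(z, z1, y, y1)\<close>, where \<open>z = u\<close>, \<open>z1 = u\<^sub>x\<close>,
  \<open>y = v\<close>, \<open>y1 = v\<^sub>x\<close>.
\<close>

type_synonym plane = "real \<times> real"
type_synonym jet = "real \<times> real \<times> real \<times> real"

abbreviation D_x :: "(plane \<Rightarrow> real) \<Rightarrow> plane \<Rightarrow> real" where "D_x \<equiv> partial (1, 0)"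
abbreviation D_t :: "(plane \<Rightarrow> real) \<Rightarrow> plane \<Rightarrow> real" where "D_t \<equiv> partial (0, 1)"

definition jet_of :: "(plane \<Rightarrow> real) \<Rightarrow> (plane \<Rightarrow> real) \<Rightarrow> plane \<Rightarrow> jet" where
  "jet_of u v q = (u q, D_x u q, v q, D_x v q)"

definition solves_system ::
  "(jet \<Rightarrow> real) \<Rightarrow> (jet \<Rightarrow> real) \<Rightarrow> plane set \<Rightarrow> (plane \<Rightarrow> real) \<Rightarrow> (plane \<Rightarrow> real) \<Rightarrow> bool" where
  "solves_system F G D u v \<longleftrightarrow>
     (\<forall>q\<in>D. D_t (D_x u) q = F (jet_of u v q) \<and> D_t (D_x v) q = G (jet_of u v q))"

text \<open>
  The pair \<open>(A, B)\<close> is the 1-form \<open>A dx + B dt\<close>; a 2-form is given by its coefficient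
  with respect to \<open>dx \<and> dt\<close>.
\<close>

type_synonym form1 = "(plane \<Rightarrow> real) \<times> (plane \<Rightarrow> real)"

definition ext_d :: "form1 \<Rightarrow> plane \<Rightarrow> real" where
  "ext_d \<omega> q = D_x (snd \<omega>) q - D_t (fst \<omega>) q"

definition wedge :: "form1 \<Rightarrow> form1 \<Rightarrow> plane \<Rightarrow> real" where
  "wedge \<omega> \<theta> q = fst \<omega> q * snd \<theta> q - snd \<omega> q * fst \<theta> q"

definition assoc_form ::
  "(nat \<Rightarrow> nat \<Rightarrow> jet \<Rightarrow> real) \<Rightarrow> (plane \<Rightarrow> real) \<Rightarrow> (plane \<Rightarrow> real) \<Rightarrow> nat \<Rightarrow> form1" where
  "assoc_form f u v i = ((\<lambda>q. f i 1 (jet_of u v q)), (\<lambda>q. f i 2 (jet_of u v q)))"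

definition solves_structure ::
  "real \<Rightarrow> (nat \<Rightarrow> nat \<Rightarrow> jet \<Rightarrow> real) \<Rightarrow> plane set \<Rightarrow> (plane \<Rightarrow> real) \<Rightarrow> (plane \<Rightarrow> real) \<Rightarrow> bool" where
  "solves_structure \<delta> f D u v \<longleftrightarrow>
     (let \<omega> = assoc_form f u v in
       \<forall>q\<in>D. ext_d (\<omega> 1) q = wedge (\<omega> 3) (\<omega> 2) q \<and>
             ext_d (\<omega> 2) q = wedge (\<omega> 1) (\<omega> 3) q \<and>
             ext_d (\<omega> 3) q = \<delta> * wedge (\<omega> 1) (\<omega> 2) q)"

text \<open>
  Pseudospherical surfaces for \<open>\<delta> = 1\<close>, spherical surfaces for \<open>\<delta> = -1\<close>. Solutions are smooth
  functions on an arbitrary open subset of the plane whose jets stay in the domain \<open>V\<close>.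
\<close>

definition describes_surfaces ::
  "real \<Rightarrow> jet set \<Rightarrow> (jet \<Rightarrow> real) \<Rightarrow> (jet \<Rightarrow> real) \<Rightarrow> (nat \<Rightarrow> nat \<Rightarrow> jet \<Rightarrow> real) \<Rightarrow> bool" where
  "describes_surfaces \<delta> V F G f \<longleftrightarrow>
     (\<forall>i\<in>{1,2,3}. \<forall>j\<in>{1,2}. smooth_on V (f i j)) \<and>
     ae_on V (\<lambda>P. f 1 1 P * f 2 2 P - f 1 2 P * f 2 1 P \<noteq> 0) \<and>
     (\<forall>D u v. open D \<longrightarrow> smooth_on D u \<longrightarrow> smooth_on D v \<longrightarrow> jet_of u v ` D \<subseteq> V \<longrightarrow>
        (solves_system F G D u v \<longleftrightarrow> solves_structure \<delta> f D u v))"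

definition describes_with_eta ::
  "real \<Rightarrow> real \<Rightarrow> jet set \<Rightarrow> (jet \<Rightarrow> real) \<Rightarrow> (jet \<Rightarrow> real) \<Rightarrow> (nat \<Rightarrow> nat \<Rightarrow> jet \<Rightarrow> real) \<Rightarrow> bool" where
  "describes_with_eta \<delta> \<eta> V F G f \<longleftrightarrow>
     describes_surfaces \<delta> V F G f \<and> (\<forall>P\<in>V. f 2 1 P = \<eta>)"

definition nondegenerate :: "jet set \<Rightarrow> (jet \<Rightarrow> real) \<Rightarrow> (jet \<Rightarrow> real) \<Rightarrow> bool" where
  "nondegenerate U F G \<longleftrightarrow>
     (let e\<^sub>z = (1, 0, 0, 0); e\<^sub>y = (0, 0, 1, 0) in
      ae_on U (\<lambda>P. (partial e\<^sub>z F P)\<^sup>2 + (partial e\<^sub>y F P)\<^sup>2 +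
                   (partial e\<^sub>z G P)\<^sup>2 + (partial e\<^sub>y G P)\<^sup>2 \<noteq> 0))"


section \<open>The two cases\<close>

text \<open>
  Functions of \<open>(z1, y1)\<close>, respectively \<open>(z, y)\<close>, are functions on the corresponding projection
  of \<open>V\<close>, and \<open>\<phi>\<close> is a function on the interval of values of \<open>\<xi> = a y + b z\<close> on \<open>V\<close>.
\<close>

definition proj_z1y1 :: "jet \<Rightarrow> real \<times> real" where
  "proj_z1y1 = (\<lambda>(z, z1, y, y1). (z1, y1))"

definition proj_zy :: "jet \<Rightarrow> real \<times> real" where
  "proj_zy = (\<lambda>(z, z1, y, y1). (z, y))"

definition xi :: "real \<Rightarrow> real \<Rightarrow> jet \<Rightarrow> real" where
  "xi a b = (\<lambda>(z, z1, y, y1). a * y + b * z)"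

abbreviation D1 :: "(real \<times> real \<Rightarrow> real) \<Rightarrow> real \<times> real \<Rightarrow> real" where "D1 \<equiv> partial (1, 0)"
abbreviation D2 :: "(real \<times> real \<Rightarrow> real) \<Rightarrow> real \<times> real \<Rightarrow> real" where "D2 \<equiv> partial (0, 1)"

definition W_of :: "(real \<times> real \<Rightarrow> real) \<Rightarrow> (real \<times> real \<Rightarrow> real) \<Rightarrow> real \<times> real \<Rightarrow> real" where
  "W_of g h r = D1 g r * D2 h r - D2 g r * D1 h r"

text \<open>
  The condition on \<open>\<phi>' / \<phi>\<close> is unaffected by the convention \<open>x / 0 = 0\<close>: since \<open>\<phi>\<close> is injective,
  it vanishes on a null set of jets only. The equations of the system are required where
  their right-hand sides are defined, that is, where \<open>W \<noteq> 0\<close>.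
\<close>

definition case_i ::
  "real \<Rightarrow> real \<Rightarrow> jet set \<Rightarrow> (jet \<Rightarrow> real) \<Rightarrow> (jet \<Rightarrow> real) \<Rightarrow>
   real \<Rightarrow> real \<Rightarrow> real \<Rightarrow> real \<Rightarrow>
   (real \<times> real \<Rightarrow> real) \<Rightarrow> (real \<times> real \<Rightarrow> real) \<Rightarrow> (real \<Rightarrow> real) \<Rightarrow> bool" where
  "case_i \<delta> \<eta> V F G a b \<mu> lam g h \<phi> \<longleftrightarrow>
     smooth_on (proj_z1y1 ` V) g \<and> smooth_on (proj_z1y1 ` V) h \<and>
     smooth_on (xi a b ` V) \<phi> \<and>
     (strict_mono_on (xi a b ` V) \<phi> \<or> strict_antimono_on (xi a b ` V) \<phi>) \<and>
     a\<^sup>2 + b\<^sup>2 \<noteq> 0 \<and> \<mu>\<^sup>2 + lam\<^sup>2 \<noteq> 0 \<and>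
     ae_on V (\<lambda>P. W_of g h (proj_z1y1 P) \<noteq> 0) \<and>
     (\<forall>(z1, y1) \<in> proj_z1y1 ` V. \<mu> * g (z1, y1) - lam * h (z1, y1) = a * y1 + b * z1) \<and>
     ae_on V (\<lambda>P. g (proj_z1y1 P) \<noteq> lam * \<eta> * (deriv \<phi> (xi a b P) / \<phi> (xi a b P))) \<and>
     (\<forall>(z, z1, y, y1) \<in> V.
        let r = (z1, y1); \<xi> = a * y + b * z; W = W_of g h r;
            \<phi>0 = \<phi> \<xi>; \<phi>1 = deriv \<phi> \<xi>; \<phi>2 = deriv (deriv \<phi>) \<xi>;
            k = (\<lambda>s. (h s)\<^sup>2 - \<delta> * (g s)\<^sup>2)
        in W \<noteq> 0 \<longrightarrow>
           F (z, z1, y, y1) = 1 / W *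
             (- (a * b * z1 + a\<^sup>2 * y1) * \<phi>2 + \<eta> * (\<mu> * D2 h r - \<delta> * lam * D2 g r) * \<phi>1
              - 1 / 2 * D2 k r * \<phi>0) \<and>
           G (z, z1, y, y1) = 1 / W *
             ((b\<^sup>2 * z1 + a * b * y1) * \<phi>2 - \<eta> * (\<mu> * D1 h r - \<delta> * lam * D1 g r) * \<phi>1
              + 1 / 2 * D1 k r * \<phi>0))"

definition assoc_i ::
  "real \<Rightarrow> jet set \<Rightarrow> (nat \<Rightarrow> nat \<Rightarrow> jet \<Rightarrow> real) \<Rightarrow>
   real \<Rightarrow> real \<Rightarrow> real \<Rightarrow> real \<Rightarrow>
   (real \<times> real \<Rightarrow> real) \<Rightarrow> (real \<times> real \<Rightarrow> real) \<Rightarrow> (real \<Rightarrow> real) \<Rightarrow> bool" where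
  "assoc_i \<eta> V f a b \<mu> lam g h \<phi> \<longleftrightarrow>
     (\<forall>(z, z1, y, y1) \<in> V.
        let P = (z, z1, y, y1); \<xi> = a * y + b * z in
        f 1 1 P = g (z1, y1) \<and> f 1 2 P = lam * deriv \<phi> \<xi> \<and>
        f 2 1 P = \<eta>          \<and> f 2 2 P = \<phi> \<xi> \<and>
        f 3 1 P = h (z1, y1) \<and> f 3 2 P = \<mu> * deriv \<phi> \<xi>)"

text \<open>The functions \<open>p\<^sub>z\<close> and \<open>p\<^sub>y\<close> are not proportional when they are linearly independent on the domain.\<close>

definition lin_indep_on :: "'a set \<Rightarrow> ('a \<Rightarrow> real) \<Rightarrow> ('a \<Rightarrow> real) \<Rightarrow> bool" where
  "lin_indep_on S f1 f2 \<longleftrightarrow>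
     (\<forall>c d. (\<forall>s\<in>S. c * f1 s + d * f2 s = 0) \<longrightarrow> c = 0 \<and> d = 0)"

definition case_ii ::
  "real \<Rightarrow> real \<Rightarrow> jet set \<Rightarrow> (jet \<Rightarrow> real) \<Rightarrow> (jet \<Rightarrow> real) \<Rightarrow>
   real \<Rightarrow> real \<Rightarrow> real \<Rightarrow> real \<Rightarrow> (real \<times> real \<Rightarrow> real) \<Rightarrow> bool" where
  "case_ii \<delta> \<eta> V F G a1 b1 a3 b3 p \<longleftrightarrow>
     (let \<gamma> = a1 * b3 - b1 * a3; \<alpha> = a3\<^sup>2 - \<delta> * a1\<^sup>2; \<beta> = b3\<^sup>2 - \<delta> * b1\<^sup>2;
          \<tau> = a3 * b3 - \<delta> * a1 * b1
      in \<gamma> \<noteq> 0 \<and> smooth_on (proj_zy ` V) p \<and>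
         lin_indep_on (proj_zy ` V) (D1 p) (D2 p) \<and>
         (\<forall>(z, z1, y, y1) \<in> V.
            let s = (z, y); p0 = p s; pz = D1 p s; py = D2 p s;
                pzz = D1 (D1 p) s; pzy = D2 (D1 p) s; pyy = D2 (D2 p) s
            in F (z, z1, y, y1) =
                 - (z1 / \<gamma>) * (pzy + \<tau> * p0) - y1 / \<gamma> * (pyy + \<beta> * p0)
                 + \<eta> / \<gamma>\<^sup>2 * (\<beta> * pz - \<tau> * py) \<and>
               G (z, z1, y, y1) =
                 z1 / \<gamma> * (pzz + \<alpha> * p0) + y1 / \<gamma> * (pzy + \<tau> * p0)
                 - \<eta> / \<gamma>\<^sup>2 * (\<tau> * pz - \<alpha> * py)))"

definition assoc_ii ::
  "real \<Rightarrow> jet set \<Rightarrow> (nat \<Rightarrow> nat \<Rightarrow> jet \<Rightarrow> real) \<Rightarrow>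
   real \<Rightarrow> real \<Rightarrow> real \<Rightarrow> real \<Rightarrow> (real \<times> real \<Rightarrow> real) \<Rightarrow> bool" where
  "assoc_ii \<eta> V f a1 b1 a3 b3 p \<longleftrightarrow>
     (\<forall>(z, z1, y, y1) \<in> V.
        let P = (z, z1, y, y1); \<gamma> = a1 * b3 - b1 * a3; pz = D1 p (z, y); py = D2 p (z, y) in
        f 1 1 P = a1 * z1 + b1 * y1 \<and> f 1 2 P = 1 / \<gamma> * (b1 * pz - a1 * py) \<and>
        f 2 1 P = \<eta>                 \<and> f 2 2 P = p (z, y) \<and>
        f 3 1 P = a3 * z1 + b3 * y1 \<and> f 3 2 P = 1 / \<gamma> * (b3 * pz - a3 * py))"

end

theory Submission
  imports Defs
begin

text \<open>
  Along a solution of the system, the structure equations become relations between the jet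
  \<open>(z, z1, y, y1)\<close>, the second derivatives \<open>z2 = u\<^sub>x\<^sub>x\<close>, \<open>y2 = v\<^sub>x\<^sub>x\<close>, the derivatives \<open>zt\<close>, \<open>yt\<close> and the values
  of \<open>F\<close> and \<open>G\<close>; they are affine in \<open>z2, y2, zt, yt\<close>. Everything rests on the fact that these four
  numbers and the jet are arbitrary: \<open>u\<^sub>x\<^sub>t = F\<close>, \<open>v\<^sub>x\<^sub>t = G\<close> is a semilinear hyperbolic system in
  characteristic coordinates, and its Goursat problem, with data prescribed on the two axes, has smooth
  local solutions (\<open>goursat_smooth\<close>, \<open>system_solution_with_jet\<close>). Comparing coefficients, the
  \<open>f\<^sub>i\<^sub>1\<close> depend on \<open>(z1, y1)\<close> only, the \<open>f\<^sub>i\<^sub>2\<close> on \<open>(z, y)\<close> only, and three identities between functions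
  of the jet remain (\<open>describes_imp_separated\<close>, \<open>reduced_eqs\<close>).
  
  The Jacobian of \<open>(f\<^sub>1\<^sub>1, f\<^sub>3\<^sub>1)\<close> in \<open>(z1, y1)\<close> is the determinant with which the first and the third identity
  determine \<open>F\<close> and \<open>G\<close>. It cannot vanish on an open set: a kernel vector could be added to \<open>(F, G)\<close>, and
  solutions of the perturbed system would satisfy the structure equations but not the system
  (\<open>jac_nonzero_somewhere\<close>). Conversely, when the Jacobian is nonzero, the three identities make the
  structure equations equivalent to the system, point by point (\<open>describes_of_reduced_eqs\<close>). This
  reduces both directions of the theorem to the three identities.
  
  The second identity reads \<open>p\<^sub>z z1 + p\<^sub>y y1 = g r - s h\<close> with \<open>p = f\<^sub>2\<^sub>2\<close>, \<open>r = f\<^sub>3\<^sub>2\<close>, \<open>s = f\<^sub>1\<^sub>2\<close> functions of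
  \<open>(z, y)\<close> and \<open>g = f\<^sub>1\<^sub>1\<close>, \<open>h = f\<^sub>3\<^sub>1\<close> functions of \<open>(z1, y1)\<close>. If \<open>r\<close> and \<open>s\<close> are linearly independent, two points
  \<open>(z, y)\<close> suffice to solve for \<open>g\<close> and \<open>h\<close>, which are therefore linear: this is case (ii)
  (\<open>normal_form_ii\<close>). Otherwise \<open>(r, s) = \<psi> (\<mu>, \<lambda>)\<close> with constants \<open>\<mu>, \<lambda>\<close>, hence \<open>\<mu> g - \<lambda> h\<close> is a linear
  form \<open>a y1 + b z1\<close>, the gradient of \<open>p\<close> is \<open>\<psi> (b, a)\<close>, and \<open>p\<close> is a function of \<open>\<xi> = a y + b z\<close> alone: this is
  case (i) (\<open>normal_form_i\<close>). The formulas for \<open>F\<close> and \<open>G\<close> come from solving the remaining two identities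
  by Cramer's rule.
\<close>

section \<open>Functions with continuous derivatives of a given order\<close>

text \<open>
  For real-valued functions this is \<open>Ck_on\<close>. Vector values let a map such as \<open>q \<mapsto> (q, w q)\<close> be
  treated as one function, and the calculus is closed under composition, bounded linear and bounded
  bilinear maps.
\<close>

primrec Ck :: "nat \<Rightarrow> 'a::euclidean_space set \<Rightarrow> ('a \<Rightarrow> 'b::real_normed_vector) \<Rightarrow> bool" where
  "Ck 0 S f \<longleftrightarrow> continuous_on S f"
| "Ck (Suc k) S f \<longleftrightarrow> (\<forall>x\<in>S. f differentiable (at x)) \<and>
     (\<forall>e\<in>Basis. Ck k S (\<lambda>x. frechet_derivative f (at x) e))"

lemma Ck_real: "Ck k S f \<longleftrightarrow> Ck_on k S (f :: 'a::euclidean_space \<Rightarrow> real)"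
  by (induction k arbitrary: f) (simp_all add: partial_def)

lemma smooth_iff_Ck: "smooth_on S f \<longleftrightarrow> (\<forall>k. Ck k S f)"
  by (simp add: smooth_on_def Ck_real)

lemma Ck_subset: "Ck k S f \<Longrightarrow> T \<subseteq> S \<Longrightarrow> Ck k T f"
  by (induction k arbitrary: f) (auto intro: continuous_on_subset)

text \<open>
  Openness matters: derivatives at a point of \<open>S\<close> see a whole neighbourhood.
\<close>

lemma Ck_cong:
  assumes "open S" "\<And>x. x \<in> S \<Longrightarrow> f x = g x" "Ck k S f"
  shows "Ck k S g"
  using assms(2,3)
proof (induction k arbitrary: f g)
  case 0
  then show ?case using continuous_on_cong[of S S f g] by simp
next
  case (Suc k)
  have der: "(g has_derivative frechet_derivative f (at x)) (at x)" if "x \<in> S" for x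
    using Suc.prems that assms(1)
    by (auto simp: frechet_derivative_works intro: has_derivative_transform_within_open)
  then have eq: "frechet_derivative g (at x) = frechet_derivative f (at x)" if "x \<in> S" for x
    using that frechet_derivative_at by metis
  have "g differentiable (at x)" if "x \<in> S" for x
    using der[OF that] by (auto simp: differentiable_def)
  moreover have "Ck k S (\<lambda>x. frechet_derivative g (at x) e)" if "e \<in> Basis" for e
    using Suc.IH[of "\<lambda>x. frechet_derivative f (at x) e" "\<lambda>x. frechet_derivative g (at x) e"]
      Suc.prems(2) that eq by simp
  ultimately show ?case by simp
qed

lemma Ck_Suc_D: "Ck (Suc k) S f \<Longrightarrow> Ck k S f"
proof (induction k arbitrary: f)
  case 0
  then show ?case
    by (auto intro!: continuous_at_imp_continuous_on differentiable_imp_continuous_within)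
qed auto

lemma Ck_continuous: "Ck k S f \<Longrightarrow> continuous_on S f"
proof (induction k)
  case (Suc k)
  then show ?case using Ck_Suc_D by blast
qed simp

lemma Ck_const: "open S \<Longrightarrow> Ck k S (\<lambda>x. c)"
proof (induction k arbitrary: c)
  case (Suc k)
  then show ?case by (simp add: frechet_derivative_const)
qed simp

lemma Ck_bounded_linear_compose:
  assumes "open S" "bounded_linear L" "Ck k S f"
  shows "Ck k S (\<lambda>x. L (f x))"
  using assms(3)
proof (induction k arbitrary: f)
  case 0
  then show ?case
    using bounded_linear.continuous_on[OF assms(2)] by simp
next
  case (Suc k)
  have der: "((\<lambda>x. L (f x)) has_derivative (\<lambda>h. L (frechet_derivative f (at x) h))) (at x)" if "x \<in> S" for x
    using bounded_linear.has_derivative[OF assms(2)] Suc.prems that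
    by (auto simp: frechet_derivative_works)
  have "Ck k S (\<lambda>x. frechet_derivative (\<lambda>x. L (f x)) (at x) e)" if "e \<in> Basis" for e
    by (rule Ck_cong[OF assms(1), of "\<lambda>x. L (frechet_derivative f (at x) e)"])
      (use Suc that frechet_derivative_at[OF der] in \<open>auto simp: fun_eq_iff\<close>)
  then show ?case using der by (auto simp: differentiable_def)
qed

lemma Ck_add:
  assumes "open S" "Ck k S f" "Ck k S g"
  shows "Ck k S (\<lambda>x. f x + g x)"
  using assms(2,3)
proof (induction k arbitrary: f g)
  case 0
  then show ?case by (simp add: continuous_on_add)
next
  case (Suc k)
  have der: "((\<lambda>x. f x + g x) has_derivative
      (\<lambda>h. frechet_derivative f (at x) h + frechet_derivative g (at x) h)) (at x)" if "x \<in> S" for x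
    using Suc.prems that
    by (auto simp: frechet_derivative_works intro!: has_derivative_add)
  have "Ck k S (\<lambda>x. frechet_derivative (\<lambda>x. f x + g x) (at x) e)" if "e \<in> Basis" for e
    by (rule Ck_cong[OF assms(1), of "\<lambda>x. frechet_derivative f (at x) e + frechet_derivative g (at x) e"])
      (use Suc that frechet_derivative_at[OF der] in \<open>auto simp: fun_eq_iff\<close>)
  then show ?case using der by (auto simp: differentiable_def)
qed

lemma Ck_sum:
  assumes "open S" "\<And>i. i \<in> I \<Longrightarrow> Ck k S (f i)"
  shows "Ck k S (\<lambda>x. \<Sum>i\<in>I. f i x)"
  using assms(2)
proof (induction I rule: infinite_finite_induct)
  case (insert i I)
  then have "Ck k S (\<lambda>x. f i x + (\<Sum>i\<in>I. f i x))" by (intro Ck_add assms(1)) simp_all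
  then show ?case using insert.hyps by simp
qed (simp_all add: Ck_const assms(1))

lemma Ck_bilinear:
  assumes "open S" "bounded_bilinear B" "Ck k S f" "Ck k S g"
  shows "Ck k S (\<lambda>x. B (f x) (g x))"
  using assms(3,4)
proof (induction k arbitrary: f g)
  case 0
  then show ?case using bounded_bilinear.continuous_on[OF assms(2)] by simp
next
  case (Suc k)
  have der: "((\<lambda>x. B (f x) (g x)) has_derivative
      (\<lambda>h. B (f x) (frechet_derivative g (at x) h) + B (frechet_derivative f (at x) h) (g x))) (at x)" if "x \<in> S" for x
    using Suc.prems that
    by (auto simp: frechet_derivative_works intro!: bounded_bilinear.FDERIV[OF assms(2)])
  have "Ck k S (\<lambda>x. frechet_derivative (\<lambda>x. B (f x) (g x)) (at x) e)" if "e \<in> Basis" for e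
  proof (rule Ck_cong[OF assms(1)])
    show "Ck k S (\<lambda>x. B (f x) (frechet_derivative g (at x) e) + B (frechet_derivative f (at x) e) (g x))"
      using Suc.prems that Ck_Suc_D[OF Suc.prems(1)] Ck_Suc_D[OF Suc.prems(2)]
      by (intro Ck_add assms(1) Suc.IH) auto
  qed (use frechet_derivative_at[OF der] in \<open>auto simp: fun_eq_iff\<close>)
  then show ?case using der by (auto simp: differentiable_def)
qed

lemmas Ck_scaleR = Ck_bilinear[OF _ bounded_bilinear_scaleR]
lemmas Ck_mult = Ck_bilinear[OF _ bounded_bilinear_mult]
lemmas Ck_inner_left = Ck_bounded_linear_compose[OF _ bounded_linear_inner_left]

lemma Ck_linear:
  assumes "open S" "bounded_linear L" shows "Ck k S L"
proof (cases k)
  case 0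
  then show ?thesis using assms(2) linear_continuous_on by simp
next
  case (Suc k)
  have "frechet_derivative L (at x) = L" for x
    using bounded_linear_imp_has_derivative[OF assms(2)] frechet_derivative_at by metis
  then show ?thesis
    using bounded_linear_imp_differentiable[OF assms(2)] Suc by (auto intro!: Ck_const assms(1))
qed

lemma Ck_id: "open S \<Longrightarrow> Ck k S (\<lambda>x. x)"
  by (rule Ck_linear) (auto simp: bounded_linear_ident)

lemma Ck_uminus: "open S \<Longrightarrow> Ck k S f \<Longrightarrow> Ck k S (\<lambda>x. - f x)"
  by (rule Ck_bounded_linear_compose[OF _ bounded_linear_minus[OF bounded_linear_ident]])

lemma Ck_Pair:
  assumes "open S" "Ck k S f" "Ck k S g"
  shows "Ck k S (\<lambda>x. (f x, g x))"
proof (rule Ck_cong[OF assms(1)])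
  show "Ck k S (\<lambda>x. (f x, 0) + (0, g x))"
    by (intro Ck_add assms
        Ck_bounded_linear_compose[OF _ bounded_linear_Pair[OF bounded_linear_ident bounded_linear_zero]]
        Ck_bounded_linear_compose[OF _ bounded_linear_Pair[OF bounded_linear_zero bounded_linear_ident]])
qed simp

lemmas Ck_fst = Ck_bounded_linear_compose[OF _ bounded_linear_fst]
lemmas Ck_snd = Ck_bounded_linear_compose[OF _ bounded_linear_snd]

lemma frechet_derivative_expand:
  fixes f :: "'a::euclidean_space \<Rightarrow> 'b::real_normed_vector"
  assumes "f differentiable (at x)"
  shows "frechet_derivative f (at x) h = (\<Sum>b\<in>Basis. (h \<bullet> b) *\<^sub>R frechet_derivative f (at x) b)"
proof -
  interpret linear "frechet_derivative f (at x)"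
    by (rule has_derivative_linear[OF assms[unfolded frechet_derivative_works]])
  have "frechet_derivative f (at x) (\<Sum>b\<in>Basis. (h \<bullet> b) *\<^sub>R b) =
      (\<Sum>b\<in>Basis. (h \<bullet> b) *\<^sub>R frechet_derivative f (at x) b)"
    by (simp only: sum scale)
  then show ?thesis by (simp only: euclidean_representation)
qed

text \<open>
  By the chain rule a directional derivative of \<open>f \<circ> g\<close> is a sum of products of components of the derivative
  of \<open>g\<close> with \<open>(\<partial>\<^sub>b f) \<circ> g\<close>, to which the induction hypothesis applies.
\<close>

lemma Ck_compose:
  fixes f :: "'a::euclidean_space \<Rightarrow> 'b::real_normed_vector"
    and g :: "'c::euclidean_space \<Rightarrow> 'a"
  assumes "open S" "Ck k T f" "Ck k S g" "\<And>x. x \<in> S \<Longrightarrow> g x \<in> T"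
  shows "Ck k S (\<lambda>x. f (g x))"
  using assms(2,3)
proof (induction k arbitrary: f)
  case 0
  then show ?case using assms(4) by (auto intro: continuous_on_compose2)
next
  case (Suc k)
  have der: "((\<lambda>x. f (g x)) has_derivative
      (\<lambda>h. frechet_derivative f (at (g x)) (frechet_derivative g (at x) h))) (at x)" if "x \<in> S" for x
  proof (rule has_derivative_compose[where f=g and g=f])
    show "(g has_derivative frechet_derivative g (at x)) (at x)"
      using Suc.prems(2) that by (simp add: frechet_derivative_works[symmetric])
    show "(f has_derivative frechet_derivative f (at (g x))) (at (g x))"
      using Suc.prems(1) that assms(4) by (simp add: frechet_derivative_works[symmetric])
  qed
  have "Ck k S (\<lambda>x. frechet_derivative (\<lambda>x. f (g x)) (at x) e)" if "e \<in> Basis" for e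
  proof (rule Ck_cong[OF assms(1)])
    show "Ck k S (\<lambda>x. \<Sum>b\<in>Basis. (frechet_derivative g (at x) e \<bullet> b) *\<^sub>R frechet_derivative f (at (g x)) b)"
      using Suc.prems that Ck_Suc_D[OF Suc.prems(2)]
      by (intro Ck_sum Ck_scaleR assms(1) Suc.IH Ck_inner_left) auto
  next
    fix x assume "x \<in> S"
    then have "f differentiable (at (g x))" using Suc.prems assms(4) by simp
    then show "(\<Sum>b\<in>Basis. (frechet_derivative g (at x) e \<bullet> b) *\<^sub>R frechet_derivative f (at (g x)) b) =
         frechet_derivative (\<lambda>x. f (g x)) (at x) e"
      unfolding frechet_derivative_at[OF der[OF \<open>x \<in> S\<close>], symmetric]
      by (rule frechet_derivative_expand[symmetric])
  qed
  then show ?case using der by (auto simp: differentiable_def)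
qed

lemma Ck_derivative_along:
  fixes f :: "'a::euclidean_space \<Rightarrow> 'b::real_normed_vector"
    and g :: "'c::euclidean_space \<Rightarrow> 'a"
  assumes "open S" "Ck (Suc k) T f" "Ck k S g" "\<And>x. x \<in> S \<Longrightarrow> g x \<in> T" "Ck k S h"
  shows "Ck k S (\<lambda>x. frechet_derivative f (at (g x)) (h x))"
proof (rule Ck_cong[OF assms(1)])
  have "Ck k S (\<lambda>x. frechet_derivative f (at (g x)) b)" if "b \<in> Basis" for b
    using Ck_compose[OF assms(1) _ assms(3,4), where f="\<lambda>y. frechet_derivative f (at y) b"] assms(2) that
    by simp
  then show "Ck k S (\<lambda>x. \<Sum>b\<in>Basis. (h x \<bullet> b) *\<^sub>R frechet_derivative f (at (g x)) b)"
    using assms by (intro Ck_sum Ck_scaleR Ck_inner_left)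
  show "(\<Sum>b\<in>Basis. (h x \<bullet> b) *\<^sub>R frechet_derivative f (at (g x)) b) = frechet_derivative f (at (g x)) (h x)"
    if "x \<in> S" for x
    using assms(2,4) that by (simp add: frechet_derivative_expand[symmetric])
qed

lemma Ck_Suc_I:
  assumes "\<And>x. x \<in> S \<Longrightarrow> (f has_derivative f' x) (at x)" "open S"
    "\<And>e. e \<in> Basis \<Longrightarrow> Ck k S (\<lambda>x. f' x e)"
  shows "Ck (Suc k) S f"
proof -
  have "Ck k S (\<lambda>x. frechet_derivative f (at x) e)" if "e \<in> Basis" for e
    by (rule Ck_cong[OF assms(2) _ assms(3)[OF that]]) (simp add: frechet_derivative_at[OF assms(1)])
  then show ?thesis using assms(1) by (auto simp: differentiable_def)
qed

text \<open>
  On the plane, Frechet differentiability is obtained from the two partial derivatives; continuity of one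
  of them is enough. Solutions of integral equations are differentiated one variable at a time, so this is how
  their class is recognised.
\<close>

lemma has_derivative_plane:
  fixes f :: "real \<times> real \<Rightarrow> 'b::real_normed_vector"
  assumes "open S"
    and fx: "\<And>x t. (x, t) \<in> S \<Longrightarrow> ((\<lambda>x. f (x, t)) has_vector_derivative fx (x, t)) (at x)"
    and ft: "\<And>x t. (x, t) \<in> S \<Longrightarrow> ((\<lambda>t. f (x, t)) has_vector_derivative ft (x, t)) (at t)"
    and cont: "continuous_on S ft" and q: "q \<in> S"
  shows "(f has_derivative (\<lambda>h. fst h *\<^sub>R fx q + snd h *\<^sub>R ft q)) (at q)"
proof -
  obtain x0 t0 where q0: "q = (x0, t0)" by (cases q)
  obtain A B where "open A" "open B" "q \<in> A \<times> B" and ABS: "A \<times> B \<subseteq> S"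
    using open_prod_elim[OF assms(1) q] by metis
  then have AB: "open A" "open B" "x0 \<in> A" "t0 \<in> B" by (auto simp: q0)
  obtain e where e: "e > 0" "ball t0 e \<subseteq> B" using AB(2,4) open_contains_ball by blast
  have sub: "A \<times> ball t0 e \<subseteq> S" using ABS e by auto
  have "((\<lambda>(x, t). f (x, t)) has_derivative (\<lambda>(tx, ty). tx *\<^sub>R fx q + blinfun_scaleR_left (ft (x0, t0)) ty)) 
      (at (x0, t0) within A \<times> ball t0 e)"
  proof (rule has_derivative_partialsI)
    show "((\<lambda>x. f (x, t0)) has_derivative (\<lambda>tx. tx *\<^sub>R fx q)) (at x0 within A)"
      using fx[of x0 t0] q q0 by (auto simp: has_vector_derivative_def intro: has_derivative_at_withinI)
    show "((\<lambda>t. f (x, t)) has_derivative blinfun_apply (blinfun_scaleR_left (ft (x, t)))) (at t within ball t0 e)"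
      if "x \<in> A" "t \<in> ball t0 e" for x t
    proof -
      have "(x, t) \<in> S" using that sub by auto
      from ft[OF this] show ?thesis by (simp add: has_vector_derivative_def has_derivative_at_withinI)
    qed
    have "continuous_on S (\<lambda>p. blinfun_scaleR_left (ft p))"
      using cont by (intro bounded_linear.continuous_on[OF bounded_linear_blinfun_scaleR_left])
    then have "continuous (at (x0, t0) within S) (\<lambda>p. blinfun_scaleR_left (ft p))"
      using q q0 by (simp add: continuous_on_eq_continuous_within)
    then show "continuous (at (x0, t0) within A \<times> ball t0 e) (\<lambda>(x, t). blinfun_scaleR_left (ft (x, t)))"
      using continuous_within_subset[OF _ sub] by (simp add: case_prod_unfold)
  qed (use e in auto)
  moreover have "at (x0, t0) within A \<times> ball t0 e = at (x0, t0)"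
    by (rule at_within_open) (use AB e in \<open>auto intro: open_Times\<close>)
  ultimately show ?thesis
    unfolding q0 by (simp only: case_prod_unfold blinfun_scaleR_left.rep_eq prod.collapse)
qed

lemma Basis_plane: "(Basis :: (real \<times> real) set) = {(1, 0), (0, 1)}"
  by (auto simp: Basis_prod_def)

lemma Ck_Suc_plane:
  fixes f :: "real \<times> real \<Rightarrow> 'b::real_normed_vector"
  assumes "open S"
    and "\<And>x t. (x, t) \<in> S \<Longrightarrow> ((\<lambda>x. f (x, t)) has_vector_derivative fx (x, t)) (at x)"
    and "\<And>x t. (x, t) \<in> S \<Longrightarrow> ((\<lambda>t. f (x, t)) has_vector_derivative ft (x, t)) (at t)"
    and "Ck k S fx" "Ck k S ft"
  shows "Ck (Suc k) S f"
proof (rule Ck_Suc_I)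
  show "(f has_derivative (\<lambda>h. fst h *\<^sub>R fx q + snd h *\<^sub>R ft q)) (at q)" if "q \<in> S" for q
    using assms(1-3) Ck_continuous[OF assms(5)] that by (rule has_derivative_plane)
  show "Ck k S (\<lambda>q. fst e *\<^sub>R fx q + snd e *\<^sub>R ft q)" if "e \<in> Basis" for e
    using that assms(4,5) by (auto simp: Basis_plane)
qed (rule assms(1))

lemma has_vector_derivative_partials:
  fixes f :: "real \<times> real \<Rightarrow> 'b::real_normed_vector"
  assumes "f differentiable (at (x, t))"
  shows "((\<lambda>x. f (x, t)) has_vector_derivative frechet_derivative f (at (x, t)) (1, 0)) (at x)"
    and "((\<lambda>t. f (x, t)) has_vector_derivative frechet_derivative f (at (x, t)) (0, 1)) (at t)"
proof -
  let ?D = "frechet_derivative f (at (x, t))"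
  have d: "(f has_derivative ?D) (at (x, t))" using assms by (simp only: frechet_derivative_works)
  interpret linear ?D by (rule has_derivative_linear[OF d])
  have *: "?D (h, 0) = h *\<^sub>R ?D (1, 0)" "?D (0, h) = h *\<^sub>R ?D (0, 1)" for h
    using scale[of h "(1, 0)"] scale[of h "(0, 1)"] by auto
  have eq: "(\<lambda>h. ?D (h, 0)) = (\<lambda>h. h *\<^sub>R ?D (1, 0))" "(\<lambda>h. ?D (0, h)) = (\<lambda>h. h *\<^sub>R ?D (0, 1))"
    by (rule ext, rule *)+
  have "((\<lambda>x. (x, t)) has_derivative (\<lambda>h. (h, 0))) (at x)" by (rule has_derivative_Pair[OF has_derivative_ident has_derivative_const])
  from has_derivative_compose[OF this d] eq(1)
  show "((\<lambda>x. f (x, t)) has_vector_derivative ?D (1, 0)) (at x)"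
    by (simp only: has_vector_derivative_def)
  have "((\<lambda>t. (x, t)) has_derivative (\<lambda>h. (0, h))) (at t)" by (rule has_derivative_Pair[OF has_derivative_const has_derivative_ident])
  from has_derivative_compose[OF this d] eq(2)
  show "((\<lambda>t. f (x, t)) has_vector_derivative ?D (0, 1)) (at t)"
    by (simp only: has_vector_derivative_def)
qed

section \<open>Integrals along the coordinate lines\<close>

text \<open>
  The oriented integral of \<open>g\<close> from \<open>0\<close> to \<open>x\<close> is written as \<open>x\<close> times an integral over \<open>{0..1}\<close>. This form
  makes sense for both signs of \<open>x\<close> and keeps the domain of integration fixed, so that parameter integrals
  can be differentiated under the integral sign.
\<close>

lemma has_vector_derivative_scaled_integral:
  fixes g :: "real \<Rightarrow> 'b::banach"
  assumes g: "continuous_on {-r<..<r} g" and x: "\<bar>x\<bar> < r"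
  shows "((\<lambda>x. x *\<^sub>R integral {0..1} (\<lambda>s. g (s * x))) has_vector_derivative g x) (at x)"
proof -
  obtain r' where r': "\<bar>x\<bar> < r'" "r' < r" using dense[OF x] by blast
  have "continuous_on {-r'..r'} g" using g by (rule continuous_on_subset) (use r' in auto)
  then obtain G where G: "\<And>x. x \<in> {-r'..r'} \<Longrightarrow> (G has_vector_derivative g x) (at x within {-r'..r'})"
    using antiderivative_continuous by blast
  have eq: "G x - G 0 = x *\<^sub>R integral {0..1} (\<lambda>s. g (s * x))" if "x \<in> {-r'<..<r'}" for x
  proof -
    have in_range: "s * x \<in> {-r'..r'}" if "s \<in> {0..1}" for s
    proof -
      have "\<bar>s * x\<bar> \<le> 1 * \<bar>x\<bar>" unfolding abs_mult by (rule mult_right_mono) (use that in auto)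
      then show ?thesis using \<open>x \<in> {-r'<..<r'}\<close> by (auto simp: abs_le_iff)
    qed
    have "((\<lambda>s. x *\<^sub>R g (s * x)) has_integral G (1 * x) - G (0 * x)) {0..1}"
    proof (rule fundamental_theorem_of_calculus)
      show "((\<lambda>s. G (s * x)) has_vector_derivative x *\<^sub>R g (s * x)) (at s within {0..1})" if "s \<in> {0..1}" for s
      proof -
        have "((\<lambda>s. s * x) has_vector_derivative x) (at s within {0..1})"
          by (auto intro!: derivative_eq_intros)
        moreover have "(G has_vector_derivative g (s * x)) (at (s * x) within (\<lambda>s. s * x) ` {0..1})"
          by (rule has_vector_derivative_within_subset[OF G[OF in_range[OF that]]]) (use in_range in blast)
        ultimately show ?thesis using vector_diff_chain_within[of "\<lambda>s. s * x"] by (simp add: o_def)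
      qed
    qed simp
    then show ?thesis by (simp add: integral_unique[symmetric] flip: integral_cmul)
  qed
  have "(G has_vector_derivative g x) (at x)"
    using G[of x] r' at_within_interior[of x "{-r'..r'}"] by (simp add: abs_less_iff)
  then have "((\<lambda>x. G x - G 0) has_vector_derivative g x) (at x)"
    by (auto intro!: derivative_eq_intros)
  then show ?thesis
    by (rule has_vector_derivative_transform_within_open[where S="{-r'<..<r'}"])
      (use eq r' in \<open>auto simp: abs_less_iff\<close>)
qed

abbreviation osquare :: "real \<Rightarrow> (real \<times> real) set" where
  "osquare r \<equiv> {-r<..<r} \<times> {-r<..<r}"

abbreviation csquare :: "real \<Rightarrow> (real \<times> real) set" where
  "csquare r \<equiv> {-r..r} \<times> {-r..r}"

lemma scaled_in:
  fixes s x r :: real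
  assumes "s \<in> {0..1}"
  shows "x \<in> {-r..r} \<Longrightarrow> s * x \<in> {-r..r}" "x \<in> {-r<..<r} \<Longrightarrow> s * x \<in> {-r<..<r}"
proof -
  have "\<bar>s * x\<bar> \<le> 1 * \<bar>x\<bar>" unfolding abs_mult by (rule mult_right_mono) (use assms in auto)
  then show "x \<in> {-r..r} \<Longrightarrow> s * x \<in> {-r..r}" "x \<in> {-r<..<r} \<Longrightarrow> s * x \<in> {-r<..<r}" by auto
qed

lemma continuous_on_integral_x:
  fixes g :: "real \<times> real \<Rightarrow> 'b::banach"
  assumes "continuous_on (A \<times> B) g" "\<And>s x. s \<in> {0..1} \<Longrightarrow> x \<in> A \<Longrightarrow> s * x \<in> A"
  shows "continuous_on (A \<times> B) (\<lambda>q. integral {0..1} (\<lambda>s. g (s * fst q, snd q)))"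
proof -
  have "continuous_on ((A \<times> B) \<times> cbox 0 1) (\<lambda>(q, s). g (s * fst q, snd q))"
    unfolding case_prod_unfold
    by (rule continuous_on_compose2[OF assms(1)]) (use assms(2) in \<open>auto intro!: continuous_intros\<close>)
  from integral_continuous_on_param[OF this] show ?thesis by simp
qed

lemma continuous_on_integral_t:
  fixes g :: "real \<times> real \<Rightarrow> 'b::banach"
  assumes "continuous_on (A \<times> B) g" "\<And>s x. s \<in> {0..1} \<Longrightarrow> x \<in> B \<Longrightarrow> s * x \<in> B"
  shows "continuous_on (A \<times> B) (\<lambda>q. integral {0..1} (\<lambda>s. g (fst q, s * snd q)))"
proof -
  have "continuous_on ((A \<times> B) \<times> cbox 0 1) (\<lambda>(q, s). g (fst q, s * snd q))"
    unfolding case_prod_unfold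
    by (rule continuous_on_compose2[OF assms(1)]) (use assms(2) in \<open>auto intro!: continuous_intros\<close>)
  from integral_continuous_on_param[OF this] show ?thesis by simp
qed

lemma has_vector_derivative_integral_x:
  fixes f :: "real \<times> real \<Rightarrow> 'b::euclidean_space"
  assumes cf: "continuous_on (osquare r) f" and ft: "continuous_on (osquare r) ft"
    and der: "\<And>x t. (x, t) \<in> osquare r \<Longrightarrow> ((\<lambda>t. f (x, t)) has_vector_derivative ft (x, t)) (at t)"
    and xt: "(x, t) \<in> osquare r"
  shows "((\<lambda>t. x *\<^sub>R integral {0..1} (\<lambda>s. f (s * x, t))) has_vector_derivative
     x *\<^sub>R integral {0..1} (\<lambda>s. ft (s * x, t))) (at t)"
proof -
  have "((\<lambda>t. integral (cbox 0 1) (\<lambda>s. f (s * x, t))) has_vector_derivative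
      integral (cbox 0 1) (\<lambda>s. ft (s * x, t))) (at t within {-r<..<r})"
  proof (rule leibniz_rule_vector_derivative)
    show "((\<lambda>t. f (s * x, t)) has_vector_derivative ft (s * x, t)) (at t within {-r<..<r})"
      if "t \<in> {-r<..<r}" "s \<in> cbox 0 1" for t s
    proof -
      have "(s * x, t) \<in> osquare r" using scaled_in(2)[of s x r] that xt by auto
      from der[OF this] show ?thesis by (rule has_vector_derivative_at_within)
    qed
    show "(\<lambda>s. f (s * x, t)) integrable_on cbox 0 1" if "t \<in> {-r<..<r}" for t
      by (rule integrable_continuous, rule continuous_on_compose2[OF cf])
        (use xt that scaled_in(2)[of _ x r] in \<open>auto intro!: continuous_intros\<close>)
    show "continuous_on ({-r<..<r} \<times> cbox 0 1) (\<lambda>(t, s). ft (s * x, t))"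
      unfolding case_prod_unfold
      by (rule continuous_on_compose2[OF ft])
        (use xt scaled_in(2)[of _ x r] in \<open>auto intro!: continuous_intros\<close>)
  qed (use xt in auto)
  then have "((\<lambda>t. integral {0..1} (\<lambda>s. f (s * x, t))) has_vector_derivative
      integral {0..1} (\<lambda>s. ft (s * x, t))) (at t)"
    using xt at_within_open[of t "{-r<..<r}"] by auto
  then show ?thesis
    by (rule bounded_linear.has_vector_derivative[OF bounded_linear_scaleR_right])
qed

text \<open>
  The \<open>x\<close>-derivative of the integral is \<open>f\<close> itself, and its \<open>t\<close>-derivative is the same integral of \<open>\<partial>\<^sub>t f\<close>, which
  allows induction on \<open>k\<close>.
\<close>

lemma Ck_integral_x:
  fixes f :: "real \<times> real \<Rightarrow> 'b::euclidean_space"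
  assumes "Ck k (osquare r) f"
  shows "Ck k (osquare r) (\<lambda>q. fst q *\<^sub>R integral {0..1} (\<lambda>s. f (s * fst q, snd q)))"
  using assms
proof (induction k arbitrary: f)
  case 0
  then show ?case
    using continuous_on_integral_x[OF _ scaled_in(2)] by (auto intro!: continuous_intros)
next
  case (Suc k)
  have op: "open (osquare r)" by (simp add: open_Times)
  let ?ft = "\<lambda>q. frechet_derivative f (at q) (0, 1)"
  have ft: "Ck k (osquare r) ?ft" using Suc.prems by (simp add: Basis_plane)
  have cf: "continuous_on (osquare r) f" by (rule Ck_continuous[OF Suc.prems])
  show ?case
  proof (rule Ck_Suc_plane[OF op])
    fix x t assume xt: "(x, t) \<in> osquare r"
    have "continuous_on {-r<..<r} (\<lambda>x. f (x, t))"
      by (rule continuous_on_compose2[OF cf]) (use xt in \<open>auto intro!: continuous_intros\<close>)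
    then show "((\<lambda>x. fst (x, t) *\<^sub>R integral {0..1} (\<lambda>s. f (s * fst (x, t), snd (x, t)))) has_vector_derivative f (x, t)) (at x)"
      using has_vector_derivative_scaled_integral[of r "\<lambda>x. f (x, t)" x] xt by auto
    show "((\<lambda>t. fst (x, t) *\<^sub>R integral {0..1} (\<lambda>s. f (s * fst (x, t), snd (x, t)))) has_vector_derivative 
        (fst (x, t) *\<^sub>R integral {0..1} (\<lambda>s. ?ft (s * fst (x, t), snd (x, t))))) (at t)"
      unfolding fst_conv snd_conv
    proof (rule has_vector_derivative_integral_x[OF cf Ck_continuous[OF ft] _ xt])
      show "((\<lambda>t. f (x, t)) has_vector_derivative ?ft (x, t)) (at t)" if "(x, t) \<in> osquare r" for x t
        by (rule has_vector_derivative_partials(2)) (use Suc.prems that in simp)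
    qed
  qed (use Suc.IH[OF ft] Ck_Suc_D[OF Suc.prems] in auto)
qed

section \<open>Integral equations on a square\<close>

lemma linear_norm_le_sum_Basis:
  fixes f :: "'a::euclidean_space \<Rightarrow> 'b::real_normed_vector"
  assumes "linear f"
  shows "norm (f h) \<le> (\<Sum>b\<in>Basis. norm (f b)) * norm h"
proof -
  interpret linear f by fact
  have "f h = f (\<Sum>b\<in>Basis. (h \<bullet> b) *\<^sub>R b)" by (simp only: euclidean_representation)
  also have "\<dots> = (\<Sum>b\<in>Basis. (h \<bullet> b) *\<^sub>R f b)" by (simp only: sum scale)
  also have "norm \<dots> \<le> (\<Sum>b\<in>Basis. \<bar>h \<bullet> b\<bar> * norm (f b))"
    by (rule norm_sum[THEN order_trans]) simp
  also have "\<dots> \<le> (\<Sum>b\<in>Basis. norm h * norm (f b))"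
    by (intro sum_mono mult_right_mono) (auto simp: Basis_le_norm)
  finally show ?thesis by (simp add: sum_distrib_left mult.commute)
qed

text \<open>
  The derivative is continuous, so near each point of \<open>C\<close> it varies by little; a Lebesgue number of the
  corresponding cover of the compact set \<open>C\<close> makes the radius uniform.
\<close>

lemma C1_uniformly_differentiable:
  fixes f :: "'a::euclidean_space \<Rightarrow> 'b::real_normed_vector"
  assumes "open \<Omega>" "Ck (Suc 0) \<Omega> f" "compact C" "C \<subseteq> \<Omega>" "\<epsilon> > 0"
  obtains \<delta> where "\<delta> > 0" "\<And>X X'. X \<in> C \<Longrightarrow> dist X' X < \<delta> \<Longrightarrow>
    X' \<in> \<Omega> \<and> norm (f X' - f X - frechet_derivative f (at X) (X' - X)) \<le> \<epsilon> * norm (X' - X)"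
proof -
  define D where "D x = frechet_derivative f (at x)" for x
  have fD: "(f has_derivative D x) (at x)" if "x \<in> \<Omega>" for x
    using assms(2) that by (simp add: D_def frechet_derivative_works[symmetric])
  have cont: "continuous_on \<Omega> (\<lambda>x. D x b)" if "b \<in> Basis" for b
    using assms(2) that by (simp add: D_def)
  have near: "\<exists>d>0. ball X d \<subseteq> \<Omega> \<and> (\<forall>x\<in>ball X d. \<forall>b\<in>Basis. norm (D x b - D X b) \<le> \<epsilon> / (2 * DIM('a)))"
    if X: "X \<in> \<Omega>" for X
  proof -
    have "\<forall>\<^sub>F x in at X. norm (D x b - D X b) \<le> \<epsilon> / (2 * DIM('a))" if "b \<in> Basis" for b
    proof -
      have "((\<lambda>x. D x b) \<longlongrightarrow> D X b) (at X)"
        using cont[OF that] assms(1) X by (simp add: continuous_on_eq_continuous_at continuous_at)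
      from tendstoD[OF this, of "\<epsilon> / (2 * DIM('a))"] assms(5)
      have "\<forall>\<^sub>F x in at X. dist (D x b) (D X b) < \<epsilon> / (2 * DIM('a))" by simp
      then show ?thesis by eventually_elim (simp add: dist_norm)
    qed
    then have "\<forall>\<^sub>F x in at X. \<forall>b\<in>Basis. norm (D x b - D X b) \<le> \<epsilon> / (2 * DIM('a))"
      by (simp add: eventually_ball_finite_distrib)
    moreover have "\<forall>\<^sub>F x in at X. x \<in> \<Omega>" using assms(1) X by (rule eventually_at_in_open')
    ultimately have "\<forall>\<^sub>F x in at X. x \<in> \<Omega> \<and> (\<forall>b\<in>Basis. norm (D x b - D X b) \<le> \<epsilon> / (2 * DIM('a)))"
      by eventually_elim simp
    then obtain d where d: "d > 0" "\<And>x. x \<noteq> X \<Longrightarrow> dist x X < d \<Longrightarrow>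
      x \<in> \<Omega> \<and> (\<forall>b\<in>Basis. norm (D x b - D X b) \<le> \<epsilon> / (2 * DIM('a)))"
      unfolding eventually_at by blast
    have "x \<in> \<Omega> \<and> (\<forall>b\<in>Basis. norm (D x b - D X b) \<le> \<epsilon> / (2 * DIM('a)))" if "x \<in> ball X d" for x
      using d(2)[of x] X that assms(5) by (cases "x = X") (auto simp: dist_commute)
    then show ?thesis using d(1) by blast
  qed
  then obtain d where d: "\<And>X. X \<in> \<Omega> \<Longrightarrow> d X > 0 \<and> ball X (d X) \<subseteq> \<Omega> \<and>
      (\<forall>x\<in>ball X (d X). \<forall>b\<in>Basis. norm (D x b - D X b) \<le> \<epsilon> / (2 * DIM('a)))" by metis
  have "C \<subseteq> \<Union> ((\<lambda>X. ball X (d X)) ` C)" using d assms(4) by fastforce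
  from Heine_Borel_lemma[OF assms(3) this]
  obtain \<delta> where \<delta>: "\<delta> > 0" "\<And>X. X \<in> C \<Longrightarrow> \<exists>G\<in>(\<lambda>X. ball X (d X)) ` C. ball X \<delta> \<subseteq> G"
    by (auto simp only: image_iff open_ball)
  show ?thesis
  proof (rule that[OF \<delta>(1)])
    fix X X' assume X: "X \<in> C" "dist X' X < \<delta>"
    then obtain Y where Y: "Y \<in> C" "ball X \<delta> \<subseteq> ball Y (d Y)" using \<delta>(2) by blast
    then have Y\<Omega>: "Y \<in> \<Omega>" using assms(4) by blast
    have sub: "ball X \<delta> \<subseteq> \<Omega>" using Y d[OF Y\<Omega>] by blast
    have bound: "onorm (\<lambda>h. D x h - D X h) \<le> \<epsilon>" if "x \<in> ball X \<delta>" for x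
    proof (rule onorm_le)
      fix h
      have "linear (\<lambda>h. D x h - D X h)"
        using fD[of x] fD[of X] that X assms(4) sub
        by (intro linear_compose_sub) (auto intro!: has_derivative_linear)
      from linear_norm_le_sum_Basis[OF this]
      have "norm (D x h - D X h) \<le> (\<Sum>b\<in>Basis. norm (D x b - D X b)) * norm h" .
      also have "\<dots> \<le> (\<Sum>b\<in>(Basis::'a set). \<epsilon> / DIM('a)) * norm h"
      proof (intro mult_right_mono sum_mono)
        fix b :: 'a assume b: "b \<in> Basis"
        have "X \<in> ball X \<delta>" using \<delta>(1) by simp
        then have "norm (D x b - D Y b) \<le> \<epsilon> / (2 * DIM('a))" "norm (D X b - D Y b) \<le> \<epsilon> / (2 * DIM('a))"
          using d[OF Y\<Omega>] Y(2) that b by blast+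
        then have "norm ((D x b - D Y b) - (D X b - D Y b)) \<le> \<epsilon> / (2 * DIM('a)) + \<epsilon> / (2 * DIM('a))"
          using norm_triangle_ineq4 by (smt (verit))
        then show "norm (D x b - D X b) \<le> \<epsilon> / DIM('a)" by simp
      qed simp
      also have "\<dots> = \<epsilon> * norm h" by simp
      finally show "norm (D x h - D X h) \<le> \<epsilon> * norm h" .
    qed
    have X': "X' \<in> ball X \<delta>" using X by (simp add: dist_commute)
    have "norm (f X' - f X - D X (X' - X)) \<le> norm (X' - X) * \<epsilon>"
    proof (rule differentiable_bound_linearization[where S="ball X \<delta>"])
      show "X + t *\<^sub>R (X' - X) \<in> ball X \<delta>" if "t \<in> {0..1}" for t
      proof -
        have "norm (t *\<^sub>R (X' - X)) \<le> 1 * norm (X' - X)"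
          unfolding norm_scaleR by (rule mult_right_mono) (use that in auto)
        then show ?thesis using X(2) by (simp add: dist_norm)
      qed
      show "(f has_derivative D x) (at x within ball X \<delta>)" if "x \<in> ball X \<delta>" for x
        by (rule has_derivative_at_withinI, rule fD) (use sub that in blast)
      show "onorm (D x - D X) \<le> \<epsilon>" if "x \<in> ball X \<delta>" for x
        using bound[OF that] by (simp add: fun_diff_def)
    qed (use \<delta>(1) in simp)
    then show "X' \<in> \<Omega> \<and> norm (f X' - f X - frechet_derivative f (at X) (X' - X)) \<le> \<epsilon> * norm (X' - X)"
      using X' sub by (auto simp: D_def mult.commute)
  qed
qed

lemma norm_integral_unit_le:
  fixes f :: "real \<Rightarrow> 'b::euclidean_space"
  assumes "continuous_on {0..1} f" "\<And>s. s \<in> {0..1} \<Longrightarrow> norm (f s) \<le> M"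
  shows "norm (integral {0..1} f) \<le> M"
  using integral_bound[of 0 1 f M] assms by simp

text \<open>
  The solution is the fixed point of a contraction. The same equation covers the Goursat problem (\<open>Hx\<close> and \<open>Ht\<close> integrated along the two
  characteristics) and linear ordinary differential equations with a parameter (\<open>Hx = 0\<close>). Because
  \<open>r * L \<le> 1 / 4\<close>, the operator \<open>T\<close> contracts by the factor \<open>1 / 2\<close>.
\<close>

lemma integral_fixpoint:
  fixes Hx Ht :: "real \<times> real \<Rightarrow> 'a::euclidean_space \<Rightarrow> 'a" and c :: "real \<times> real \<Rightarrow> 'a"
  defines "T \<equiv> \<lambda>w q. c q + fst q *\<^sub>R integral {0..1} (\<lambda>s. Hx (s * fst q, snd q) (w (s * fst q, snd q)))
                        + snd q *\<^sub>R integral {0..1} (\<lambda>s. Ht (fst q, s * snd q) (w (fst q, s * snd q)))"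
  assumes r: "r \<ge> 0" and B: "closed B" "B \<noteq> {}"
    and c: "continuous_on (csquare r) c"
    and Hx: "continuous_on (csquare r \<times> B) (\<lambda>(q, w). Hx q w)"
    and Ht: "continuous_on (csquare r \<times> B) (\<lambda>(q, w). Ht q w)"
    and Lx: "\<And>q w w'. q \<in> csquare r \<Longrightarrow> w \<in> B \<Longrightarrow> w' \<in> B \<Longrightarrow> norm (Hx q w - Hx q w') \<le> L * norm (w - w')"
    and Lt: "\<And>q w w'. q \<in> csquare r \<Longrightarrow> w \<in> B \<Longrightarrow> w' \<in> B \<Longrightarrow> norm (Ht q w - Ht q w') \<le> L * norm (w - w')"
    and L: "L \<ge> 0" "r * L \<le> 1 / 4"
    and inv: "\<And>w q. continuous_on (csquare r) w \<Longrightarrow> w ` csquare r \<subseteq> B \<Longrightarrow> q \<in> csquare r \<Longrightarrow> T w q \<in> B"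
  shows "\<exists>w. continuous_on (csquare r) w \<and> w ` csquare r \<subseteq> B \<and> (\<forall>q\<in>csquare r. w q = T w q)"
proof -
  \<comment> \<open>Clamping to the square turns functions on the square into bounded continuous functions on the whole
    plane, which form a complete metric space.\<close>
  define cl where "cl = clamp (-r, -r) (r, r)"
  have Q: "csquare r = cbox (-r, -r) (r, r)" by (simp add: cbox_Pair_eq)
  have cl_in: "cl q \<in> csquare r" for q
    unfolding cl_def Q by (rule clamp_in_interval) (use r in \<open>auto simp: Basis_plane\<close>)
  have cl_id: "cl q = q" if "q \<in> csquare r" for q
    using that unfolding cl_def Q by simp
  have contx: "continuous_on (csquare r) (\<lambda>q. Hx q (w q))"
    and contt: "continuous_on (csquare r) (\<lambda>q. Ht q (w q))"
    if "continuous_on (csquare r) w" "w ` csquare r \<subseteq> B" for w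
  proof -
    have g: "continuous_on (csquare r) (\<lambda>q. (q, w q))" "(\<lambda>q. (q, w q)) ` csquare r \<subseteq> csquare r \<times> B"
      using that by (auto intro!: continuous_on_Pair continuous_on_id)
    show "continuous_on (csquare r) (\<lambda>q. Hx q (w q))" using continuous_on_compose2[OF Hx g] by simp
    show "continuous_on (csquare r) (\<lambda>q. Ht q (w q))" using continuous_on_compose2[OF Ht g] by simp
  qed
  have contT: "continuous_on (csquare r) (T w)"
    if "continuous_on (csquare r) w" "w ` csquare r \<subseteq> B" for w
    unfolding T_def
    by (intro continuous_on_add c continuous_on_scaleR continuous_on_fst continuous_on_snd continuous_on_id
        continuous_on_integral_x[OF contx[OF that]] continuous_on_integral_t[OF contt[OF that]] scaled_in(1))
  define \<Phi> where "\<Phi> w = Bcontfun (\<lambda>q. T (apply_bcontfun w) (cl q))" for w :: "(real \<times> real) \<Rightarrow>\<^sub>C 'a"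
  define S where "S = PiC (UNIV :: (real \<times> real) set) (\<lambda>_. B)"
  have wB: "apply_bcontfun w q \<in> B" if "w \<in> S" for w q
    using that by (auto simp: S_def mem_PiC_iff)
  have \<Phi>: "apply_bcontfun (\<Phi> w) q = T (apply_bcontfun w) (cl q)" if "w \<in> S" for w q
  proof -
    have cT: "continuous_on (cbox (-r, -r) (r, r)) (T (apply_bcontfun w))"
      unfolding Q[symmetric] by (rule contT) (use wB[OF that] in auto)
    have "(\<lambda>q. T (apply_bcontfun w) (cl q)) \<in> bcontfun"
      unfolding bcontfun_def mem_Collect_eq cl_def
      using clamp_continuous_on[OF cT] clamp_bounded[OF compact_imp_bounded[OF compact_continuous_image[OF cT compact_cbox]]]
      by blast
    then show ?thesis by (simp add: \<Phi>_def Bcontfun_inverse)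
  qed
  have "\<exists>!w\<in>S. \<Phi> w = w"
  proof (rule Banach_fix)
    show "complete S"
      unfolding complete_eq_closed S_def using B(1) by (rule closed_PiC)
    obtain b where "b \<in> B" using B(2) by blast
    then have "const_bcontfun b \<in> S" by (simp add: S_def mem_PiC_iff const_bcontfun.rep_eq)
    then show "S \<noteq> {}" by blast
    show "\<Phi> ` S \<subseteq> S"
      using inv cl_in wB by (auto simp: S_def mem_PiC_iff \<Phi>[unfolded S_def] image_subset_iff)
    show "dist (\<Phi> v) (\<Phi> w) \<le> (1/2) * dist v w" if vw: "v \<in> S" "w \<in> S" for v w
    proof (rule dist_bound)
      fix q'
      define q where "q = cl q'"
      have q: "q \<in> csquare r" using cl_in by (simp add: q_def)
      have pw: "norm (v p - w p) \<le> dist v w" for p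
        using dist_bounded[of v p w] by (simp add: dist_norm)
      have cv: "continuous_on (csquare r) v" "v ` csquare r \<subseteq> B" "continuous_on (csquare r) w" "w ` csquare r \<subseteq> B"
        using wB vw by auto
      have inx: "(s * fst q, snd q) \<in> csquare r" and int: "(fst q, s * snd q) \<in> csquare r" if "s \<in> {0..1}" for s
        using scaled_in(1)[OF that] q by (auto simp: mem_Times_iff)
      have ix: "continuous_on {0..1} (\<lambda>s. Hx (s * fst q, snd q) (u (s * fst q, snd q)))"
        and it: "continuous_on {0..1} (\<lambda>s. Ht (fst q, s * snd q) (u (fst q, s * snd q)))"
        if "u = v \<or> u = w" for u :: "(real \<times> real) \<Rightarrow>\<^sub>C 'a"
      proof -
        have cu: "continuous_on (csquare r) u" "u ` csquare r \<subseteq> B" using that cv by auto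
        have 1: "continuous_on {0..1} (\<lambda>s. (s * fst q, snd q))" "(\<lambda>s. (s * fst q, snd q)) ` {0..1} \<subseteq> csquare r"
          using inx by (auto intro!: continuous_intros)
        have 2: "continuous_on {0..1} (\<lambda>s. (fst q, s * snd q))" "(\<lambda>s. (fst q, s * snd q)) ` {0..1} \<subseteq> csquare r"
          using int by (auto intro!: continuous_intros)
        show "continuous_on {0..1} (\<lambda>s. Hx (s * fst q, snd q) (u (s * fst q, snd q)))"
          by (rule continuous_on_compose2[OF contx[OF cu] 1])
        show "continuous_on {0..1} (\<lambda>s. Ht (fst q, s * snd q) (u (fst q, s * snd q)))"
          by (rule continuous_on_compose2[OF contt[OF cu] 2])
      qed
      let ?dx = "\<lambda>s. Hx (s * fst q, snd q) (v (s * fst q, snd q)) - Hx (s * fst q, snd q) (w (s * fst q, snd q))"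
      let ?dt = "\<lambda>s. Ht (fst q, s * snd q) (v (fst q, s * snd q)) - Ht (fst q, s * snd q) (w (fst q, s * snd q))"
      have nx: "norm (integral {0..1} ?dx) \<le> L * dist v w"
      proof (rule norm_integral_unit_le)
        show "norm (?dx s) \<le> L * dist v w" if "s \<in> {0..1}" for s
          using Lx[OF inx[OF that] wB[OF vw(1)] wB[OF vw(2)]] mult_left_mono[OF pw L(1)] by (rule order_trans)
      qed (intro continuous_on_diff ix; simp)
      have nt: "norm (integral {0..1} ?dt) \<le> L * dist v w"
      proof (rule norm_integral_unit_le)
        show "norm (?dt s) \<le> L * dist v w" if "s \<in> {0..1}" for s
          using Lt[OF int[OF that] wB[OF vw(1)] wB[OF vw(2)]] mult_left_mono[OF pw L(1)] by (rule order_trans)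
      qed (intro continuous_on_diff it; simp)
      have Tdiff: "T v q - T w q = fst q *\<^sub>R integral {0..1} ?dx + snd q *\<^sub>R integral {0..1} ?dt"
        using integral_diff[OF integrable_continuous_interval[OF ix[of v]] integrable_continuous_interval[OF ix[of w]]]
          integral_diff[OF integrable_continuous_interval[OF it[of v]] integrable_continuous_interval[OF it[of w]]]
        by (simp add: T_def scaleR_diff_right)
      have "norm (T v q - T w q) \<le> \<bar>fst q\<bar> * norm (integral {0..1} ?dx) + \<bar>snd q\<bar> * norm (integral {0..1} ?dt)"
        unfolding Tdiff by (rule norm_triangle_ineq[THEN order_trans]) simp
      also have "\<dots> \<le> r * (L * dist v w) + r * (L * dist v w)"
        using q r by (intro add_mono mult_mono nx nt) (auto simp: mem_Times_iff abs_le_iff)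
      also have "\<dots> = 2 * (r * L) * dist v w" by (simp add: algebra_simps)
      also have "\<dots> \<le> 2 * (1 / 4) * dist v w"
        by (intro mult_right_mono mult_left_mono L(2)) auto
      finally show "dist (\<Phi> v q') (\<Phi> w q') \<le> 1 / 2 * dist v w"
        by (simp add: \<Phi>[OF vw(1)] \<Phi>[OF vw(2)] q_def dist_norm)
    qed
  qed auto
  then obtain w where w: "w \<in> S" "\<Phi> w = w" by blast
  show ?thesis
  proof (intro exI conjI ballI)
    show "continuous_on (csquare r) (apply_bcontfun w)" by simp
    show "apply_bcontfun w ` csquare r \<subseteq> B" using wB[OF w(1)] by blast
    show "w q = T w q" if "q \<in> csquare r" for q
      using \<Phi>[OF w(1), of q] w(2) cl_id[OF that] by simp
  qed
qed

text \<open>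
  For fixed \<open>x\<close>, the function \<open>w (x, \<cdot>)\<close> solves the ordinary differential equation \<open>w\<^sub>t = K\<close> with
  initial value \<open>c x\<close>. Its derivative in the parameter \<open>x\<close> is the solution \<open>y\<close> of the equation
  obtained by formal differentiation: that equation is linear, hence solvable on the whole square, and a
  Gronwall type estimate shows that \<open>w (x + h, t) - w (x, t) - h y (x, t)\<close> is of smaller order than \<open>h\<close>.
  The bound \<open>r * L \<le> 1 / 4\<close>, which involves the derivative of \<open>K\<close> in \<open>w\<close> only, replaces the
  exponential factor of Gronwall's inequality.
\<close>

lemma parameter_derivative_square:
  fixes K :: "(real \<times> real) \<times> 'a \<Rightarrow> 'a::euclidean_space" and w :: "real \<times> real \<Rightarrow> 'a" and c c' :: "real \<Rightarrow> 'a"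
  assumes r: "0 < r" and \<Omega>: "open \<Omega>" and K: "Ck (Suc 0) \<Omega> K"
    and w: "continuous_on (csquare r) w" "\<And>q. q \<in> csquare r \<Longrightarrow> (q, w q) \<in> \<Omega>"
    and weq: "\<And>x t. (x, t) \<in> csquare r \<Longrightarrow> w (x, t) = c x + t *\<^sub>R integral {0..1} (\<lambda>s. K ((x, s * t), w (x, s * t)))"
    and c: "\<And>x. x \<in> {-r<..<r} \<Longrightarrow> (c has_vector_derivative c' x) (at x)" "continuous_on {-r..r} c'"
    and L: "L \<ge> 0" "r * L \<le> 1 / 4" "\<And>q v. q \<in> csquare r \<Longrightarrow> norm (frechet_derivative K (at (q, w q)) (0, v)) \<le> L * norm v"
  obtains y where "continuous_on (csquare r) y"
    "\<And>x t. (x, t) \<in> csquare r \<Longrightarrow> y (x, t) = c' x + t *\<^sub>R integral {0..1} (\<lambda>s. 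
       frechet_derivative K (at ((x, s * t), w (x, s * t))) ((1, 0), y (x, s * t)))"
    "\<And>x t. x \<in> {-r<..<r} \<Longrightarrow> t \<in> {-r..r} \<Longrightarrow> ((\<lambda>x. w (x, t)) has_vector_derivative y (x, t)) (at x)"
proof -
  define D where "D q = frechet_derivative K (at (q, w q))" for q
  have linD: "linear (D q)" if "q \<in> csquare r" for q
    using K w(2)[OF that] has_derivative_linear unfolding D_def
    by (auto simp: frechet_derivative_works)
  have graph: "continuous_on (csquare r) (\<lambda>q. (q, w q))" by (intro continuous_intros w)
  have contD: "continuous_on (csquare r) (\<lambda>q. D q (h q))" if "continuous_on (csquare r) h" for h
  proof -
    have "continuous_on (csquare r) (\<lambda>q. \<Sum>b\<in>Basis. (h q \<bullet> b) *\<^sub>R D q b)"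
    proof (intro continuous_intros that)
      fix b :: "(real \<times> real) \<times> 'a" assume "b \<in> Basis"
      then have "continuous_on \<Omega> (\<lambda>X. frechet_derivative K (at X) b)" using K by simp
      then show "continuous_on (csquare r) (\<lambda>q. D q b)"
        unfolding D_def by (rule continuous_on_compose2[OF _ graph]) (use w(2) in auto)
    qed
    moreover have "(\<Sum>b\<in>Basis. (h q \<bullet> b) *\<^sub>R D q b) = D q (h q)" if "q \<in> csquare r" for q
      using frechet_derivative_expand[of K "(q, w q)" "h q"] K w(2)[OF that] by (simp add: D_def)
    ultimately show ?thesis by (simp cong: continuous_on_cong)
  qed
  have "\<exists>y. continuous_on (csquare r) y \<and> y ` csquare r \<subseteq> UNIV \<and> (\<forall>q\<in>csquare r. y q = 
      c' (fst q) + fst q *\<^sub>R integral {0..1} (\<lambda>s. (\<lambda>q v. 0) (s * fst q, snd q) (y (s * fst q, snd q)))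
      + snd q *\<^sub>R integral {0..1} (\<lambda>s. (\<lambda>q v. D q ((1, 0), v)) (fst q, s * snd q) (y (fst q, s * snd q))))"
  proof (rule integral_fixpoint[where L=L])
    show "continuous_on (csquare r) (\<lambda>q. c' (fst q))"
      by (rule continuous_on_compose2[OF c(2)]) (auto intro!: continuous_intros)
    show "continuous_on (csquare r \<times> UNIV) (\<lambda>(q, v). D q ((1, 0), v))"
    proof -
      have "continuous_on (csquare r \<times> UNIV) (\<lambda>p. \<Sum>b\<in>Basis. (((1, 0), snd p) \<bullet> b) *\<^sub>R D (fst p) b)"
      proof (intro continuous_intros)
        fix b :: "(real \<times> real) \<times> 'a" assume "b \<in> Basis"
        show "continuous_on (csquare r \<times> UNIV) (\<lambda>p. D (fst p) b)"
          by (rule continuous_on_compose2[OF contD[OF continuous_on_const]]) (auto intro!: continuous_intros)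
      qed
      moreover have "(\<Sum>b\<in>Basis. (((1, 0), snd p) \<bullet> b) *\<^sub>R D (fst p) b) = D (fst p) ((1, 0), snd p)" 
        if "p \<in> csquare r \<times> UNIV" for p :: "(real \<times> real) \<times> 'a"
        using frechet_derivative_expand[of K "(fst p, w (fst p))" "((1, 0), snd p)"] K w(2)[of "fst p"] that 
        by (auto simp: D_def)
      ultimately show ?thesis by (simp add: case_prod_unfold cong: continuous_on_cong)
    qed
    show "norm (D q ((1, 0), v) - D q ((1, 0), v')) \<le> L * norm (v - v')" if "q \<in> csquare r" for q v v'
    proof -
      have "D q ((1, 0), v) - D q ((1, 0), v') = D q (0, v - v')"
        using linear_diff[OF linD[OF that], of "((1, 0), v)" "((1, 0), v')"] by simp
      then show ?thesis using L(3)[OF that] by (simp add: D_def)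
    qed
  qed (use r L(1,2) in \<open>auto simp: case_prod_unfold\<close>)
  then obtain y where y: "continuous_on (csquare r) y" and
    yeq: "\<And>q. q \<in> csquare r \<Longrightarrow> y q = c' (fst q) + snd q *\<^sub>R integral {0..1} (\<lambda>s. D (fst q, s * snd q) ((1, 0), y (fst q, s * snd q)))"
    by (auto simp only: integral_0 scaleR_zero_right add_0_right)
  show ?thesis
  proof (rule that[OF y])
    show "y (x, t) = c' x + t *\<^sub>R integral {0..1} (\<lambda>s. 
       frechet_derivative K (at ((x, s * t), w (x, s * t))) ((1, 0), y (x, s * t)))" if "(x, t) \<in> csquare r" for x t
      using yeq[OF that] by (simp add: D_def)
    fix x t assume x: "x \<in> {-r<..<r}" and t: "t \<in> {-r..r}"
    have cq: "compact (csquare r)" by (intro compact_Times compact_Icc)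
    obtain Y where Y: "Y \<ge> 0" "\<And>q. q \<in> csquare r \<Longrightarrow> norm (y q) \<le> Y"
    proof -
      have "bounded (y ` csquare r)" using compact_continuous_image[OF y cq] by (rule compact_imp_bounded)
      then obtain Y where "\<And>q. q \<in> csquare r \<Longrightarrow> norm (y q) \<le> Y" by (auto simp: bounded_iff)
      then show ?thesis using that[of "max 0 Y"] by (meson max.cobounded1 max.coboundedI2)
    qed
    have key: "\<exists>d>0. \<forall>h. \<bar>h\<bar> < d \<longrightarrow> norm (w (x + h, t) - w (x, t) - h *\<^sub>R y (x, t)) \<le> \<eta> * \<bar>h\<bar>"
      if \<eta>: "\<eta> > 0" for \<eta>
    proof -
      \<comment> \<open>\<open>\<epsilon>\<close> is chosen so that the final estimate \<open>m \<le> \<epsilon> * M * \<bar>h\<bar>\<close> gives the required \<open>\<eta> * \<bar>h\<bar>\<close>, and so that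
        \<open>r * \<epsilon> + r * L \<le> 1 / 2\<close> lets the terms with \<open>m\<close> on the right be absorbed on the left.\<close>
      define M where "M = 2 * (1 + r * (1 + Y))"
      have M: "M > 0" using r Y(1) by (simp add: M_def add_pos_nonneg)
      define \<epsilon> where "\<epsilon> = min (\<eta> / M) (1 / (4 * r))"
      have \<epsilon>: "\<epsilon> > 0" "\<epsilon> * M \<le> \<eta>" "r * \<epsilon> \<le> 1 / 4"
        using \<eta> M r by (auto simp: \<epsilon>_def min_def field_simps)
      have "compact ((\<lambda>q. (q, w q)) ` csquare r)" "(\<lambda>q. (q, w q)) ` csquare r \<subseteq> \<Omega>"
        using compact_continuous_image[OF graph cq] w(2) by auto
      then obtain \<delta> where \<delta>: "\<delta> > 0" "\<And>q X'. q \<in> csquare r \<Longrightarrow> dist X' (q, w q) < \<delta> \<Longrightarrow>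
        norm (K X' - K (q, w q) - D q (X' - (q, w q))) \<le> \<epsilon> * norm (X' - (q, w q))"
        using C1_uniformly_differentiable[OF \<Omega> K _ _ \<epsilon>(1)] by (metis (no_types, lifting) D_def imageI)
      have "uniformly_continuous_on (csquare r) (\<lambda>q. (q, w q))"
        using graph cq by (rule compact_uniformly_continuous)
      then obtain d1 where d1: "d1 > 0" "\<And>q q'. q \<in> csquare r \<Longrightarrow> q' \<in> csquare r \<Longrightarrow> dist q' q < d1 \<Longrightarrow>
          dist (q', w q') (q, w q) < \<delta>"
        using \<delta>(1) unfolding uniformly_continuous_on_def by metis
      have "(c has_derivative (\<lambda>h. h *\<^sub>R c' x)) (at x)" using c(1)[OF x] by (simp add: has_vector_derivative_def)
      then obtain d2 where d2: "d2 > 0" "\<And>x'. \<bar>x' - x\<bar> < d2 \<Longrightarrow> norm (c x' - c x - (x' - x) *\<^sub>R c' x) \<le> \<epsilon> * \<bar>x' - x\<bar>"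
        using \<epsilon>(1) unfolding has_derivative_at_alt real_norm_def by blast
      define d where "d = min (min d1 d2) (r - \<bar>x\<bar>)"
      have "d > 0" using d1(1) d2(1) x by (auto simp: d_def)
      moreover have "norm (w (x + h, t) - w (x, t) - h *\<^sub>R y (x, t)) \<le> \<eta> * \<bar>h\<bar>" if h: "\<bar>h\<bar> < d" for h
      proof -
        have xh: "x + h \<in> {-r..r}" "x \<in> {-r..r}" using h x by (auto simp: d_def)
        define e where "e s = w (x + h, s) - w (x, s) - h *\<^sub>R y (x, s)" for s
        have conte: "continuous_on {-r..r} e"
          unfolding e_def
          by (intro continuous_intros continuous_on_compose2[OF w(1)] continuous_on_compose2[OF y]) (use xh in auto)
        have "{-r..r} \<noteq> {}" using r by simp
        from continuous_attains_sup[OF compact_Icc this continuous_on_norm[OF conte]]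
        obtain s0 where s0: "s0 \<in> {-r..r}" "\<And>s. s \<in> {-r..r} \<Longrightarrow> norm (e s) \<le> norm (e s0)"
          by blast
        define m where "m = norm (e s0)"
        \<comment> \<open>\<open>\<kappa>\<close> is the integrand of the integral equation satisfied by the error \<open>e\<close>, and \<open>m\<close> is the maximum of \<open>\<bar>e\<bar>\<close>.\<close>
        define \<kappa> where "\<kappa> s = K ((x + h, s), w (x + h, s)) - K ((x, s), w (x, s)) - h *\<^sub>R D (x, s) ((1, 0), y (x, s))" for s
        have cK: "continuous_on {-r..r} (\<lambda>s. K ((x', s), w (x', s)))" if "x' \<in> {-r..r}" for x'
          by (rule continuous_on_compose2[OF Ck_continuous[OF K]])
            (use that w(2) in \<open>auto intro!: continuous_intros continuous_on_compose2[OF w(1)]\<close>)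
        have cD: "continuous_on {-r..r} (\<lambda>s. D (x, s) ((1, 0), y (x, s)))"
          by (rule continuous_on_compose2[OF contD, where f="\<lambda>s. (x, s)"])
            (use xh in \<open>auto intro!: continuous_intros continuous_on_compose2[OF y]\<close>)
        have \<kappa>bound: "norm (\<kappa> s) \<le> \<epsilon> * (\<bar>h\<bar> * (1 + Y) + m) + L * m" if s: "s \<in> {-r..r}" for s
        proof -
          have q: "(x, s) \<in> csquare r" "(x + h, s) \<in> csquare r" using xh s by auto
          have em: "norm (e s) \<le> m" using s0(2)[OF s] by (simp add: m_def)
          let ?\<Delta> = "((x + h, s), w (x + h, s)) - ((x, s), w (x, s))"
          have \<Delta>: "?\<Delta> = h *\<^sub>R ((1, 0), y (x, s)) + (0, e s)" by (simp add: e_def)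
          have "dist (x + h, s) (x, s) < d1" using h by (simp add: dist_norm d_def norm_Pair)
          from \<delta>(2)[OF q(1) d1(2)[OF q this]]
          have 1: "norm (K ((x + h, s), w (x + h, s)) - K ((x, s), w (x, s)) - D (x, s) ?\<Delta>) \<le> \<epsilon> * norm ?\<Delta>" .
          have "norm ?\<Delta> \<le> norm (h *\<^sub>R ((1::real, 0::real), y (x, s))) + norm ((0 :: real \<times> real), e s)"
            unfolding \<Delta> by (rule norm_triangle_ineq)
          also have "\<dots> \<le> \<bar>h\<bar> * (1 + Y) + m"
          proof -
            have "norm ((1::real, 0::real), y (x, s)) \<le> 1 + Y"
              using norm_Pair_le[of "(1::real, 0::real)" "y (x, s)"] Y(2)[OF q(1)] by (simp add: norm_Pair)
            then have "norm (h *\<^sub>R ((1::real, 0::real), y (x, s))) \<le> \<bar>h\<bar> * (1 + Y)"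
              unfolding norm_scaleR by (rule mult_left_mono) simp
            moreover have "norm ((0 :: real \<times> real), e s) \<le> m" using em by (simp add: norm_Pair)
            ultimately show ?thesis by (rule add_mono)
          qed
          finally have 2: "norm ?\<Delta> \<le> \<bar>h\<bar> * (1 + Y) + m" .
          have "D (x, s) ?\<Delta> = h *\<^sub>R D (x, s) ((1, 0), y (x, s)) + D (x, s) (0, e s)"
            unfolding \<Delta> linear_add[OF linD[OF q(1)]] linear_scale[OF linD[OF q(1)]] ..
          then have "\<kappa> s = (K ((x + h, s), w (x + h, s)) - K ((x, s), w (x, s)) - D (x, s) ?\<Delta>) + D (x, s) (0, e s)"
            by (simp add: \<kappa>_def algebra_simps)
          also have "norm \<dots> \<le> \<epsilon> * (\<bar>h\<bar> * (1 + Y) + m) + L * m"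
          proof (rule norm_triangle_le[OF add_mono])
            show "norm (K ((x + h, s), w (x + h, s)) - K ((x, s), w (x, s)) - D (x, s) ?\<Delta>) \<le> \<epsilon> * (\<bar>h\<bar> * (1 + Y) + m)"
              using 1 mult_left_mono[OF 2] \<epsilon>(1) by (meson less_imp_le order_trans)
            show "norm (D (x, s) (0, e s)) \<le> L * m"
              using L(3)[OF q(1), of "e s"] mult_left_mono[OF em L(1)] by (simp add: D_def)
          qed
          finally show ?thesis .
        qed
        have etexp: "e s = (c (x + h) - c x - h *\<^sub>R c' x) + s *\<^sub>R integral {0..1} (\<lambda>\<sigma>. \<kappa> (\<sigma> * s))" if s: "s \<in> {-r..r}" for s
        proof -
          have i: "(\<lambda>\<sigma>. f (\<sigma> * s)) integrable_on {0..1}" if "continuous_on {-r..r} f" for f :: "real \<Rightarrow> 'a"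
            by (rule integrable_continuous_interval, rule continuous_on_compose2[OF that])
              (use scaled_in(1) s in \<open>auto intro!: continuous_intros\<close>)
          note i1 = i[OF cK[OF xh(1)]] and i2 = i[OF cK[OF xh(2)]] and i3 = i[OF cD]
          have "integral {0..1} (\<lambda>\<sigma>. \<kappa> (\<sigma> * s)) = integral {0..1} (\<lambda>\<sigma>. K ((x + h, \<sigma> * s), w (x + h, \<sigma> * s)))
             - integral {0..1} (\<lambda>\<sigma>. K ((x, \<sigma> * s), w (x, \<sigma> * s))) - h *\<^sub>R integral {0..1} (\<lambda>\<sigma>. D (x, \<sigma> * s) ((1, 0), y (x, \<sigma> * s)))"
            unfolding \<kappa>_def using i1 i2 i3
            by (simp add: integral_diff integrable_diff integrable_cmul)
          note \<kappa>int = this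
          show ?thesis
            unfolding \<kappa>int using weq[of "x + h" s] weq[of x s] yeq[of "(x, s)"] xh s
            by (simp add: e_def algebra_simps)
        qed
        have "m \<le> \<epsilon> * \<bar>h\<bar> + r * (\<epsilon> * (\<bar>h\<bar> * (1 + Y) + m) + L * m)"
        proof -
          have "norm (integral {0..1} (\<lambda>\<sigma>. \<kappa> (\<sigma> * s0))) \<le> \<epsilon> * (\<bar>h\<bar> * (1 + Y) + m) + L * m"
          proof (rule norm_integral_unit_le)
            have "continuous_on {-r..r} \<kappa>" unfolding \<kappa>_def by (intro continuous_intros cK cD xh)
            then show "continuous_on {0..1} (\<lambda>\<sigma>. \<kappa> (\<sigma> * s0))"
              by (rule continuous_on_compose2) (use scaled_in(1) s0(1) in \<open>auto intro!: continuous_intros\<close>)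
          qed (use \<kappa>bound scaled_in(1) s0(1) in blast)
          moreover have "\<bar>s0\<bar> \<le> r" using s0(1) by auto
          ultimately have "norm (s0 *\<^sub>R integral {0..1} (\<lambda>\<sigma>. \<kappa> (\<sigma> * s0))) \<le> r * (\<epsilon> * (\<bar>h\<bar> * (1 + Y) + m) + L * m)"
            unfolding norm_scaleR by (intro mult_mono) (use r in auto)
          moreover have "norm (c (x + h) - c x - h *\<^sub>R c' x) \<le> \<epsilon> * \<bar>h\<bar>"
            using d2(2)[of "x + h"] h by (simp add: d_def)
          ultimately show ?thesis
            unfolding m_def etexp[OF s0(1)] by (intro norm_triangle_le add_mono)
        qed
        also have "\<dots> = \<epsilon> * \<bar>h\<bar> * (1 + r * (1 + Y)) + (r * \<epsilon>) * m + (r * L) * m" by (simp add: algebra_simps)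
        also have "\<dots> \<le> \<epsilon> * \<bar>h\<bar> * (1 + r * (1 + Y)) + (1 / 4) * m + (1 / 4) * m"
          by (intro add_mono mult_right_mono \<epsilon>(3) L(2) order_refl) (auto simp: m_def)
        finally have "m \<le> (\<epsilon> * M) * \<bar>h\<bar>" by (simp add: M_def algebra_simps)
        also have "\<dots> \<le> \<eta> * \<bar>h\<bar>" by (intro mult_right_mono \<epsilon>(2)) simp
        finally show ?thesis using s0(2)[OF t] by (simp add: m_def e_def)
      qed
      ultimately show ?thesis by blast
    qed
    show "((\<lambda>x. w (x, t)) has_vector_derivative y (x, t)) (at x)"
      unfolding has_vector_derivative_def has_derivative_at_alt
    proof (intro conjI allI impI)
      fix \<eta> :: real assume "\<eta> > 0"
      then obtain d where d: "d > 0" "\<And>h. \<bar>h\<bar> < d \<Longrightarrow> norm (w (x + h, t) - w (x, t) - h *\<^sub>R y (x, t)) \<le> \<eta> * \<bar>h\<bar>"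
        using key by blast
      show "\<exists>d>0. \<forall>z. norm (z - x) < d \<longrightarrow> norm (w (z, t) - w (x, t) - (z - x) *\<^sub>R y (x, t)) \<le> \<eta> * norm (z - x)"
        using d(1) d(2)[of "z - x" for z] by (auto intro!: exI[of _ d])
    qed (rule bounded_linear_scaleR_left)
  qed
qed

section \<open>Smooth dependence of ordinary differential equations on a parameter\<close>

lemma Ck_le: "Ck n S f \<Longrightarrow> m \<le> n \<Longrightarrow> Ck m S f"
proof (induction n)
  case (Suc n)
  then show ?case using Ck_Suc_D by (metis le_Suc_eq)
qed simp

lemma has_vector_derivative_along_line:
  fixes f :: "'a::real_normed_vector \<Rightarrow> 'b::real_normed_vector"
  assumes "f differentiable (at X)"
  shows "((\<lambda>s. f (X + s *\<^sub>R h)) has_vector_derivative frechet_derivative f (at X) h) (at 0)"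
proof -
  let ?D = "frechet_derivative f (at X)"
  have d: "(f has_derivative ?D) (at X)" using assms by (simp only: frechet_derivative_works)
  have "((\<lambda>s. X + s *\<^sub>R h) has_derivative (\<lambda>s. s *\<^sub>R h)) (at (0::real))"
    by (auto intro!: derivative_eq_intros)
  then have "((\<lambda>s. f (X + s *\<^sub>R h)) has_derivative (\<lambda>s. ?D (s *\<^sub>R h))) (at 0)"
    by (rule has_derivative_compose) (use d in simp)
  moreover have "(\<lambda>s. ?D (s *\<^sub>R h)) = (\<lambda>s. s *\<^sub>R ?D h)"
    by (rule ext) (rule linear_scale[OF has_derivative_linear[OF d]])
  ultimately show ?thesis by (simp only: has_vector_derivative_def)
qed

lemma in_smaller_square:
  assumes "q \<in> osquare r"
  obtains r' where "0 < r'" "r' < r" "q \<in> osquare r'"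
proof -
  obtain x t where q: "q = (x, t)" by (cases q)
  have "max \<bar>x\<bar> \<bar>t\<bar> < r" using assms q by auto
  then obtain r' where "max \<bar>x\<bar> \<bar>t\<bar> < r'" "r' < r" using dense by blast
  moreover from this have "0 < r'" "x \<in> {-r'<..<r'}" "t \<in> {-r'<..<r'}" by auto
  ultimately show ?thesis using that[of r'] q by blast
qed

text \<open>
  Induction on \<open>k\<close>. The derivative \<open>w\<^sub>x\<close> solves an equation of the same form whose right-hand
  side is of class \<open>C\<^sup>k\<close> when \<open>K\<close> is of class \<open>C\<^sup>k\<^sup>+\<^sup>1\<close>. This right-hand side is affine in the unknown, with
  linear part \<open>\<partial>\<^sub>w K\<close> along \<open>w\<close>, so the bound \<open>L\<close>, and with it the square, stays the same at
  every order. That is what makes the solution smooth on one fixed square.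
\<close>

lemma ode_parameter_Ck:
  fixes K :: "(real \<times> real) \<times> 'a \<Rightarrow> 'a::euclidean_space" and w :: "real \<times> real \<Rightarrow> 'a" and c :: "real \<Rightarrow> 'a"
  assumes "0 < r" "open \<Omega>" "Ck k \<Omega> K" "continuous_on (osquare r) w" "\<And>q. q \<in> osquare r \<Longrightarrow> (q, w q) \<in> \<Omega>"
    and "\<And>x t. (x, t) \<in> osquare r \<Longrightarrow> w (x, t) = c x + t *\<^sub>R integral {0..1} (\<lambda>s. K ((x, s * t), w (x, s * t)))"
    and "\<And>j. Ck j {-r<..<r} c"
    and L: "L \<ge> 0" "r * L \<le> 1 / 4"
    and "\<And>q v. k > 0 \<Longrightarrow> q \<in> osquare r \<Longrightarrow> norm (frechet_derivative K (at (q, w q)) (0, v)) \<le> L * norm v"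
  shows "Ck k (osquare r) w"
  using assms(2-7,10)
proof (induction k arbitrary: \<Omega> K w c)
  case 0
  then show ?case by simp
next
  case (Suc k)
  note \<Omega> = Suc.prems(1) and K = Suc.prems(2) and w = Suc.prems(3,4) and weq = Suc.prems(5)
    and c = Suc.prems(6) and DK = Suc.prems(7)
  have op: "open (osquare r)" by (simp add: open_Times)
  define c' where "c' x = frechet_derivative c (at x) 1" for x
  have c': "Ck j {-r<..<r} c'" for j using c[of "Suc j"] by (simp add: c'_def[abs_def])
  have cder: "(c has_vector_derivative c' x) (at x)" if "x \<in> {-r<..<r}" for x
  proof -
    have "c differentiable (at x)" using c[of "Suc 0"] that by simp
    then show ?thesis
      by (simp add: c'_def frechet_derivative_eq_vector_derivative vector_derivative_works)
  qed
  have K1: "Ck (Suc 0) \<Omega> K" using K by (rule Ck_le) simp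
  have wk: "Ck k (osquare r) w"
    by (rule Suc.IH[OF \<Omega> Ck_Suc_D[OF K] w weq c DK]) auto
  let ?Kt = "\<lambda>p. frechet_derivative K (at (fst p, w (fst p))) ((1, 0), snd p)"
  define y where "y q = vector_derivative (\<lambda>x. w (x, snd q)) (at (fst q))" for q
  \<comment> \<open>Compactness is needed for the differentiation, so it takes place on slightly smaller closed squares.\<close>
  have local: "continuous_on (osquare r') y \<and> (\<forall>x t. (x, t) \<in> osquare r' \<longrightarrow>
       ((\<lambda>x. w (x, t)) has_vector_derivative y (x, t)) (at x) \<and>
       y (x, t) = c' x + t *\<^sub>R integral {0..1} (\<lambda>s. ?Kt ((x, s * t), y (x, s * t))))"
    if r': "0 < r'" "r' < r" for r'
  proof -
    have sub: "csquare r' \<subseteq> osquare r" using r' by auto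
    have "r' * L \<le> r * L" using r' L(1) by (intro mult_right_mono) auto
    then have r'L: "r' * L \<le> 1 / 4" using L(2) by simp
    obtain y' where y': "continuous_on (csquare r') y'"
      "\<And>x t. (x, t) \<in> csquare r' \<Longrightarrow> y' (x, t) = c' x + t *\<^sub>R integral {0..1} (\<lambda>s. 
         frechet_derivative K (at ((x, s * t), w (x, s * t))) ((1, 0), y' (x, s * t)))"
      "\<And>x t. x \<in> {-r'<..<r'} \<Longrightarrow> t \<in> {-r'..r'} \<Longrightarrow> ((\<lambda>x. w (x, t)) has_vector_derivative y' (x, t)) (at x)"
    proof (rule parameter_derivative_square[OF r'(1) \<Omega> K1, where c=c and c'=c' and L=L and w=w])
      show "continuous_on (csquare r') w" using w(1) sub by (rule continuous_on_subset)
      show "continuous_on {-r'..r'} c'"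
        using Ck_continuous[OF c'] by (rule continuous_on_subset) (use r' in auto)
    qed (use sub w(2) weq cder r' L(1) r'L DK in \<open>auto simp: subset_iff\<close>)
    have eq: "y q = y' q" if "q \<in> osquare r'" for q
      using y'(3)[of "fst q" "snd q"] that unfolding y_def
      by (auto simp: mem_Times_iff intro!: vector_derivative_at)
    have "continuous_on (osquare r') y'" by (rule continuous_on_subset[OF y'(1)]) auto
    then have "continuous_on (osquare r') y" using eq by (simp cong: continuous_on_cong)
    moreover have "y (x, t) = c' x + t *\<^sub>R integral {0..1} (\<lambda>s. ?Kt ((x, s * t), y (x, s * t)))"
      if xt: "(x, t) \<in> osquare r'" for x t
    proof -
      have "integral {0..1} (\<lambda>s. ?Kt ((x, s * t), y (x, s * t))) = integral {0..1} (\<lambda>s. ?Kt ((x, s * t), y' (x, s * t)))"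
        by (intro integral_cong) (use eq xt scaled_in(2)[of _ t r'] in auto)
      then show ?thesis using y'(2)[of x t] eq[OF xt] xt by simp
    qed
    moreover have "((\<lambda>x. w (x, t)) has_vector_derivative y (x, t)) (at x)" if xt: "(x, t) \<in> osquare r'" for x t
      unfolding eq[OF xt] by (rule y'(3)) (use xt in auto)
    ultimately show ?thesis by blast
  qed
  have yder: "((\<lambda>x. w (x, t)) has_vector_derivative y (x, t)) (at x)"
    and yeq: "y (x, t) = c' x + t *\<^sub>R integral {0..1} (\<lambda>s. ?Kt ((x, s * t), y (x, s * t)))" if "(x, t) \<in> osquare r" for x t
  proof -
    obtain r' where r': "0 < r'" "r' < r" "(x, t) \<in> osquare r'"
      by (rule in_smaller_square[OF \<open>(x, t) \<in> osquare r\<close>])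
    from local[OF r'(1,2)] r'(3)
    show "((\<lambda>x. w (x, t)) has_vector_derivative y (x, t)) (at x)"
      "y (x, t) = c' x + t *\<^sub>R integral {0..1} (\<lambda>s. ?Kt ((x, s * t), y (x, s * t)))" by blast+
  qed
  have ycont: "continuous_on (osquare r) y"
  proof (rule continuous_at_imp_continuous_on, intro ballI)
    fix q assume "q \<in> osquare r"
    then obtain r' where r': "0 < r'" "r' < r" "q \<in> osquare r'" by (rule in_smaller_square)
    have "open (osquare r')" by (simp add: open_Times)
    then show "isCont y q" using local[OF r'(1,2)] r'(3) continuous_on_eq_continuous_at by blast
  qed
  have g: "Ck k (osquare r \<times> (UNIV :: 'a set)) (\<lambda>p. (fst p, w (fst p)))"
  proof -
    have o: "open (osquare r \<times> (UNIV :: 'a set))" by (intro open_Times op open_UNIV)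
    have "Ck k (osquare r \<times> (UNIV :: 'a set)) (\<lambda>p. w (fst p))"
      by (rule Ck_compose[OF o wk Ck_fst[OF o Ck_id[OF o]]]) auto
    then show ?thesis by (intro Ck_Pair o Ck_fst Ck_id)
  qed
  have Kt: "Ck k (osquare r \<times> (UNIV :: 'a set)) ?Kt"
  proof -
    have o: "open (osquare r \<times> (UNIV :: 'a set))" by (intro open_Times op open_UNIV)
    show ?thesis
      by (rule Ck_derivative_along[OF o K g]) (use w(2) in \<open>auto intro!: Ck_Pair Ck_const Ck_snd Ck_id o\<close>)
  qed
  have "Ck k (osquare r) y"
  proof (rule Suc.IH[OF _ Kt ycont _ _ c'])
    show "open (osquare r \<times> (UNIV :: 'a set))" by (intro open_Times op open_UNIV)
    fix q v assume k: "0 < k" and q: "q \<in> osquare r"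
    have lin: "linear (frechet_derivative K (at (q, w q)))"
      using K w(2)[OF q] has_derivative_linear by (auto simp: frechet_derivative_works)
    obtain j where "k = Suc j" using k by (cases k) auto
    then have "?Kt differentiable (at (q, y q))" using Kt q by auto
    from has_vector_derivative_along_line[OF this, of "(0, v)"]
    have 1: "((\<lambda>s. frechet_derivative K (at (q, w q)) ((1, 0), y q + s *\<^sub>R v)) has_vector_derivative
        frechet_derivative ?Kt (at (q, y q)) (0, v)) (at 0)" by simp
    have "frechet_derivative K (at (q, w q)) ((1, 0), y q + s *\<^sub>R v) =
        frechet_derivative K (at (q, w q)) ((1, 0), y q) + s *\<^sub>R frechet_derivative K (at (q, w q)) (0, v)" for s
      using linear_add[OF lin, of "((1, 0), y q)" "s *\<^sub>R (0, v)"] linear_scale[OF lin, of s "(0, v)"] by simp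
    then have 2: "((\<lambda>s. frechet_derivative K (at (q, w q)) ((1, 0), y q + s *\<^sub>R v)) has_vector_derivative
        frechet_derivative K (at (q, w q)) (0, v)) (at 0)"
      by (auto intro!: derivative_eq_intros simp: has_vector_derivative_def)
    show "norm (frechet_derivative ?Kt (at (q, y q)) (0, v)) \<le> L * norm v"
      using DK[OF _ q, of v] vector_derivative_unique_at[OF 1 2] by simp
  qed (use yeq in auto)
  moreover have "Ck k (osquare r) (\<lambda>q. K (q, w q))"
    by (rule Ck_compose[OF op Ck_Suc_D[OF K]]) (use w(2) in \<open>auto intro!: Ck_Pair Ck_id op wk\<close>)
  moreover have "((\<lambda>t. w (x, t)) has_vector_derivative K ((x, t), w (x, t))) (at t)" if xt: "(x, t) \<in> osquare r" for x t
  proof -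
    have "continuous_on {-r<..<r} (\<lambda>t. K ((x, t), w (x, t)))"
      by (rule continuous_on_compose2[OF Ck_continuous[OF K]])
        (use xt w(2) in \<open>auto intro!: continuous_intros continuous_on_compose2[OF w(1)]\<close>)
    from has_vector_derivative_add[OF has_vector_derivative_const[of "c x"] has_vector_derivative_scaled_integral[OF this, of t]] xt
    have "((\<lambda>t. c x + t *\<^sub>R integral {0..1} (\<lambda>s. K ((x, s * t), w (x, s * t)))) has_vector_derivative K ((x, t), w (x, t))) (at t)"
      by (simp add: abs_less_iff)
    then show ?thesis
      by (rule has_vector_derivative_transform_within_open[where S="{-r<..<r}"]) (use xt weq in auto)
  qed
  ultimately show ?case using yder by (intro Ck_Suc_plane[OF op])
qed

section \<open>The Goursat problem\<close>

lemma C1_bound_on_cball: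
  fixes H :: "'a::euclidean_space \<Rightarrow> 'b::euclidean_space"
  assumes "Ck (Suc 0) \<Omega> H" "cball P \<rho> \<subseteq> \<Omega>"
  obtains L where "L \<ge> 1" "\<And>X h. X \<in> cball P \<rho> \<Longrightarrow> norm (frechet_derivative H (at X) h) \<le> L * norm h"
    "\<And>X Y. X \<in> cball P \<rho> \<Longrightarrow> Y \<in> cball P \<rho> \<Longrightarrow> norm (H X - H Y) \<le> L * norm (X - Y)"
    "\<And>X. X \<in> cball P \<rho> \<Longrightarrow> norm (H X) \<le> L"
proof -
  let ?s = "\<lambda>X. \<Sum>b\<in>Basis. norm (frechet_derivative H (at X) b)"
  have der: "(H has_derivative frechet_derivative H (at X)) (at X)" if "X \<in> cball P \<rho>" for X
    using assms that by (auto simp: frechet_derivative_works)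
  have "continuous_on (cball P \<rho>) (\<lambda>X. frechet_derivative H (at X) b)" if "b \<in> Basis" for b
    by (rule continuous_on_subset[OF _ assms(2)]) (use assms(1) that in simp)
  then have "continuous_on (cball P \<rho>) ?s" by (intro continuous_on_sum continuous_on_norm)
  moreover have "continuous_on (cball P \<rho>) (\<lambda>X. norm (H X))"
    by (intro continuous_on_norm continuous_on_subset[OF Ck_continuous[OF assms(1)] assms(2)])
  ultimately
  have "bounded (?s ` cball P \<rho>)" "bounded ((\<lambda>X. norm (H X)) ` cball P \<rho>)"
    by (blast intro: compact_imp_bounded compact_continuous_image compact_cball)+
  then obtain L1 L2 where L: "\<And>X. X \<in> cball P \<rho> \<Longrightarrow> ?s X \<le> L1" "\<And>X. X \<in> cball P \<rho> \<Longrightarrow> norm (H X) \<le> L2"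
    unfolding bounded_iff by (force simp: abs_le_iff)
  define L where "L = max 1 (max L1 L2)"
  have bd: "norm (frechet_derivative H (at X) h) \<le> L * norm h" if "X \<in> cball P \<rho>" for X h
  proof -
    have "norm (frechet_derivative H (at X) h) \<le> ?s X * norm h"
      by (rule linear_norm_le_sum_Basis[OF has_derivative_linear[OF der[OF that]]])
    also have "\<dots> \<le> L * norm h" using L(1)[OF that] by (intro mult_right_mono) (auto simp: L_def)
    finally show ?thesis .
  qed
  show ?thesis
  proof (rule that[of L])
    show "norm (H X - H Y) \<le> L * norm (X - Y)" if "X \<in> cball P \<rho>" "Y \<in> cball P \<rho>" for X Y
    proof (rule differentiable_bound[where S="cball P \<rho>"])
      show "(H has_derivative frechet_derivative H (at X)) (at X within cball P \<rho>)" if "X \<in> cball P \<rho>" for X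
        using der[OF that] by (rule has_derivative_at_withinI)
      show "onorm (frechet_derivative H (at X)) \<le> L" if "X \<in> cball P \<rho>" for X
        using bd[OF that] by (rule onorm_le)
    qed (use that in auto)
    show "norm (H X) \<le> L" if "X \<in> cball P \<rho>" for X using L(2)[OF that] by (auto simp: L_def)
    show "1 \<le> L" by (simp add: L_def)
  qed (rule bd)
qed

text \<open>
  With \<open>b = a\<^sub>x\<close>, the equation \<open>a\<^sub>x\<^sub>t = H (a, a\<^sub>x)\<close> becomes the first order system \<open>a\<^sub>x = b\<close>, \<open>b\<^sub>t = H (a, b)\<close>. It
  can be integrated along the characteristics from \<open>a (0, t) = a0 + t ad\<close> and \<open>b (x, 0) = b0 + x bx\<close>.
\<close>

lemma goursat_continuous:
  fixes H :: "'a \<times> 'a \<Rightarrow> 'a::euclidean_space"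
  assumes H: "Ck (Suc 0) \<Omega> H" and \<Omega>: "open \<Omega>" "(a0, b0) \<in> \<Omega>"
  obtains r L A B where "r > 0" "L \<ge> 0" "r * L \<le> 1 / 4"
    "continuous_on (osquare r) A" "continuous_on (osquare r) B"
    "\<And>q. q \<in> osquare r \<Longrightarrow> (A q, B q) \<in> \<Omega>"
    "\<And>q h. q \<in> osquare r \<Longrightarrow> norm (frechet_derivative H (at (A q, B q)) h) \<le> L * norm h"
    "\<And>x t. (x, t) \<in> osquare r \<Longrightarrow> A (x, t) = a0 + t *\<^sub>R ad + x *\<^sub>R integral {0..1} (\<lambda>s. B (s * x, t))"
    "\<And>x t. (x, t) \<in> osquare r \<Longrightarrow> B (x, t) = b0 + x *\<^sub>R bx + t *\<^sub>R integral {0..1} (\<lambda>s. H (A (x, s * t), B (x, s * t)))"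
proof -
  obtain \<rho> where \<rho>: "\<rho> > 0" "cball (a0, b0) \<rho> \<subseteq> \<Omega>" using \<Omega> open_contains_cball by blast
  let ?B = "cball (a0, b0) \<rho>"
  obtain L where L: "L \<ge> 1" "\<And>X h. X \<in> ?B \<Longrightarrow> norm (frechet_derivative H (at X) h) \<le> L * norm h"
    "\<And>X Y. X \<in> ?B \<Longrightarrow> Y \<in> ?B \<Longrightarrow> norm (H X - H Y) \<le> L * norm (X - Y)"
    "\<And>X. X \<in> ?B \<Longrightarrow> norm (H X) \<le> L"
    using C1_bound_on_cball[OF H \<rho>(2)] by blast
  \<comment> \<open>In a square of side \<open>2 r\<close> the solution moves away from \<open>(a0, b0)\<close> by at most \<open>r * M\<close>, which keeps it in the ball.\<close>
  define M where "M = norm ad + norm bx + (norm (a0, b0) + \<rho>) + L"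
  have M: "M > 0" using L(1) \<rho>(1) by (simp add: M_def add_nonneg_pos)
  define r where "r = min (1 / (4 * L)) (\<rho> / M)"
  have r: "r > 0" "r * L \<le> 1 / 4" "r * M \<le> \<rho>"
    using L(1) \<rho>(1) M by (auto simp: r_def min_def field_simps)
  define c where "c q = (a0 + snd q *\<^sub>R ad, b0 + fst q *\<^sub>R bx)" for q :: "real \<times> real"
  define Hx where "Hx q w = (snd w, 0 :: 'a)" for q :: "real \<times> real" and w :: "'a \<times> 'a"
  define Ht where "Ht q w = (0 :: 'a, H w)" for q :: "real \<times> real" and w
  have cH: "continuous_on ?B H" using Ck_continuous[OF H] \<rho>(2) by (rule continuous_on_subset)
  have cHx: "continuous_on (csquare r \<times> ?B) (\<lambda>(q, w). Hx q w)"
    unfolding Hx_def case_prod_unfold by (intro continuous_intros)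
  have cHt: "continuous_on (csquare r \<times> ?B) (\<lambda>(q, w). Ht q w)"
    unfolding Ht_def case_prod_unfold
    by (intro continuous_intros continuous_on_compose2[OF cH]) auto
  have cmpx: "continuous_on {0..1} (\<lambda>s. w (s * fst q, snd q))" "(\<lambda>s. w (s * fst q, snd q)) ` {0..1} \<subseteq> ?B"
    and cmpt: "continuous_on {0..1} (\<lambda>s. w (fst q, s * snd q))" "(\<lambda>s. w (fst q, s * snd q)) ` {0..1} \<subseteq> ?B"
    if w: "continuous_on (csquare r) w" "w ` csquare r \<subseteq> ?B" and q: "q \<in> csquare r" for w q
  proof -
    have x: "(\<lambda>s. (s * fst q, snd q)) ` {0..1} \<subseteq> csquare r" and t: "(\<lambda>s. (fst q, s * snd q)) ` {0..1} \<subseteq> csquare r"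
      using scaled_in(1)[of _ "fst q" r] scaled_in(1)[of _ "snd q" r] q by (auto simp: mem_Times_iff)
    show "continuous_on {0..1} (\<lambda>s. w (s * fst q, snd q))"
      by (rule continuous_on_compose2[OF w(1) _ x]) (intro continuous_intros)
    show "continuous_on {0..1} (\<lambda>s. w (fst q, s * snd q))"
      by (rule continuous_on_compose2[OF w(1) _ t]) (intro continuous_intros)
    show "(\<lambda>s. w (s * fst q, snd q)) ` {0..1} \<subseteq> ?B" "(\<lambda>s. w (fst q, s * snd q)) ` {0..1} \<subseteq> ?B"
      using x t w(2) by blast+
  qed
  have ball_norm: "norm X \<le> norm (a0, b0) + \<rho>" if "X \<in> ?B" for X
    using that norm_triangle_sub[of X "(a0, b0)"] by (simp add: dist_norm norm_minus_commute)
  have "\<exists>w. continuous_on (csquare r) w \<and> w ` csquare r \<subseteq> ?B \<and> (\<forall>q\<in>csquare r. w q = c q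
       + fst q *\<^sub>R integral {0..1} (\<lambda>s. Hx (s * fst q, snd q) (w (s * fst q, snd q)))
       + snd q *\<^sub>R integral {0..1} (\<lambda>s. Ht (fst q, s * snd q) (w (fst q, s * snd q))))"
  proof (rule integral_fixpoint[where L=L])
    show "continuous_on (csquare r) c" unfolding c_def by (intro continuous_intros)
    show "norm (Hx q w - Hx q w') \<le> L * norm (w - w')" for q w w'
    proof -
      have "norm (snd (w - w')) \<le> norm (w - w')" by (metis norm_snd_le prod.collapse)
      then have "norm (Hx q w - Hx q w') \<le> 1 * norm (w - w')" by (simp add: Hx_def norm_Pair)
      also have "\<dots> \<le> L * norm (w - w')" using L(1) by (rule mult_right_mono) simp
      finally show ?thesis .
    qed
    show "norm (Ht q w - Ht q w') \<le> L * norm (w - w')" if "w \<in> ?B" "w' \<in> ?B" for q w w'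
      using L(3)[OF that] by (simp add: Ht_def norm_Pair)
    fix w q assume w: "continuous_on (csquare r) w" "w ` csquare r \<subseteq> ?B" and q: "q \<in> csquare r"
    note wx = cmpx[OF w q] and wt = cmpt[OF w q]
    have 1: "norm (integral {0..1} (\<lambda>s. Hx (s * fst q, snd q) (w (s * fst q, snd q)))) \<le> norm (a0, b0) + \<rho>"
    proof (rule norm_integral_unit_le)
      show "norm (Hx (s * fst q, snd q) (w (s * fst q, snd q))) \<le> norm (a0, b0) + \<rho>" if "s \<in> {0..1}" for s
      proof -
        have "norm (snd (w (s * fst q, snd q))) \<le> norm (w (s * fst q, snd q))" by (metis norm_snd_le prod.collapse)
        then show ?thesis using ball_norm wx(2) that by (fastforce simp: Hx_def norm_Pair)
      qed
    qed (unfold Hx_def, intro continuous_intros wx)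
    have 2: "norm (integral {0..1} (\<lambda>s. Ht (fst q, s * snd q) (w (fst q, s * snd q)))) \<le> L"
    proof (rule norm_integral_unit_le)
      show "norm (Ht (fst q, s * snd q) (w (fst q, s * snd q))) \<le> L" if "s \<in> {0..1}" for s
      proof -
        have "w (fst q, s * snd q) \<in> ?B" using wt(2) that by blast
        then show ?thesis using L(4) by (simp add: Ht_def norm_Pair)
      qed
    qed (unfold Ht_def, intro continuous_intros continuous_on_compose2[OF cH wt])
    have q': "\<bar>fst q\<bar> \<le> r" "\<bar>snd q\<bar> \<le> r" using q by (auto simp: mem_Times_iff)
    let ?I = "integral {0..1} (\<lambda>s. Hx (s * fst q, snd q) (w (s * fst q, snd q)))"
    let ?J = "integral {0..1} (\<lambda>s. Ht (fst q, s * snd q) (w (fst q, s * snd q)))"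
    have c': "c q - (a0, b0) = snd q *\<^sub>R (ad, 0) + fst q *\<^sub>R (0, bx)" by (simp add: c_def)
    have "norm ((c q + fst q *\<^sub>R ?I + snd q *\<^sub>R ?J) - (a0, b0)) = norm (snd q *\<^sub>R (ad, 0) + fst q *\<^sub>R (0, bx) + fst q *\<^sub>R ?I + snd q *\<^sub>R ?J)"
      unfolding c'[symmetric] by (simp add: algebra_simps)
    also have "\<dots> \<le> r * norm ad + r * norm bx + r * (norm (a0, b0) + \<rho>) + r * L"
    proof (intro norm_triangle_le[OF add_mono])
      show "norm (snd q *\<^sub>R (ad, 0::'a)) \<le> r * norm ad" "norm (fst q *\<^sub>R (0::'a, bx)) \<le> r * norm bx"
        using q' by (auto simp: norm_Pair simp del: scaleR_Pair intro!: mult_right_mono)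
      show "norm (fst q *\<^sub>R ?I) \<le> r * (norm (a0, b0) + \<rho>)" "norm (snd q *\<^sub>R ?J) \<le> r * L"
        unfolding norm_scaleR using q' 1 2 r(1) by (auto intro!: mult_mono)
    qed
    also have "\<dots> = r * M" by (simp add: M_def algebra_simps)
    also have "\<dots> \<le> \<rho>" by (rule r(3))
    finally show "c q + fst q *\<^sub>R ?I + snd q *\<^sub>R ?J \<in> ?B" by (simp add: dist_norm norm_minus_commute)
  qed (use r L(1) \<rho>(1) cHx cHt in auto)
  then obtain w where w: "continuous_on (csquare r) w" "w ` csquare r \<subseteq> ?B"
    and weq: "\<And>q. q \<in> csquare r \<Longrightarrow> w q = c q
       + fst q *\<^sub>R integral {0..1} (\<lambda>s. Hx (s * fst q, snd q) (w (s * fst q, snd q)))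
       + snd q *\<^sub>R integral {0..1} (\<lambda>s. Ht (fst q, s * snd q) (w (fst q, s * snd q)))" by blast
  have split: "fst (w q) = a0 + snd q *\<^sub>R ad + fst q *\<^sub>R integral {0..1} (\<lambda>s. snd (w (s * fst q, snd q)))"
    "snd (w q) = b0 + fst q *\<^sub>R bx + snd q *\<^sub>R integral {0..1} (\<lambda>s. H (w (fst q, s * snd q)))" 
    if q: "q \<in> csquare r" for q
  proof -
    note wx = cmpx[OF w q] and wt = cmpt[OF w q]
    have ix: "(\<lambda>s. Hx (s * fst q, snd q) (w (s * fst q, snd q))) integrable_on {0..1}"
      unfolding Hx_def by (intro integrable_continuous_interval continuous_intros wx)
    have it: "(\<lambda>s. Ht (fst q, s * snd q) (w (fst q, s * snd q))) integrable_on {0..1}"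
      unfolding Ht_def by (intro integrable_continuous_interval continuous_intros continuous_on_compose2[OF cH wt])
    have "fst (integral {0..1} (\<lambda>s. Hx (s * fst q, snd q) (w (s * fst q, snd q)))) = integral {0..1} (\<lambda>s. snd (w (s * fst q, snd q)))"
      "snd (integral {0..1} (\<lambda>s. Hx (s * fst q, snd q) (w (s * fst q, snd q)))) = 0"
      using integral_linear[OF ix bounded_linear_fst] integral_linear[OF ix bounded_linear_snd] by (auto simp: o_def Hx_def)
    moreover have "fst (integral {0..1} (\<lambda>s. Ht (fst q, s * snd q) (w (fst q, s * snd q)))) = 0"
      "snd (integral {0..1} (\<lambda>s. Ht (fst q, s * snd q) (w (fst q, s * snd q)))) = integral {0..1} (\<lambda>s. H (w (fst q, s * snd q)))"
      using integral_linear[OF it bounded_linear_fst] integral_linear[OF it bounded_linear_snd] by (auto simp: o_def Ht_def)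
    ultimately show "fst (w q) = a0 + snd q *\<^sub>R ad + fst q *\<^sub>R integral {0..1} (\<lambda>s. snd (w (s * fst q, snd q)))"
      "snd (w q) = b0 + fst q *\<^sub>R bx + snd q *\<^sub>R integral {0..1} (\<lambda>s. H (w (fst q, s * snd q)))"
      by (subst weq[OF q], simp add: c_def)+
  qed
  have sub: "osquare r \<subseteq> csquare r" by auto
  have wB: "w q \<in> ?B" if "q \<in> osquare r" for q using w(2) sub that by blast
  show ?thesis
  proof (rule that[of r L "\<lambda>q. fst (w q)" "\<lambda>q. snd (w q)"])
    show "continuous_on (osquare r) (\<lambda>q. fst (w q))" "continuous_on (osquare r) (\<lambda>q. snd (w q))"
      by (intro continuous_on_fst continuous_on_snd continuous_on_subset[OF w(1) sub])+
    show "(fst (w q), snd (w q)) \<in> \<Omega>" if "q \<in> osquare r" for q using wB[OF that] \<rho>(2) by auto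
    show "norm (frechet_derivative H (at (fst (w q), snd (w q))) h) \<le> L * norm h" if "q \<in> osquare r" for q h
      using L(2)[OF wB[OF that]] by simp
    show "fst (w (x, t)) = a0 + t *\<^sub>R ad + x *\<^sub>R integral {0..1} (\<lambda>s. snd (w (s * x, t)))" if "(x, t) \<in> osquare r" for x t
      using split(1)[of "(x, t)"] sub that by auto
    show "snd (w (x, t)) = b0 + x *\<^sub>R bx + t *\<^sub>R integral {0..1} (\<lambda>s. H (fst (w (x, s * t)), snd (w (x, s * t))))"
      if "(x, t) \<in> osquare r" for x t
      using split(2)[of "(x, t)"] sub that by auto
  qed (use r L(1) in auto)
qed

text \<open>
  Bootstrapping. The equation for \<open>B\<close> is an ordinary differential equation in \<open>t\<close> with parameter \<open>x\<close> whose
  coefficients involve \<open>A\<close>. If \<open>A\<close> and \<open>B\<close> are of class \<open>C\<^sup>k\<close>, then \<open>A\<^sub>x = B\<close> and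
  \<open>A\<^sub>t = ad +\<close> the integral of \<open>H (A, B)\<close> are of class \<open>C\<^sup>k\<close>; hence \<open>A\<close> is of class \<open>C\<^sup>k\<^sup>+\<^sup>1\<close>, and then
  so is \<open>B\<close> by smooth dependence on the parameter.
\<close>

lemma goursat_smooth:
  fixes H :: "'a \<times> 'a \<Rightarrow> 'a::euclidean_space"
  assumes H: "\<And>k. Ck k \<Omega> H" and \<Omega>: "open \<Omega>" "(a0, b0) \<in> \<Omega>"
  obtains r A B where "r > 0"
    "\<And>k. Ck k (osquare r) A" "\<And>k. Ck k (osquare r) B"
    "\<And>q. q \<in> osquare r \<Longrightarrow> (A q, B q) \<in> \<Omega>"
    "\<And>x t. (x, t) \<in> osquare r \<Longrightarrow> ((\<lambda>x. A (x, t)) has_vector_derivative B (x, t)) (at x)"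
    "\<And>x t. (x, t) \<in> osquare r \<Longrightarrow> ((\<lambda>t. B (x, t)) has_vector_derivative H (A (x, t), B (x, t))) (at t)"
    "\<And>t. t \<in> {-r<..<r} \<Longrightarrow> A (0, t) = a0 + t *\<^sub>R ad" "\<And>x. x \<in> {-r<..<r} \<Longrightarrow> B (x, 0) = b0 + x *\<^sub>R bx"
proof -
  obtain r L A B where r: "r > 0" and L: "L \<ge> 0" "r * L \<le> 1 / 4"
    and cA: "continuous_on (osquare r) A" and cB: "continuous_on (osquare r) B"
    and AB: "\<And>q. q \<in> osquare r \<Longrightarrow> (A q, B q) \<in> \<Omega>"
    and DH: "\<And>q h. q \<in> osquare r \<Longrightarrow> norm (frechet_derivative H (at (A q, B q)) h) \<le> L * norm h"
    and Aeq: "\<And>x t. (x, t) \<in> osquare r \<Longrightarrow> A (x, t) = a0 + t *\<^sub>R ad + x *\<^sub>R integral {0..1} (\<lambda>s. B (s * x, t))"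
    and Beq: "\<And>x t. (x, t) \<in> osquare r \<Longrightarrow> B (x, t) = b0 + x *\<^sub>R bx + t *\<^sub>R integral {0..1} (\<lambda>s. H (A (x, s * t), B (x, s * t)))"
    using goursat_continuous[OF H \<Omega>, where ad=ad and bx=bx] by blast
  have op: "open (osquare r)" by (simp add: open_Times)
  have cHAB: "continuous_on (osquare r) (\<lambda>q. H (A q, B q))"
    by (rule continuous_on_compose2[OF Ck_continuous[OF H]]) (use AB cA cB in \<open>auto intro!: continuous_intros\<close>)
  have Ax: "((\<lambda>x. A (x, t)) has_vector_derivative B (x, t)) (at x)" if xt: "(x, t) \<in> osquare r" for x t
  proof -
    have "continuous_on {-r<..<r} (\<lambda>x. B (x, t))"
      by (rule continuous_on_compose2[OF cB]) (use xt in \<open>auto intro!: continuous_intros\<close>)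
    from has_vector_derivative_add[OF has_vector_derivative_const[of "a0 + t *\<^sub>R ad"] has_vector_derivative_scaled_integral[OF this, of x]] xt
    have "((\<lambda>x. a0 + t *\<^sub>R ad + x *\<^sub>R integral {0..1} (\<lambda>s. B (s * x, t))) has_vector_derivative B (x, t)) (at x)"
      by (simp add: abs_less_iff)
    then show ?thesis
      by (rule has_vector_derivative_transform_within_open[where S="{-r<..<r}"]) (use xt Aeq in auto)
  qed
  have Bt: "((\<lambda>t. B (x, t)) has_vector_derivative H (A (x, t), B (x, t))) (at t)" if xt: "(x, t) \<in> osquare r" for x t
  proof -
    have "continuous_on {-r<..<r} (\<lambda>t. H (A (x, t), B (x, t)))"
      by (rule continuous_on_compose2[OF cHAB]) (use xt in \<open>auto intro!: continuous_intros\<close>)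
    from has_vector_derivative_add[OF has_vector_derivative_const[of "b0 + x *\<^sub>R bx"] has_vector_derivative_scaled_integral[OF this, of t]] xt
    have "((\<lambda>t. b0 + x *\<^sub>R bx + t *\<^sub>R integral {0..1} (\<lambda>s. H (A (x, s * t), B (x, s * t)))) has_vector_derivative H (A (x, t), B (x, t))) (at t)"
      by (simp add: abs_less_iff)
    then show ?thesis
      by (rule has_vector_derivative_transform_within_open[where S="{-r<..<r}"]) (use xt Beq in auto)
  qed
  let ?At = "\<lambda>q. ad + fst q *\<^sub>R integral {0..1} (\<lambda>s. H (A (s * fst q, snd q), B (s * fst q, snd q)))"
  have At: "((\<lambda>t. A (x, t)) has_vector_derivative ?At (x, t)) (at t)" if xt: "(x, t) \<in> osquare r" for x t
  proof -
    have "((\<lambda>t. x *\<^sub>R integral {0..1} (\<lambda>s. B (s * x, t))) has_vector_derivative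
        x *\<^sub>R integral {0..1} (\<lambda>s. H (A (s * x, t), B (s * x, t)))) (at t)"
      by (rule has_vector_derivative_integral_x[OF cB cHAB Bt xt])
    moreover have "((\<lambda>t. a0 + t *\<^sub>R ad) has_vector_derivative ad) (at t)"
      by (auto intro!: derivative_eq_intros)
    ultimately have "((\<lambda>t. a0 + t *\<^sub>R ad + x *\<^sub>R integral {0..1} (\<lambda>s. B (s * x, t))) has_vector_derivative ?At (x, t)) (at t)"
      using has_vector_derivative_add by fastforce
    then show ?thesis
      by (rule has_vector_derivative_transform_within_open[where S="{-r<..<r}"]) (use xt Aeq in auto)
  qed
  have smooth: "Ck k (osquare r) A \<and> Ck k (osquare r) B" for k
  proof (induction k)
    case 0
    then show ?case using cA cB by simp
  next
    case (Suc k)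
    have "Ck k (osquare r) (\<lambda>q. H (A q, B q))"
      by (rule Ck_compose[OF op H]) (use AB Suc in \<open>auto intro!: Ck_Pair op\<close>)
    then have "Ck k (osquare r) ?At" by (intro Ck_add Ck_const op Ck_integral_x)
    then have A: "Ck (Suc k) (osquare r) A" using Suc by (intro Ck_Suc_plane[OF op Ax At]) auto
    define \<Omega>' where "\<Omega>' = (osquare r \<times> UNIV) \<inter> (\<lambda>p. (A (fst p), snd p)) -` \<Omega>"
    have o': "open (osquare r \<times> (UNIV :: 'a set))" by (intro open_Times op open_UNIV)
    have "continuous_on (osquare r \<times> (UNIV :: 'a set)) (\<lambda>p. (A (fst p), snd p))"
      by (intro continuous_intros continuous_on_compose2[OF cA]) auto
    then have o: "open \<Omega>'" unfolding \<Omega>'_def using \<Omega>(1) o' by (simp add: continuous_on_open_vimage Int_commute)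
    have "Ck (Suc k) \<Omega>' (\<lambda>p. H (A (fst p), snd p))"
    proof (rule Ck_compose[OF o H[of "Suc k"]])
      have "Ck (Suc k) \<Omega>' (\<lambda>p. A (fst p))"
        by (rule Ck_compose[OF o A Ck_fst[OF o Ck_id[OF o]]]) (auto simp: \<Omega>'_def)
      then show "Ck (Suc k) \<Omega>' (\<lambda>p. (A (fst p), snd p))" by (intro Ck_Pair o Ck_snd Ck_id)
    qed (auto simp: \<Omega>'_def)
    moreover have c: "Ck j {-r<..<r} (\<lambda>x. b0 + x *\<^sub>R bx)" for j
      by (intro Ck_add Ck_const Ck_scaleR Ck_id) auto
    moreover have "norm (frechet_derivative (\<lambda>p. H (A (fst p), snd p)) (at (q, B q)) (0, v)) \<le> L * norm v" 
      if q: "q \<in> osquare r" for q v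
    proof -
      have "(q, B q) \<in> \<Omega>'" using AB q by (auto simp: \<Omega>'_def)
      then have "(\<lambda>p. H (A (fst p), snd p)) differentiable (at (q, B q))" using calculation(1) by simp
      from has_vector_derivative_along_line[OF this, of "(0, v)"]
      have 1: "((\<lambda>s. H (A q, B q + s *\<^sub>R v)) has_vector_derivative 
          frechet_derivative (\<lambda>p. H (A (fst p), snd p)) (at (q, B q)) (0, v)) (at 0)" by simp
      have "H differentiable (at (A q, B q))" using H[of "Suc 0"] AB[OF q] by simp
      from has_vector_derivative_along_line[OF this, of "(0, v)"]
      have "((\<lambda>s. H (A q, B q + s *\<^sub>R v)) has_vector_derivative frechet_derivative H (at (A q, B q)) (0, v)) (at 0)" by simp
      then show ?thesis using vector_derivative_unique_at[OF 1] DH[OF q, of "(0, v)"] by (simp add: norm_Pair)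
    qed
    ultimately have "Ck (Suc k) (osquare r) B"
      by (intro ode_parameter_Ck[OF r o _ cB _ _ c L]) (use AB Beq in \<open>auto simp: \<Omega>'_def\<close>)
    then show ?case using A by simp
  qed
  show ?thesis
  proof (rule that[OF r _ _ AB Ax Bt])
    show "A (0, t) = a0 + t *\<^sub>R ad" if "t \<in> {-r<..<r}" for t using Aeq[of 0 t] that r by simp
    show "B (x, 0) = b0 + x *\<^sub>R bx" if "x \<in> {-r<..<r}" for x using Beq[of x 0] that r by simp
  qed (use smooth in auto)
qed

section \<open>Jets of solutions\<close>

abbreviation J\<^sub>z :: "(jet \<Rightarrow> real) \<Rightarrow> jet \<Rightarrow> real" where "J\<^sub>z \<equiv> partial (1, 0, 0, 0)"
abbreviation J\<^sub>z\<^sub>1 :: "(jet \<Rightarrow> real) \<Rightarrow> jet \<Rightarrow> real" where "J\<^sub>z\<^sub>1 \<equiv> partial (0, 1, 0, 0)"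
abbreviation J\<^sub>y :: "(jet \<Rightarrow> real) \<Rightarrow> jet \<Rightarrow> real" where "J\<^sub>y \<equiv> partial (0, 0, 1, 0)"
abbreviation J\<^sub>y\<^sub>1 :: "(jet \<Rightarrow> real) \<Rightarrow> jet \<Rightarrow> real" where "J\<^sub>y\<^sub>1 \<equiv> partial (0, 0, 0, 1)"

lemma Basis_jet: "(Basis :: jet set) = {(1, 0, 0, 0), (0, 1, 0, 0), (0, 0, 1, 0), (0, 0, 0, 1)}"
  unfolding Basis_prod_def by (simp add: zero_prod_def) blast

lemma frechet_derivative_jet:
  fixes f :: "jet \<Rightarrow> real"
  assumes "f differentiable (at P)"
  shows "frechet_derivative f (at P) (a, b, c, d) = a * J\<^sub>z f P + b * J\<^sub>z\<^sub>1 f P + c * J\<^sub>y f P + d * J\<^sub>y\<^sub>1 f P"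
  using frechet_derivative_expand[OF assms, of "(a, b, c, d)"] by (simp add: Basis_jet partial_def)

lemma frechet_derivative_pair:
  fixes f :: "real \<times> real \<Rightarrow> real"
  assumes "f differentiable (at r)"
  shows "frechet_derivative f (at r) (a, b) = a * D1 f r + b * D2 f r"
  using frechet_derivative_expand[OF assms, of "(a, b)"] by (simp add: Basis_plane partial_def)

lemma smooth_on_differentiable: "smooth_on S f \<Longrightarrow> x \<in> S \<Longrightarrow> f differentiable (at x)"
  unfolding smooth_on_def by (metis Ck_on.simps(2))

lemma smooth_on_partial: "smooth_on S f \<Longrightarrow> e \<in> Basis \<Longrightarrow> smooth_on S (partial e f)"
  unfolding smooth_on_def by (metis Ck_on.simps(2))

lemma smooth_on_jet_partials:
  assumes "smooth_on S f"
  shows "smooth_on S (J\<^sub>z f)" "smooth_on S (J\<^sub>z\<^sub>1 f)" "smooth_on S (J\<^sub>y f)" "smooth_on S (J\<^sub>y\<^sub>1 f)"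
  using assms by (auto intro: smooth_on_partial simp: Basis_jet)

lemma smooth_on_plane_partials:
  assumes "smooth_on S f"
  shows "smooth_on S (D1 f)" "smooth_on S (D2 f)"
  using assms by (auto intro: smooth_on_partial simp: Basis_plane)

lemma smooth_on_continuous: "smooth_on S f \<Longrightarrow> continuous_on S f"
  unfolding smooth_on_def by (metis Ck_on.simps(1))

lemma smooth_on_subset: "smooth_on S f \<Longrightarrow> T \<subseteq> S \<Longrightarrow> smooth_on T f"
  unfolding smooth_iff_Ck using Ck_subset by blast

lemma partial_eqI: "(f has_derivative f') (at x) \<Longrightarrow> partial e f x = f' e"
  unfolding partial_def using frechet_derivative_at by metis

lemma partial_cong:
  assumes "open S" "x \<in> S" "\<And>y. y \<in> S \<Longrightarrow> f y = g y"
  shows "partial e f x = partial e g x"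
proof (cases "f differentiable (at x)")
  case True
  then have "(g has_derivative frechet_derivative f (at x)) (at x)"
    using assms has_derivative_transform_within_open unfolding frechet_derivative_works by blast
  from partial_eqI[OF this, of e] show ?thesis by (simp only: partial_def[of e f])
next
  case False
  have "\<not> g differentiable (at x)"
  proof
    assume "g differentiable (at x)"
    then have "(f has_derivative frechet_derivative g (at x)) (at x)"
      using has_derivative_transform_within_open[OF _ assms(1,2)] assms(3)[symmetric]
      unfolding frechet_derivative_works by blast
    then show False using False by (auto simp: differentiable_def)
  qed
  then have "(SOME D. (f has_derivative D) (at x)) = (SOME D. (g has_derivative D) (at x))"
    using False unfolding differentiable_def by metis
  then show ?thesis by (simp add: partial_def frechet_derivative_def)
qed

lemma partial_plane:
  fixes f :: "plane \<Rightarrow> real"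
  assumes "f differentiable (at (x, t))"
  shows "((\<lambda>x. f (x, t)) has_vector_derivative d) (at x) \<Longrightarrow> D_x f (x, t) = d"
    and "((\<lambda>t. f (x, t)) has_vector_derivative d) (at t) \<Longrightarrow> D_t f (x, t) = d"
  using has_vector_derivative_partials[OF assms] vector_derivative_unique_at unfolding partial_def by metis+

text \<open>
  The jet and the four derivatives \<open>z2\<close>, \<open>y2\<close>, \<open>zt\<close>, \<open>yt\<close> are exactly the free Goursat data to first order:
  \<open>(zt, yt)\<close> is the slope of \<open>(u, v)\<close> along the \<open>t\<close>-axis, \<open>(z2, y2)\<close> that of \<open>(u\<^sub>x, v\<^sub>x)\<close> along the \<open>x\<close>-axis.
\<close>

lemma system_solution_with_jet:
  assumes "open V" "smooth_on V F" "smooth_on V G" "(z, z1, y, y1) \<in> V"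
  obtains D u v where "open D" "(0, 0) \<in> D" "smooth_on D u" "smooth_on D v" "jet_of u v ` D \<subseteq> V"
    "solves_system F G D u v" "jet_of u v (0, 0) = (z, z1, y, y1)"
    "D_x (D_x u) (0, 0) = z2" "D_x (D_x v) (0, 0) = y2" "D_t u (0, 0) = zt" "D_t v (0, 0) = yt"
proof -
  let ?m = "\<lambda>((a1 :: real, a2 :: real), (b1 :: real, b2 :: real)). (a1, b1, a2, b2)"
  define \<Omega> where "\<Omega> = ?m -` V"
  have "continuous_on UNIV ?m" unfolding case_prod_unfold by (intro continuous_intros)
  then have \<Omega>: "open \<Omega>" unfolding \<Omega>_def using assms(1) by (simp add: open_vimage)
  have m: "Ck k \<Omega> ?m" for k
    unfolding case_prod_unfold by (intro Ck_Pair Ck_fst Ck_snd Ck_id \<Omega>)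
  define H where "H w = (F (?m w), G (?m w))" for w
  have FG: "Ck k V F" "Ck k V G" for k using assms(2,3) by (auto simp: smooth_iff_Ck)
  have H: "Ck k \<Omega> H" for k
    unfolding H_def[abs_def] 
    by (intro Ck_Pair \<Omega> Ck_compose[OF \<Omega> FG(1) m] Ck_compose[OF \<Omega> FG(2) m]) (auto simp: \<Omega>_def)
  have w0: "((z, y), (z1, y1)) \<in> \<Omega>" using assms(4) by (simp add: \<Omega>_def)
  obtain r A B where r: "r > 0"
    and A: "\<And>k. Ck k (osquare r) A" and B: "\<And>k. Ck k (osquare r) B"
    and AB: "\<And>q. q \<in> osquare r \<Longrightarrow> (A q, B q) \<in> \<Omega>"
    and Ax: "\<And>x t. (x, t) \<in> osquare r \<Longrightarrow> ((\<lambda>x. A (x, t)) has_vector_derivative B (x, t)) (at x)"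
    and Bt: "\<And>x t. (x, t) \<in> osquare r \<Longrightarrow> ((\<lambda>t. B (x, t)) has_vector_derivative H (A (x, t), B (x, t))) (at t)"
    and A0: "\<And>t. t \<in> {-r<..<r} \<Longrightarrow> A (0, t) = (z, y) + t *\<^sub>R (zt, yt)"
    and B0: "\<And>x. x \<in> {-r<..<r} \<Longrightarrow> B (x, 0) = (z1, y1) + x *\<^sub>R (z2, y2)"
    by (rule goursat_smooth[OF H \<Omega> w0, where ad="(zt, yt)" and bx="(z2, y2)"]) blast
  let ?D = "osquare r"
  have op: "open ?D" by (simp add: open_Times)
  define u where "u q = fst (A q)" for q
  define v where "v q = snd (A q)" for q
  have sm: "smooth_on ?D u" "smooth_on ?D v" "smooth_on ?D (\<lambda>q. fst (B q))" "smooth_on ?D (\<lambda>q. snd (B q))"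
    unfolding smooth_iff_Ck u_def[abs_def] v_def[abs_def] by (intro allI Ck_fst Ck_snd op A B)+
  have ux: "D_x u q = fst (B q)" and vx: "D_x v q = snd (B q)" if "q \<in> ?D" for q
  proof -
    obtain x t where q: "q = (x, t)" by (cases q)
    note d = bounded_linear.has_vector_derivative[OF bounded_linear_fst Ax[of x t]]
      bounded_linear.has_vector_derivative[OF bounded_linear_snd Ax[of x t]]
    show "D_x u q = fst (B q)"
      unfolding q by (rule partial_plane) (use that q smooth_on_differentiable[OF sm(1)] d in \<open>auto simp: u_def\<close>)
    show "D_x v q = snd (B q)"
      unfolding q by (rule partial_plane) (use that q smooth_on_differentiable[OF sm(2)] d in \<open>auto simp: v_def\<close>)
  qed
  have jet: "jet_of u v q = ?m (A q, B q)" if "q \<in> ?D" for q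
    using ux[OF that] vx[OF that] by (simp add: jet_of_def u_def v_def case_prod_unfold)
  have uxd: "partial e (D_x u) q = partial e (\<lambda>q. fst (B q)) q" "partial e (D_x v) q = partial e (\<lambda>q. snd (B q)) q" if "q \<in> ?D" for e q
    using partial_cong[OF op that ux] partial_cong[OF op that vx] by auto
  have sys: "D_t (D_x u) q = F (jet_of u v q)" "D_t (D_x v) q = G (jet_of u v q)" if "q \<in> ?D" for q
  proof -
    obtain x t where q: "q = (x, t)" by (cases q)
    note d = bounded_linear.has_vector_derivative[OF bounded_linear_fst Bt[of x t]]
      bounded_linear.has_vector_derivative[OF bounded_linear_snd Bt[of x t]]
    show "D_t (D_x u) q = F (jet_of u v q)"
      unfolding uxd[OF that] jet[OF that] unfolding q
      by (rule partial_plane) (use that q smooth_on_differentiable[OF sm(3)] d in \<open>auto simp: H_def\<close>)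
    show "D_t (D_x v) q = G (jet_of u v q)"
      unfolding uxd[OF that] jet[OF that] unfolding q
      by (rule partial_plane) (use that q smooth_on_differentiable[OF sm(4)] d in \<open>auto simp: H_def\<close>)
  qed
  have o: "(0, 0) \<in> ?D" using r by simp
  have lin: "((\<lambda>s. a + s * b) has_vector_derivative b) (at 0)" for a b :: real
    by (auto intro!: derivative_eq_intros simp: has_real_derivative_iff_has_vector_derivative[symmetric])
  have Aeq: "((\<lambda>t. fst (A (0, t))) has_vector_derivative zt) (at 0)" "((\<lambda>t. snd (A (0, t))) has_vector_derivative yt) (at 0)"
    by (rule has_vector_derivative_transform_within_open[OF lin[of z zt], of "{-r<..<r}"], use r A0 in auto)
      (rule has_vector_derivative_transform_within_open[OF lin[of y yt], of "{-r<..<r}"], use r A0 in auto)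
  have Beq: "((\<lambda>x. fst (B (x, 0))) has_vector_derivative z2) (at 0)" "((\<lambda>x. snd (B (x, 0))) has_vector_derivative y2) (at 0)"
    by (rule has_vector_derivative_transform_within_open[OF lin[of z1 z2], of "{-r<..<r}"], use r B0 in auto)
      (rule has_vector_derivative_transform_within_open[OF lin[of y1 y2], of "{-r<..<r}"], use r B0 in auto)
  show ?thesis
  proof (rule that[OF op o sm(1,2)])
    show "jet_of u v ` ?D \<subseteq> V"
    proof
      fix P assume "P \<in> jet_of u v ` ?D"
      then obtain q where q: "q \<in> ?D" "P = ?m (A q, B q)" using jet by auto
      then show "P \<in> V" using AB[OF q(1)] by (simp add: \<Omega>_def)
    qed
    show "solves_system F G ?D u v" using sys by (simp add: solves_system_def)
    show "jet_of u v (0, 0) = (z, z1, y, y1)" using jet[OF o] A0[of 0] B0[of 0] r by simp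
    show "D_x (D_x u) (0, 0) = z2" "D_x (D_x v) (0, 0) = y2"
      unfolding uxd[OF o]
      by (rule partial_plane(1)[OF smooth_on_differentiable[OF sm(3) o] Beq(1)],
          rule partial_plane(1)[OF smooth_on_differentiable[OF sm(4) o] Beq(2)])
    show "D_t u (0, 0) = zt" "D_t v (0, 0) = yt"
      using partial_plane(2)[OF smooth_on_differentiable[OF sm(1) o]] partial_plane(2)[OF smooth_on_differentiable[OF sm(2) o]]
        Aeq by (auto simp: u_def v_def)
  qed
qed

section \<open>The structure equations as relations between jets\<close>

text \<open>
  The structure equations at a point where \<open>u, v\<close> have jet \<open>P\<close>, with \<open>u\<^sub>x\<^sub>x, v\<^sub>x\<^sub>x, u\<^sub>t, v\<^sub>t, u\<^sub>x\<^sub>t, v\<^sub>x\<^sub>t\<close> replaced by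
  independent variables; \<open>X\<close> and \<open>T\<close> are the total derivatives in \<open>x\<close> and \<open>t\<close>.
\<close>

definition struct_eqs :: "real \<Rightarrow> (nat \<Rightarrow> nat \<Rightarrow> jet \<Rightarrow> real) \<Rightarrow> jet \<Rightarrow>
    real \<Rightarrow> real \<Rightarrow> real \<Rightarrow> real \<Rightarrow> real \<Rightarrow> real \<Rightarrow> bool" where
  "struct_eqs \<delta> f P z2 y2 zt yt z1t y1t \<longleftrightarrow>
    (let X = (\<lambda>k. J\<^sub>z k P * fst (snd P) + J\<^sub>z\<^sub>1 k P * z2 + J\<^sub>y k P * snd (snd (snd P)) + J\<^sub>y\<^sub>1 k P * y2);
         T = (\<lambda>k. J\<^sub>z k P * zt + J\<^sub>z\<^sub>1 k P * z1t + J\<^sub>y k P * yt + J\<^sub>y\<^sub>1 k P * y1t)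
     in X (f 1 2) - T (f 1 1) = f 3 1 P * f 2 2 P - f 3 2 P * f 2 1 P \<and>
        X (f 2 2) - T (f 2 1) = f 1 1 P * f 3 2 P - f 1 2 P * f 3 1 P \<and>
        X (f 3 2) - T (f 3 1) = \<delta> * (f 1 1 P * f 2 2 P - f 1 2 P * f 2 1 P))"

lemma partial_along_jet:
  assumes "open D" "q \<in> D" "smooth_on D u" "smooth_on D v" "k differentiable (at (jet_of u v q))"
  shows "partial e (\<lambda>q. k (jet_of u v q)) q = partial e u q * J\<^sub>z k (jet_of u v q) + partial e (D_x u) q * J\<^sub>z\<^sub>1 k (jet_of u v q)
    + partial e v q * J\<^sub>y k (jet_of u v q) + partial e (D_x v) q * J\<^sub>y\<^sub>1 k (jet_of u v q)"
proof -
  have d: "(w has_derivative (\<lambda>h. partial h w q)) (at q)" if "smooth_on D w" for w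
    using smooth_on_differentiable[OF that assms(2)] unfolding frechet_derivative_works partial_def .
  have "(jet_of u v has_derivative (\<lambda>h. (partial h u q, partial h (D_x u) q, partial h v q, partial h (D_x v) q))) (at q)"
    unfolding jet_of_def[abs_def]
    by (intro has_derivative_Pair d assms smooth_on_plane_partials)
  moreover have "(k has_derivative frechet_derivative k (at (jet_of u v q))) (at (jet_of u v q))"
    using assms(5) frechet_derivative_works by blast
  ultimately have "((\<lambda>q. k (jet_of u v q)) has_derivative (\<lambda>h. frechet_derivative k (at (jet_of u v q))
      (partial h u q, partial h (D_x u) q, partial h v q, partial h (D_x v) q))) (at q)"
    by (rule has_derivative_compose)
  then show ?thesis by (simp add: partial_eqI frechet_derivative_jet[OF assms(5)])
qed

lemma solves_structure_iff:
  assumes "open D" "smooth_on D u" "smooth_on D v" "jet_of u v ` D \<subseteq> V"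
    and f: "\<forall>i\<in>{1,2,3}. \<forall>j\<in>{1,2}. smooth_on V (f i j)"
  shows "solves_structure \<delta> f D u v \<longleftrightarrow> (\<forall>q\<in>D. struct_eqs \<delta> f (jet_of u v q)
    (D_x (D_x u) q) (D_x (D_x v) q) (D_t u q) (D_t v q) (D_t (D_x u) q) (D_t (D_x v) q))"
proof -
  have "f i j differentiable (at (jet_of u v q))" if "i \<in> {1,2,3}" "j \<in> {1,2}" "q \<in> D" for i j q
    using smooth_on_differentiable[of V "f i j" "jet_of u v q"] f that assms(4) by blast
  note chain = partial_along_jet[OF assms(1) _ assms(2,3) this]
  have jet: "fst (snd (jet_of u v q)) = D_x u q" "snd (snd (snd (jet_of u v q))) = D_x v q" for q
    by (simp_all add: jet_of_def)
  show ?thesis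
    unfolding solves_structure_def struct_eqs_def Let_def assoc_form_def ext_d_def wedge_def fst_conv snd_conv jet
    by (intro ball_cong refl) (simp add: chain mult.commute)
qed

lemma describes_imp_struct_eqs:
  assumes "describes_surfaces \<delta> V F G f" "open V" "smooth_on V F" "smooth_on V G" "P \<in> V"
  shows "struct_eqs \<delta> f P z2 y2 zt yt (F P) (G P)"
proof -
  obtain z z1 y y1 where P: "P = (z, z1, y, y1)" by (cases P)
  then have "(z, z1, y, y1) \<in> V" using assms(5) by simp
  then obtain D u v where D: "open D" "(0, 0) \<in> D" "smooth_on D u" "smooth_on D v" "jet_of u v ` D \<subseteq> V"
    "solves_system F G D u v" and jet: "jet_of u v (0, 0) = (z, z1, y, y1)"
    "D_x (D_x u) (0, 0) = z2" "D_x (D_x v) (0, 0) = y2" "D_t u (0, 0) = zt" "D_t v (0, 0) = yt"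
    using system_solution_with_jet[OF assms(2-4), where ?z2.0=z2 and ?y2.0=y2 and zt=zt and yt=yt] by metis
  have "solves_structure \<delta> f D u v" using assms(1) D by (simp add: describes_surfaces_def)
  then have "struct_eqs \<delta> f (jet_of u v (0, 0)) (D_x (D_x u) (0, 0)) (D_x (D_x v) (0, 0)) (D_t u (0, 0)) (D_t v (0, 0))
      (D_t (D_x u) (0, 0)) (D_t (D_x v) (0, 0))"
    using solves_structure_iff[OF D(1,3,4,5)] assms(1) D(2) unfolding describes_surfaces_def by blast
  moreover have "D_t (D_x u) (0, 0) = F P" "D_t (D_x v) (0, 0) = G P"
    using D(2,6) jet(1) P unfolding solves_system_def by auto
  ultimately show ?thesis by (simp add: jet P)
qed

text \<open>
  On a box this says that the \<open>f\<^sub>i\<^sub>1\<close> are functions of \<open>(z1, y1)\<close> and the \<open>f\<^sub>i\<^sub>2\<close> are functions of \<open>(z, y)\<close>.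
\<close>

definition separated :: "jet set \<Rightarrow> (nat \<Rightarrow> nat \<Rightarrow> jet \<Rightarrow> real) \<Rightarrow> bool" where
  "separated V f \<longleftrightarrow> (\<forall>P\<in>V. \<forall>i\<in>{1,2,3}. J\<^sub>z (f i 1) P = 0 \<and> J\<^sub>y (f i 1) P = 0 \<and>
     J\<^sub>z\<^sub>1 (f i 2) P = 0 \<and> J\<^sub>y\<^sub>1 (f i 2) P = 0)"

text \<open>
  What remains of the structure equations for separated \<open>f\<close> with \<open>f\<^sub>2\<^sub>1 = \<eta>\<close>: the variables \<open>z2, y2, zt, yt\<close> have
  disappeared, and the second equation no longer involves \<open>z1t\<close> and \<open>y1t\<close>.
\<close>

definition reduced_eqs :: "real \<Rightarrow> real \<Rightarrow> (nat \<Rightarrow> nat \<Rightarrow> jet \<Rightarrow> real) \<Rightarrow> jet \<Rightarrow> real \<Rightarrow> real \<Rightarrow> bool" where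
  "reduced_eqs \<delta> \<eta> f P z1t y1t \<longleftrightarrow>
    (let z1 = fst (snd P); y1 = snd (snd (snd P)) in
     J\<^sub>z (f 1 2) P * z1 + J\<^sub>y (f 1 2) P * y1 - J\<^sub>z\<^sub>1 (f 1 1) P * z1t - J\<^sub>y\<^sub>1 (f 1 1) P * y1t = f 3 1 P * f 2 2 P - f 3 2 P * \<eta> \<and>
     J\<^sub>z (f 2 2) P * z1 + J\<^sub>y (f 2 2) P * y1 = f 1 1 P * f 3 2 P - f 1 2 P * f 3 1 P \<and>
     J\<^sub>z (f 3 2) P * z1 + J\<^sub>y (f 3 2) P * y1 - J\<^sub>z\<^sub>1 (f 3 1) P * z1t - J\<^sub>y\<^sub>1 (f 3 1) P * y1t = \<delta> * (f 1 1 P * f 2 2 P - f 1 2 P * \<eta>))"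

lemma partial_const: "partial e (\<lambda>_. c) x = 0"
  by (simp add: partial_def frechet_derivative_const)

lemma partial_eq_0_of_const:
  assumes "open V" "P \<in> V" "\<forall>P\<in>V. k P = c"
  shows "partial e k P = 0"
  using partial_cong[OF assms(1,2), of k "\<lambda>_. c" e] assms(3) partial_const by metis

lemma struct_eqs_separated:
  assumes "separated V f" "open V" "P \<in> V" "\<forall>P\<in>V. f 2 1 P = \<eta>"
  shows "struct_eqs \<delta> f P z2 y2 zt yt z1t y1t \<longleftrightarrow> reduced_eqs \<delta> \<eta> f P z1t y1t"
  using assms(1,3,4) partial_eq_0_of_const[OF assms(2,3,4)]
  by (auto simp: struct_eqs_def reduced_eqs_def separated_def Let_def)

text \<open>
  The structure equations hold for all values of \<open>z2, y2, zt, yt\<close> and are affine in them, so the four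
  coefficients vanish.
\<close>

lemma describes_imp_separated:
  assumes "describes_surfaces \<delta> V F G f" "open V" "smooth_on V F" "smooth_on V G"
  shows "separated V f"
  unfolding separated_def
proof (intro ballI)
  fix P and i :: nat assume P: "P \<in> V" and i: "i \<in> {1,2,3}"
  note S = describes_imp_struct_eqs[OF assms P, unfolded struct_eqs_def Let_def]
  from S[of 0 0 0 0] S[of 1 0 0 0] S[of 0 1 0 0] S[of 0 0 1 0] S[of 0 0 0 1] i
  show "J\<^sub>z (f i 1) P = 0 \<and> J\<^sub>y (f i 1) P = 0 \<and> J\<^sub>z\<^sub>1 (f i 2) P = 0 \<and> J\<^sub>y\<^sub>1 (f i 2) P = 0"
    by auto
qed

section \<open>Generic points and cubes\<close>

lemma smooth_on_add: "open S \<Longrightarrow> smooth_on S f \<Longrightarrow> smooth_on S g \<Longrightarrow> smooth_on S (\<lambda>x. f x + g x)"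
  by (simp add: smooth_iff_Ck Ck_add)

lemma smooth_on_uminus: "open S \<Longrightarrow> smooth_on S f \<Longrightarrow> smooth_on S (\<lambda>x. - f x)"
  by (simp add: smooth_iff_Ck Ck_uminus)

lemma smooth_on_mult: "open S \<Longrightarrow> smooth_on S f \<Longrightarrow> smooth_on S g \<Longrightarrow> smooth_on S (\<lambda>x. f x * g x)"
  by (simp add: smooth_iff_Ck Ck_mult)

lemma smooth_on_const: "open S \<Longrightarrow> smooth_on S (\<lambda>x. c)"
  by (simp add: smooth_iff_Ck Ck_const)

lemma smooth_on_cong: "open S \<Longrightarrow> (\<And>x. x \<in> S \<Longrightarrow> f x = g x) \<Longrightarrow> smooth_on S f \<Longrightarrow> smooth_on S g"
  unfolding smooth_iff_Ck using Ck_cong by blast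

lemma smooth_on_compose_linear:
  assumes "open S" "smooth_on T f" "bounded_linear L" "\<And>x. x \<in> S \<Longrightarrow> L x + c \<in> T"
  shows "smooth_on S (\<lambda>x. f (L x + c))"
  unfolding smooth_iff_Ck
proof
  fix k
  have "Ck k T f" using assms(2) by (simp add: smooth_iff_Ck)
  moreover have "Ck k S (\<lambda>x. L x + c)" by (intro Ck_add Ck_linear Ck_const assms(1,3))
  ultimately show "Ck k S (\<lambda>x. f (L x + c))" by (rule Ck_compose[OF assms(1)]) (rule assms(4))
qed

lemma bounded_linear_proj: "bounded_linear proj_z1y1" "bounded_linear proj_zy" "bounded_linear (xi a b)"
  unfolding proj_z1y1_def proj_zy_def xi_def case_prod_unfold
  by (intro bounded_linear_Pair bounded_linear_add bounded_linear_const_mult bounded_linear_compose[OF bounded_linear_fst]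
      bounded_linear_compose[OF bounded_linear_snd] bounded_linear_ident)+

lemma ae_on_witness:
  assumes "ae_on U C" "open V" "V \<noteq> {}" "V \<subseteq> U"
  obtains P where "P \<in> V" "C P"
proof -
  have "\<not> negligible V" using assms(2,3) open_not_negligible by blast
  then have "\<not> V \<subseteq> {P \<in> U. \<not> C P}" using assms(1) negligible_subset unfolding ae_on_def by blast
  then show ?thesis using that assms(4) by blast
qed

lemma ae_on_conj: "ae_on U C \<Longrightarrow> ae_on U C' \<Longrightarrow> ae_on U (\<lambda>P. C P \<and> C' P)"
  unfolding ae_on_def by (drule (1) negligible_Un, erule negligible_subset) auto

lemma ae_on_subset: "ae_on U C \<Longrightarrow> V \<subseteq> U \<Longrightarrow> ae_on V C"
  unfolding ae_on_def by (erule negligible_subset) auto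

lemma describes_with_eta_subset:
  assumes "describes_with_eta \<delta> \<eta> V F G f" "V' \<subseteq> V"
  shows "describes_with_eta \<delta> \<eta> V' F G f"
  using assms smooth_on_subset ae_on_subset[OF _ assms(2)]
  unfolding describes_with_eta_def describes_surfaces_def by (meson order_trans subsetD)

text \<open>
  Boxes rather than balls, because on a box the variables \<open>(z, y)\<close> and \<open>(z1, y1)\<close> range independently.
\<close>

definition cube :: "jet \<Rightarrow> real \<Rightarrow> jet set" where
  "cube P \<epsilon> = (case P of (a, b, c, d) \<Rightarrow>
     {a - \<epsilon><..<a + \<epsilon>} \<times> {b - \<epsilon><..<b + \<epsilon>} \<times> {c - \<epsilon><..<c + \<epsilon>} \<times> {d - \<epsilon><..<d + \<epsilon>})"

lemma mem_cube: "(z, z1, y, y1) \<in> cube (a, b, c, d) \<epsilon> \<longleftrightarrow>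
    \<bar>z - a\<bar> < \<epsilon> \<and> \<bar>z1 - b\<bar> < \<epsilon> \<and> \<bar>y - c\<bar> < \<epsilon> \<and> \<bar>y1 - d\<bar> < \<epsilon>"
  by (auto simp: cube_def abs_less_iff)

lemma cube_open: "open (cube P \<epsilon>)"
  by (auto simp: cube_def open_Times split: prod.split)

lemma cube_convex: "convex (cube P \<epsilon>)"
  by (auto simp: cube_def intro!: convex_Times split: prod.split)

lemma cube_center: "\<epsilon> > 0 \<Longrightarrow> P \<in> cube P \<epsilon>"
  by (cases P) (simp add: mem_cube)

lemma cube_in_open:
  assumes "open V" "P \<in> V"
  obtains \<epsilon> where "\<epsilon> > 0" "cube P \<epsilon> \<subseteq> V"
proof -
  obtain e where e: "e > 0" "ball P e \<subseteq> V" using assms open_contains_ball by blast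
  have "cube P (e / 4) \<subseteq> ball P e"
  proof
    fix Q assume Q: "Q \<in> cube P (e / 4)"
    obtain a b c d where P: "P = (a, b, c, d)" by (cases P)
    obtain z z1 y y1 where Q': "Q = (z, z1, y, y1)" by (cases Q)
    have m: "\<bar>z - a\<bar> < e / 4" "\<bar>z1 - b\<bar> < e / 4" "\<bar>y - c\<bar> < e / 4" "\<bar>y1 - d\<bar> < e / 4"
      using Q unfolding P Q' mem_cube by auto
    have "norm (z - a, z1 - b, y - c, y1 - d) \<le> \<bar>z - a\<bar> + (\<bar>z1 - b\<bar> + (\<bar>y - c\<bar> + \<bar>y1 - d\<bar>))"
      using norm_Pair_le[of "z - a" "(z1 - b, y - c, y1 - d)"] norm_Pair_le[of "z1 - b" "(y - c, y1 - d)"]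
        norm_Pair_le[of "y - c" "y1 - d"] by simp
    then have "norm (Q - P) < e" using m by (simp add: P Q')
    then show "Q \<in> ball P e" by (simp add: dist_norm norm_minus_commute)
  qed
  then show ?thesis using that[of "e / 4"] e by auto
qed

lemma cube_subdomain: "\<epsilon> > 0 \<Longrightarrow> cube P \<epsilon> \<subseteq> V \<Longrightarrow> subdomain (cube P \<epsilon>) V"
  unfolding subdomain_def using cube_open cube_convex convex_connected cube_center by blast

lemma open_nonzero:
  fixes k :: "'a::topological_space \<Rightarrow> real"
  assumes "open V" "continuous_on V k"
  shows "open {P \<in> V. k P \<noteq> 0}"
proof -
  have "{P \<in> V. k P \<noteq> 0} = V \<inter> k -` (- {0})" by auto
  then show ?thesis using assms by (simp add: continuous_on_open_vimage Int_commute open_Compl)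
qed

section \<open>Solving the structure equations for the system\<close>

text \<open>
  The Jacobian of \<open>(f\<^sub>1\<^sub>1, f\<^sub>3\<^sub>1)\<close> with respect to \<open>(z1, y1)\<close>.
\<close>

definition jac :: "(nat \<Rightarrow> nat \<Rightarrow> jet \<Rightarrow> real) \<Rightarrow> jet \<Rightarrow> real" where
  "jac f P = J\<^sub>z\<^sub>1 (f 1 1) P * J\<^sub>y\<^sub>1 (f 3 1) P - J\<^sub>y\<^sub>1 (f 1 1) P * J\<^sub>z\<^sub>1 (f 3 1) P"

lemma jac_continuous:
  assumes "\<forall>i\<in>{1,2,3}. \<forall>j\<in>{1,2}. smooth_on V (f i j)"
  shows "continuous_on V (jac f)"
  unfolding jac_def[abs_def] using assms
  by (intro continuous_intros smooth_on_continuous smooth_on_jet_partials) auto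

text \<open>
  Where the Jacobian vanishes identically, the rows \<open>(\<partial>f\<^sub>i\<^sub>1/\<partial>z1, \<partial>f\<^sub>i\<^sub>1/\<partial>y1)\<close>, \<open>i = 1, 3\<close>, have a common smooth kernel vector
  \<open>(k1, k2)\<close>: a nonzero row rotated by a right angle, or \<open>(1, 0)\<close> if both rows vanish identically. Solutions of the
  system with right-hand sides \<open>F + k1\<close>, \<open>G + k2\<close> satisfy the structure equations, so they would have to satisfy
  the original system as well, which is impossible at a point where \<open>(k1, k2)\<close> is nonzero.
\<close>

lemma jac_nonzero_somewhere:
  assumes desc: "describes_with_eta \<delta> \<eta> V F G f" and V: "open V" "V \<noteq> {}"
    and FG: "smooth_on V F" "smooth_on V G"
  shows "\<exists>P\<in>V. jac f P \<noteq> 0"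
proof (rule ccontr)
  assume "\<not> ?thesis"
  then have zero: "J\<^sub>z\<^sub>1 (f 1 1) P * J\<^sub>y\<^sub>1 (f 3 1) P - J\<^sub>y\<^sub>1 (f 1 1) P * J\<^sub>z\<^sub>1 (f 3 1) P = 0" if "P \<in> V" for P
    using that unfolding jac_def by blast
  have ds: "describes_surfaces \<delta> V F G f" and eta: "\<forall>P\<in>V. f 2 1 P = \<eta>"
    using desc by (auto simp: describes_with_eta_def)
  then have sm: "\<forall>i\<in>{1,2,3}. \<forall>j\<in>{1,2}. smooth_on V (f i j)" by (simp add: describes_surfaces_def)
  have sep: "separated V f" by (rule describes_imp_separated[OF ds V(1) FG])
  have red: "reduced_eqs \<delta> \<eta> f P (F P) (G P)" if "P \<in> V" for P
    using describes_imp_struct_eqs[OF ds V(1) FG that] struct_eqs_separated[OF sep V(1) that eta] by blast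
  let ?ker = "\<lambda>k1 k2 P0. smooth_on V k1 \<and> smooth_on V k2 \<and> P0 \<in> V \<and> (k1 P0 \<noteq> 0 \<or> k2 P0 \<noteq> 0) \<and>
    (\<forall>P\<in>V. J\<^sub>z\<^sub>1 (f 1 1) P * k1 P + J\<^sub>y\<^sub>1 (f 1 1) P * k2 P = 0 \<and> J\<^sub>z\<^sub>1 (f 3 1) P * k1 P + J\<^sub>y\<^sub>1 (f 3 1) P * k2 P = 0)"
  have row: "?ker (J\<^sub>y\<^sub>1 (f i 1)) (\<lambda>P. - J\<^sub>z\<^sub>1 (f i 1) P) P"
    if "i = 1 \<or> i = 3" "P \<in> V" "J\<^sub>z\<^sub>1 (f i 1) P \<noteq> 0 \<or> J\<^sub>y\<^sub>1 (f i 1) P \<noteq> 0" for i P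
  proof -
    have "smooth_on V (f i 1)" using that(1) sm by auto
    then have "smooth_on V (J\<^sub>y\<^sub>1 (f i 1))" "smooth_on V (\<lambda>P. - J\<^sub>z\<^sub>1 (f i 1) P)"
      using V(1) by (auto intro!: smooth_on_uminus smooth_on_jet_partials)
    then show ?thesis using that zero by (auto simp: algebra_simps)
  qed
  have "\<exists>k1 k2 P0. ?ker k1 k2 P0"
  proof (cases "\<exists>P\<in>V. \<exists>i. (i = 1 \<or> i = 3) \<and> (J\<^sub>z\<^sub>1 (f i 1) P \<noteq> 0 \<or> J\<^sub>y\<^sub>1 (f i 1) P \<noteq> 0)")
    case True
    then obtain P i where "P \<in> V" "i = 1 \<or> i = 3" "J\<^sub>z\<^sub>1 (f i 1) P \<noteq> 0 \<or> J\<^sub>y\<^sub>1 (f i 1) P \<noteq> 0" by blast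
    from row[OF this(2,1,3)] show ?thesis by blast
  next
    case False
    obtain P where P: "P \<in> V" using V(2) by blast
    have "?ker (\<lambda>_. 1) (\<lambda>_. 0) P" using False P V(1) smooth_on_const by auto
    then show ?thesis by blast
  qed
  then obtain k1 k2 P0 where k: "smooth_on V k1" "smooth_on V k2" "P0 \<in> V" "k1 P0 \<noteq> 0 \<or> k2 P0 \<noteq> 0"
    and ker: "\<And>P. P \<in> V \<Longrightarrow> J\<^sub>z\<^sub>1 (f 1 1) P * k1 P + J\<^sub>y\<^sub>1 (f 1 1) P * k2 P = 0"
      "\<And>P. P \<in> V \<Longrightarrow> J\<^sub>z\<^sub>1 (f 3 1) P * k1 P + J\<^sub>y\<^sub>1 (f 3 1) P * k2 P = 0"
    by blast
  obtain z z1 y y1 where P0: "P0 = (z, z1, y, y1)" by (cases P0)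
  obtain D u v where D: "open D" "(0, 0) \<in> D" "smooth_on D u" "smooth_on D v" "jet_of u v ` D \<subseteq> V"
    "solves_system (\<lambda>P. F P + k1 P) (\<lambda>P. G P + k2 P) D u v" "jet_of u v (0, 0) = (z, z1, y, y1)"
    by (rule system_solution_with_jet[OF V(1) smooth_on_add[OF V(1) FG(1) k(1)] smooth_on_add[OF V(1) FG(2) k(2)]
        k(3)[unfolded P0], where ?z2.0=0 and ?y2.0=0 and zt=0 and yt=0]) blast
  have "solves_structure \<delta> f D u v"
    unfolding solves_structure_iff[OF D(1,3-5) sm]
  proof
    fix q assume q: "q \<in> D"
    let ?P = "jet_of u v q"
    have P: "?P \<in> V" using q D(5) by blast
    have 1: "D_t (D_x u) q = F ?P + k1 ?P" "D_t (D_x v) q = G ?P + k2 ?P"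
      using D(6) q by (auto simp: solves_system_def)
    have "reduced_eqs \<delta> \<eta> f ?P (F ?P + k1 ?P) (G ?P + k2 ?P)"
      using red[OF P] ker[OF P] by (simp add: reduced_eqs_def Let_def algebra_simps)
    then show "struct_eqs \<delta> f ?P (D_x (D_x u) q) (D_x (D_x v) q) (D_t u q) (D_t v q) (D_t (D_x u) q) (D_t (D_x v) q)"
      unfolding struct_eqs_separated[OF sep V(1) P eta] 1 .
  qed
  then have "solves_system F G D u v" using ds D unfolding describes_surfaces_def by blast
  then have "F P0 + k1 P0 = F P0" "G P0 + k2 P0 = G P0"
    using D(2,6,7) unfolding solves_system_def P0 by force+
  then show False using k(4) by simp
qed

text \<open>
  Subtracting the identities satisfied by \<open>F\<close> and \<open>G\<close> from the structure equations leaves a homogeneous linear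
  system for \<open>(u\<^sub>x\<^sub>t - F, v\<^sub>x\<^sub>t - G)\<close> with determinant \<open>jac f\<close>.
\<close>

lemma describes_of_reduced_eqs:
  assumes "open V" "\<forall>i\<in>{1,2,3}. \<forall>j\<in>{1,2}. smooth_on V (f i j)" "separated V f" "\<forall>P\<in>V. f 2 1 P = \<eta>"
    "\<And>P. P \<in> V \<Longrightarrow> jac f P \<noteq> 0" "\<And>P. P \<in> V \<Longrightarrow> f 1 1 P * f 2 2 P - f 1 2 P * f 2 1 P \<noteq> 0"
    "\<And>P. P \<in> V \<Longrightarrow> reduced_eqs \<delta> \<eta> f P (F P) (G P)"
  shows "describes_with_eta \<delta> \<eta> V F G f"
proof -
  have iff: "reduced_eqs \<delta> \<eta> f P a b \<longleftrightarrow> a = F P \<and> b = G P" if P: "P \<in> V" for P a b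
  proof
    assume "reduced_eqs \<delta> \<eta> f P a b"
    with assms(7)[OF P]
    have 1: "J\<^sub>z\<^sub>1 (f 1 1) P * (a - F P) + J\<^sub>y\<^sub>1 (f 1 1) P * (b - G P) = 0"
      and 3: "J\<^sub>z\<^sub>1 (f 3 1) P * (a - F P) + J\<^sub>y\<^sub>1 (f 3 1) P * (b - G P) = 0"
      by (auto simp: reduced_eqs_def Let_def algebra_simps)
    have "jac f P * (a - F P) = 0" "jac f P * (b - G P) = 0"
      using 1 3 unfolding jac_def by algebra+
    then show "a = F P \<and> b = G P" using assms(5)[OF P] by simp
  qed (use assms(7)[OF P] in simp)
  have equiv: "solves_system F G D u v \<longleftrightarrow> solves_structure \<delta> f D u v"
    if D: "open D" "smooth_on D u" "smooth_on D v" "jet_of u v ` D \<subseteq> V" for D u v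
    unfolding solves_structure_iff[OF D assms(2)] solves_system_def
  proof (intro ball_cong refl)
    fix q assume "q \<in> D"
    then have P: "jet_of u v q \<in> V" using D(4) by blast
    show "(D_t (D_x u) q = F (jet_of u v q) \<and> D_t (D_x v) q = G (jet_of u v q)) =
        struct_eqs \<delta> f (jet_of u v q) (D_x (D_x u) q) (D_x (D_x v) q) (D_t u q) (D_t v q) (D_t (D_x u) q) (D_t (D_x v) q)"
      unfolding struct_eqs_separated[OF assms(3,1) P assms(4)] iff[OF P] ..
  qed
  have empty: "{P \<in> V. \<not> f 1 1 P * f 2 2 P - f 1 2 P * f 2 1 P \<noteq> 0} = {}" using assms(6) by blast
  have ae: "ae_on V (\<lambda>P. f 1 1 P * f 2 2 P - f 1 2 P * f 2 1 P \<noteq> 0)"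
    unfolding ae_on_def empty by (rule negligible_empty)
  show ?thesis
    unfolding describes_with_eta_def describes_surfaces_def
    by (intro conjI assms(2,4) ae allI impI equiv)
qed

section \<open>Functions of fewer variables\<close>

lemma partial_pullback:
  assumes "open V" "P \<in> V" "\<And>P. P \<in> V \<Longrightarrow> k P = g (L P)" "bounded_linear L" "g differentiable (at (L P))"
  shows "partial e k P = frechet_derivative g (at (L P)) (L e)"
proof -
  have "((\<lambda>P. g (L P)) has_derivative (\<lambda>h. frechet_derivative g (at (L P)) (L h))) (at P)"
    by (rule has_derivative_compose[OF bounded_linear_imp_has_derivative[OF assms(4)]])
      (use assms(5) frechet_derivative_works in blast)
  from partial_eqI[OF this, of e] show ?thesis
    using partial_cong[of V P k "\<lambda>P. g (L P)" e] assms(1-3) by simp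
qed

lemma partials_z1y1:
  assumes "open V" "P \<in> V" "\<And>P. P \<in> V \<Longrightarrow> k P = g (proj_z1y1 P)" "g differentiable (at (proj_z1y1 P))"
  shows "J\<^sub>z k P = 0" "J\<^sub>z\<^sub>1 k P = D1 g (proj_z1y1 P)" "J\<^sub>y k P = 0" "J\<^sub>y\<^sub>1 k P = D2 g (proj_z1y1 P)"
proof -
  have "partial e k P = frechet_derivative g (at (proj_z1y1 P)) (proj_z1y1 e)" for e
    using assms(1-3) bounded_linear_proj(1) assms(4) by (rule partial_pullback)
  moreover have "proj_z1y1 (1, 0, 0, 0) = (0, 0)" "proj_z1y1 (0, 1, 0, 0) = (1, 0)" "proj_z1y1 (0, 0, 1, 0) = (0, 0)" "proj_z1y1 (0, 0, 0, 1) = (0, 1)"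
    by (simp_all add: proj_z1y1_def)
  ultimately show "J\<^sub>z k P = 0" "J\<^sub>z\<^sub>1 k P = D1 g (proj_z1y1 P)" "J\<^sub>y k P = 0" "J\<^sub>y\<^sub>1 k P = D2 g (proj_z1y1 P)"
    by (simp_all add: frechet_derivative_pair[OF assms(4)])
qed

lemma partials_zy:
  assumes "open V" "P \<in> V" "\<And>P. P \<in> V \<Longrightarrow> k P = p (proj_zy P)" "p differentiable (at (proj_zy P))"
  shows "J\<^sub>z k P = D1 p (proj_zy P)" "J\<^sub>z\<^sub>1 k P = 0" "J\<^sub>y k P = D2 p (proj_zy P)" "J\<^sub>y\<^sub>1 k P = 0"
proof -
  have "partial e k P = frechet_derivative p (at (proj_zy P)) (proj_zy e)" for e
    using assms(1-3) bounded_linear_proj(2) assms(4) by (rule partial_pullback)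
  moreover have "proj_zy (1, 0, 0, 0) = (1, 0)" "proj_zy (0, 1, 0, 0) = (0, 0)" "proj_zy (0, 0, 1, 0) = (0, 1)" "proj_zy (0, 0, 0, 1) = (0, 0)"
    by (simp_all add: proj_zy_def)
  ultimately show "J\<^sub>z k P = D1 p (proj_zy P)" "J\<^sub>z\<^sub>1 k P = 0" "J\<^sub>y k P = D2 p (proj_zy P)" "J\<^sub>y\<^sub>1 k P = 0"
    by (simp_all add: frechet_derivative_pair[OF assms(4)])
qed

lemma partials_xi:
  assumes "open V" "P \<in> V" "\<And>P. P \<in> V \<Longrightarrow> k P = \<phi> (xi a b P)" "\<phi> differentiable (at (xi a b P))"
  shows "J\<^sub>z k P = b * deriv \<phi> (xi a b P)" "J\<^sub>z\<^sub>1 k P = 0" "J\<^sub>y k P = a * deriv \<phi> (xi a b P)" "J\<^sub>y\<^sub>1 k P = 0"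
proof -
  have "(\<phi> has_real_derivative deriv \<phi> (xi a b P)) (at (xi a b P))"
    using assms(4) by (simp add: DERIV_deriv_iff_real_differentiable)
  then have fd: "frechet_derivative \<phi> (at (xi a b P)) = (\<lambda>h. deriv \<phi> (xi a b P) * h)"
    unfolding has_field_derivative_def using frechet_derivative_at by metis
  have "partial e k P = frechet_derivative \<phi> (at (xi a b P)) (xi a b e)" for e
    using assms(1-3) bounded_linear_proj(3) assms(4) by (rule partial_pullback)
  then have pull: "partial e k P = deriv \<phi> (xi a b P) * xi a b e" for e
    by (simp only: fd)
  show "J\<^sub>z k P = b * deriv \<phi> (xi a b P)" "J\<^sub>z\<^sub>1 k P = 0" "J\<^sub>y k P = a * deriv \<phi> (xi a b P)" "J\<^sub>y\<^sub>1 k P = 0"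
    using pull by (simp_all add: xi_def mult.commute split: prod.split)
qed

lemma smooth_on_deriv:
  assumes "open S" "smooth_on S (\<phi> :: real \<Rightarrow> real)"
  shows "smooth_on S (deriv \<phi>)"
proof (rule smooth_on_cong[OF assms(1)])
  show "smooth_on S (partial 1 \<phi>)" using smooth_on_partial[OF assms(2)] by simp
  show "partial 1 \<phi> x = deriv \<phi> x" if "x \<in> S" for x
  proof -
    have "(\<phi> has_real_derivative deriv \<phi> x) (at x)"
      using smooth_on_differentiable[OF assms(2) that] by (simp add: DERIV_deriv_iff_real_differentiable)
    then show ?thesis unfolding has_field_derivative_def using partial_eqI by fastforce
  qed
qed

lemma open_xi_image:
  assumes "open V" "a\<^sup>2 + b\<^sup>2 \<noteq> 0"
  shows "open (xi a b ` V)"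
proof (rule open_surjective_linear_image[OF assms(1)])
  show "linear (xi a b)" using bounded_linear_proj(3) by (rule bounded_linear.linear)
  have "s = xi a b (s * b / (a\<^sup>2 + b\<^sup>2), 0, s * a / (a\<^sup>2 + b\<^sup>2), 0)" for s
  proof -
    have "xi a b (s * b / (a\<^sup>2 + b\<^sup>2), 0, s * a / (a\<^sup>2 + b\<^sup>2), 0) = s * (a\<^sup>2 + b\<^sup>2) / (a\<^sup>2 + b\<^sup>2)"
      unfolding xi_def by (simp add: power2_eq_square algebra_simps add_divide_distrib del: sum_power2_eq_zero_iff)
    also have "\<dots> = s" using assms(2) by (rule nonzero_mult_div_cancel_right)
    finally show ?thesis by (rule sym)
  qed
  then show "surj (xi a b)" unfolding surj_def by blast
qed

text \<open>
  Write \<open>p\<close> as the integral of \<open>D1 p\<close> in the first variable and differentiate under the integral sign in the second: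
  \<open>D2 p\<close> becomes the integral of \<open>D2 (D1 p)\<close>, whose derivative in the first variable is the integrand.
\<close>

lemma D1_D2_commute:
  assumes "open S" "smooth_on S p" "(x0, t0) \<in> S"
  shows "D1 (D2 p) (x0, t0) = D2 (D1 p) (x0, t0)"
proof -
  obtain A B where AB: "open A" "open B" "(x0, t0) \<in> A \<times> B" and sub: "A \<times> B \<subseteq> S"
    using open_prod_elim[OF assms(1,3)] by metis
  obtain e1 where e1: "e1 > 0" "ball x0 e1 \<subseteq> A" using AB(1,3) open_contains_ball by blast
  obtain e2 where e2: "e2 > 0" "ball t0 e2 \<subseteq> B" using AB(2,3) open_contains_ball by blast
  note e = e1 e2
  define r where "r = min e1 e2"
  have r: "r > 0" using e by (simp add: r_def)
  have inS: "(x0 + x, t0 + t) \<in> S" if "(x, t) \<in> osquare r" for x t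
  proof -
    have "x0 + x \<in> ball x0 e1" "t0 + t \<in> ball t0 e2" using that by (auto simp: r_def dist_real_def)
    then show ?thesis using e sub by blast
  qed
  note sm = smooth_on_plane_partials[OF assms(2)]
  have px: "((\<lambda>x. k (x0 + x, t0 + t)) has_vector_derivative D1 k (x0 + x, t0 + t)) (at x)"
    and pt: "((\<lambda>t. k (x0 + x, t0 + t)) has_vector_derivative D2 k (x0 + x, t0 + t)) (at t)"
    if "(x, t) \<in> osquare r" "smooth_on S k" for k x t
  proof -
    have k: "k differentiable (at (x0 + x, t0 + t))" using smooth_on_differentiable that inS by blast
    have "((\<lambda>x. x0 + x) has_vector_derivative 1) (at x)" "((\<lambda>t. t0 + t) has_vector_derivative 1) (at t)"
      by (auto intro!: derivative_eq_intros)
    from vector_diff_chain_at[OF this(1) has_vector_derivative_partials(1)[OF k]] vector_diff_chain_at[OF this(2) has_vector_derivative_partials(2)[OF k]]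
    show "((\<lambda>x. k (x0 + x, t0 + t)) has_vector_derivative D1 k (x0 + x, t0 + t)) (at x)"
      "((\<lambda>t. k (x0 + x, t0 + t)) has_vector_derivative D2 k (x0 + x, t0 + t)) (at t)"
      by (simp_all add: o_def partial_def)
  qed
  define f where "f q = D1 p (x0 + fst q, t0 + snd q)" for q
  define ft where "ft q = D2 (D1 p) (x0 + fst q, t0 + snd q)" for q
  have cf: "continuous_on (osquare r) f" "continuous_on (osquare r) ft"
    unfolding f_def[abs_def] ft_def[abs_def]
    by (rule continuous_on_compose2[OF smooth_on_continuous[OF sm(1)]], intro continuous_intros, use inS in force)
      (rule continuous_on_compose2[OF smooth_on_continuous[OF smooth_on_plane_partials(2)[OF sm(1)]]], intro continuous_intros, use inS in force)
  have int: "p (x0 + x, t0 + t) = p (x0, t0 + t) + x *\<^sub>R integral {0..1} (\<lambda>s. f (s * x, t))" if xt: "(x, t) \<in> osquare r" for x t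
  proof -
    have "continuous_on {-r<..<r} (\<lambda>x. f (x, t))"
      by (rule continuous_on_compose2[OF cf(1)]) (use xt in \<open>auto intro!: continuous_intros\<close>)
    note sc = has_vector_derivative_scaled_integral[OF this]
    have "((\<lambda>x. p (x0 + x, t0 + t) - x *\<^sub>R integral {0..1} (\<lambda>s. f (s * x, t))) has_vector_derivative 0) (at x' within {-r<..<r})"
      if x': "x' \<in> {-r<..<r}" for x'
    proof -
      have "(x', t) \<in> osquare r" "\<bar>x'\<bar> < r" using x' xt by auto
      from has_vector_derivative_diff[OF px[OF this(1) assms(2)] sc[OF this(2)]]
      show ?thesis by (rule has_vector_derivative_at_within[OF has_vector_derivative_eq_rhs]) (simp add: f_def)
    qed
    note zero = this
    obtain C where C: "\<And>x. x \<in> {-r<..<r} \<Longrightarrow> p (x0 + x, t0 + t) - x *\<^sub>R integral {0..1} (\<lambda>s. f (s * x, t)) = C"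
      by (rule has_vector_derivative_zero_constant[OF convex_real_interval(8) zero]) (assumption, rule that, blast)
    from C[of x] C[of 0] show ?thesis using xt r by simp
  qed
  have "D2 p (x0 + x, t0) = D2 p (x0, t0) + x *\<^sub>R integral {0..1} (\<lambda>s. ft (s * x, 0))" if x: "x \<in> {-r<..<r}" for x
  proof -
    have x0: "(x, 0) \<in> osquare r" "(0, 0) \<in> osquare r" using x r by auto
    have "((\<lambda>t. x *\<^sub>R integral {0..1} (\<lambda>s. f (s * x, t))) has_vector_derivative x *\<^sub>R integral {0..1} (\<lambda>s. ft (s * x, 0))) (at 0)"
    proof (rule has_vector_derivative_integral_x[OF cf _ x0(1)])
      show "((\<lambda>t. f (x, t)) has_vector_derivative ft (x, t)) (at t)" if "(x, t) \<in> osquare r" for x t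
        using pt[OF that sm(1)] by (simp add: f_def ft_def)
    qed
    from has_vector_derivative_add[OF pt[OF x0(2) assms(2)] this]
    have "((\<lambda>t. p (x0, t0 + t) + x *\<^sub>R integral {0..1} (\<lambda>s. f (s * x, t))) has_vector_derivative 
        D2 p (x0, t0) + x *\<^sub>R integral {0..1} (\<lambda>s. ft (s * x, 0))) (at 0)" by simp
    then have "((\<lambda>t. p (x0 + x, t0 + t)) has_vector_derivative 
        D2 p (x0, t0) + x *\<^sub>R integral {0..1} (\<lambda>s. ft (s * x, 0))) (at 0)"
      by (rule has_vector_derivative_transform_within_open[where S="{-r<..<r}"]) (use r x int in auto)
    from vector_derivative_unique_at[OF pt[OF x0(1) assms(2)] this] show ?thesis by simp
  qed
  moreover have "continuous_on {-r<..<r} (\<lambda>x. ft (x, 0))"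
    by (rule continuous_on_compose2[OF cf(2)]) (use r in \<open>auto intro!: continuous_intros\<close>)
  from has_vector_derivative_add[OF has_vector_derivative_const[of "D2 p (x0, t0)"] has_vector_derivative_scaled_integral[OF this, of 0]]
  have "((\<lambda>x. D2 p (x0, t0) + x *\<^sub>R integral {0..1} (\<lambda>s. ft (s * x, 0))) has_vector_derivative ft (0, 0)) (at 0)"
    using r by simp
  ultimately have "((\<lambda>x. D2 p (x0 + x, t0)) has_vector_derivative ft (0, 0)) (at 0)"
    using r by (auto intro: has_vector_derivative_transform_within_open[where S="{-r<..<r}"])
  moreover have "((\<lambda>x. D2 p (x0 + x, t0)) has_vector_derivative D1 (D2 p) (x0, t0)) (at 0)"
    using px[of 0 0 "D2 p"] r sm(2) by simp
  ultimately show ?thesis using vector_derivative_unique_at by (fastforce simp: ft_def)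
qed

section \<open>The two cases\<close>

text \<open>
  The index \<open>1\<close> of the associated functions is kept from being rewritten to \<open>Suc 0\<close>.
\<close>

declare One_nat_def [simp del]

lemma linear_2x2_solve:
  fixes g1 g2 h1 h2 R1 R3 F G :: real
  assumes "g1 * h2 - g2 * h1 \<noteq> 0"
  shows "(g1 * F + g2 * G = R1 \<and> h1 * F + h2 * G = R3) \<longleftrightarrow>
    (F = (h2 * R1 - g2 * R3) / (g1 * h2 - g2 * h1) \<and> G = (g1 * R3 - h1 * R1) / (g1 * h2 - g2 * h1))"
proof
  assume L: "g1 * F + g2 * G = R1 \<and> h1 * F + h2 * G = R3"
  then have R: "R1 = g1 * F + g2 * G" "R3 = h1 * F + h2 * G" by simp_all
  have "F * (g1 * h2 - g2 * h1) = h2 * R1 - g2 * R3" "G * (g1 * h2 - g2 * h1) = g1 * R3 - h1 * R1"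
    unfolding R by (simp_all add: algebra_simps)
  then show "F = (h2 * R1 - g2 * R3) / (g1 * h2 - g2 * h1) \<and> G = (g1 * R3 - h1 * R1) / (g1 * h2 - g2 * h1)"
    using assms by (simp add: nonzero_eq_divide_eq)
next
  let ?W = "g1 * h2 - g2 * h1"
  assume "F = (h2 * R1 - g2 * R3) / ?W \<and> G = (g1 * R3 - h1 * R1) / ?W"
  then have "F * ?W = h2 * R1 - g2 * R3" "G * ?W = g1 * R3 - h1 * R1" using assms by simp_all
  then have "?W * (g1 * F + g2 * G - R1) = 0" "?W * (h1 * F + h2 * G - R3) = 0" by algebra+
  then show "g1 * F + g2 * G = R1 \<and> h1 * F + h2 * G = R3" using assms by simp
qed

text \<open>
  The relations \<open>\<mu> g\<^sub>z\<^sub>1 - \<lambda> h\<^sub>z\<^sub>1 = b\<close> and \<open>\<mu> g\<^sub>y\<^sub>1 - \<lambda> h\<^sub>y\<^sub>1 = a\<close> collapse the terms with \<open>\<phi>''\<close> in Cramer's rule to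
  multiples of \<open>a\<close> and \<open>b\<close>.
\<close>

lemma case_i_solve:
  fixes g h g1 g2 h1 h2 :: real
  defines "W \<equiv> g1 * h2 - g2 * h1"
  assumes W: "W \<noteq> 0" and b: "\<mu> * g1 - lam * h1 = b" and a: "\<mu> * g2 - lam * h2 = a"
  shows "(lam * \<phi>2 * (b * z1 + a * y1) - g1 * F - g2 * G = h * \<phi>0 - \<mu> * \<phi>1 * \<eta> \<and>
      \<mu> * \<phi>2 * (b * z1 + a * y1) - h1 * F - h2 * G = \<delta> * (g * \<phi>0 - lam * \<phi>1 * \<eta>)) \<longleftrightarrow>
    (F = 1 / W * (- (a * b * z1 + a\<^sup>2 * y1) * \<phi>2 + \<eta> * (\<mu> * h2 - \<delta> * lam * g2) * \<phi>1
              - 1 / 2 * (2 * h * h2 - \<delta> * (2 * g * g2)) * \<phi>0) \<and>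
     G = 1 / W * ((b\<^sup>2 * z1 + a * b * y1) * \<phi>2 - \<eta> * (\<mu> * h1 - \<delta> * lam * g1) * \<phi>1
              + 1 / 2 * (2 * h * h1 - \<delta> * (2 * g * g1)) * \<phi>0))"
proof -
  let ?X = "b * z1 + a * y1"
  let ?R1 = "lam * \<phi>2 * ?X - h * \<phi>0 + \<mu> * \<phi>1 * \<eta>" and ?R3 = "\<mu> * \<phi>2 * ?X - \<delta> * (g * \<phi>0 - lam * \<phi>1 * \<eta>)"
  have "h2 * ?R1 - g2 * ?R3 = - (a * b * z1 + a\<^sup>2 * y1) * \<phi>2 + \<eta> * (\<mu> * h2 - \<delta> * lam * g2) * \<phi>1
              - 1 / 2 * (2 * h * h2 - \<delta> * (2 * g * g2)) * \<phi>0"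
    unfolding a[symmetric] b[symmetric] by (simp add: algebra_simps power2_eq_square)
  moreover have "g1 * ?R3 - h1 * ?R1 = (b\<^sup>2 * z1 + a * b * y1) * \<phi>2 - \<eta> * (\<mu> * h1 - \<delta> * lam * g1) * \<phi>1
              + 1 / 2 * (2 * h * h1 - \<delta> * (2 * g * g1)) * \<phi>0"
    unfolding a[symmetric] b[symmetric] by (simp add: algebra_simps power2_eq_square)
  moreover have "(lam * \<phi>2 * ?X - g1 * F - g2 * G = h * \<phi>0 - \<mu> * \<phi>1 * \<eta> \<and>
      \<mu> * \<phi>2 * ?X - h1 * F - h2 * G = \<delta> * (g * \<phi>0 - lam * \<phi>1 * \<eta>)) \<longleftrightarrow>
      (g1 * F + g2 * G = ?R1 \<and> h1 * F + h2 * G = ?R3)" by (auto simp: algebra_simps)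
  ultimately show ?thesis
    using linear_2x2_solve[of g1 h2 g2 h1 F G ?R1 ?R3] W unfolding W_def by simp
qed

lemma case_ii_solve:
  fixes a1 b1 a3 b3 :: real
  defines "\<gamma> \<equiv> a1 * b3 - b1 * a3"
  assumes \<gamma>: "\<gamma> \<noteq> 0"
  shows "((b1 * pzz - a1 * pzy) / \<gamma> * z1 + (b1 * pzy - a1 * pyy) / \<gamma> * y1 - a1 * F - b1 * G
        = (a3 * z1 + b3 * y1) * p - (b3 * pz - a3 * py) / \<gamma> * \<eta> \<and>
      (b3 * pzz - a3 * pzy) / \<gamma> * z1 + (b3 * pzy - a3 * pyy) / \<gamma> * y1 - a3 * F - b3 * G
        = \<delta> * ((a1 * z1 + b1 * y1) * p - (b1 * pz - a1 * py) / \<gamma> * \<eta>)) \<longleftrightarrow>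
    (F = - (z1 / \<gamma>) * (pzy + (a3 * b3 - \<delta> * a1 * b1) * p) - y1 / \<gamma> * (pyy + (b3\<^sup>2 - \<delta> * b1\<^sup>2) * p)
         + \<eta> / \<gamma>\<^sup>2 * ((b3\<^sup>2 - \<delta> * b1\<^sup>2) * pz - (a3 * b3 - \<delta> * a1 * b1) * py) \<and>
     G = z1 / \<gamma> * (pzz + (a3\<^sup>2 - \<delta> * a1\<^sup>2) * p) + y1 / \<gamma> * (pzy + (a3 * b3 - \<delta> * a1 * b1) * p)
         - \<eta> / \<gamma>\<^sup>2 * ((a3 * b3 - \<delta> * a1 * b1) * pz - (a3\<^sup>2 - \<delta> * a1\<^sup>2) * py))"
proof -
  define i where "i = 1 / \<gamma>"
  have i: "\<gamma> * i = 1" using \<gamma> by (simp add: i_def)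
  have di: "x / \<gamma> = x * i" "x / \<gamma>\<^sup>2 = x * i\<^sup>2" for x by (simp_all add: i_def power_one_over)
  let ?R1 = "(b1 * pzz - a1 * pzy) * i * z1 + (b1 * pzy - a1 * pyy) * i * y1 - (a3 * z1 + b3 * y1) * p + (b3 * pz - a3 * py) * i * \<eta>"
  let ?R3 = "(b3 * pzz - a3 * pzy) * i * z1 + (b3 * pzy - a3 * pyy) * i * y1 - \<delta> * ((a1 * z1 + b1 * y1) * p - (b1 * pz - a1 * py) * i * \<eta>)"
  let ?F = "- (z1 * i) * (pzy + (a3 * b3 - \<delta> * a1 * b1) * p) - y1 * i * (pyy + (b3\<^sup>2 - \<delta> * b1\<^sup>2) * p)
         + \<eta> * i\<^sup>2 * ((b3\<^sup>2 - \<delta> * b1\<^sup>2) * pz - (a3 * b3 - \<delta> * a1 * b1) * py)"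
  let ?G = "z1 * i * (pzz + (a3\<^sup>2 - \<delta> * a1\<^sup>2) * p) + y1 * i * (pzy + (a3 * b3 - \<delta> * a1 * b1) * p)
         - \<eta> * i\<^sup>2 * ((a3 * b3 - \<delta> * a1 * b1) * pz - (a3\<^sup>2 - \<delta> * a1\<^sup>2) * py)"
  have i': "(a1 * b3 - b1 * a3) * i = 1" using i by (simp add: \<gamma>_def)
  have "(b3 * ?R1 - b1 * ?R3) * i = - ((a1 * b3 - b1 * a3) * i) * (z1 * i * pzy + y1 * i * pyy)
      - z1 * i * ((a3 * b3 - \<delta> * a1 * b1) * p) - y1 * i * ((b3\<^sup>2 - \<delta> * b1\<^sup>2) * p)
      + \<eta> * i\<^sup>2 * ((b3\<^sup>2 - \<delta> * b1\<^sup>2) * pz - (a3 * b3 - \<delta> * a1 * b1) * py)"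
    by (simp add: algebra_simps power2_eq_square)
  then have F: "(b3 * ?R1 - b1 * ?R3) * i = ?F" unfolding i' by (simp add: algebra_simps)
  have "(a1 * ?R3 - a3 * ?R1) * i = ((a1 * b3 - b1 * a3) * i) * (z1 * i * pzz + y1 * i * pzy)
      + z1 * i * ((a3\<^sup>2 - \<delta> * a1\<^sup>2) * p) + y1 * i * ((a3 * b3 - \<delta> * a1 * b1) * p)
      - \<eta> * i\<^sup>2 * ((a3 * b3 - \<delta> * a1 * b1) * pz - (a3\<^sup>2 - \<delta> * a1\<^sup>2) * py)"
    by (simp add: algebra_simps power2_eq_square)
  then have G: "(a1 * ?R3 - a3 * ?R1) * i = ?G" unfolding i' by (simp add: algebra_simps)
  have "((b1 * pzz - a1 * pzy) * i * z1 + (b1 * pzy - a1 * pyy) * i * y1 - a1 * F - b1 * G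
        = (a3 * z1 + b3 * y1) * p - (b3 * pz - a3 * py) * i * \<eta> \<and>
      (b3 * pzz - a3 * pzy) * i * z1 + (b3 * pzy - a3 * pyy) * i * y1 - a3 * F - b3 * G
        = \<delta> * ((a1 * z1 + b1 * y1) * p - (b1 * pz - a1 * py) * i * \<eta>)) \<longleftrightarrow>
      (a1 * F + b1 * G = ?R1 \<and> a3 * F + b3 * G = ?R3)" by linarith
  also have "\<dots> \<longleftrightarrow> F = (b3 * ?R1 - b1 * ?R3) / \<gamma> \<and> G = (a1 * ?R3 - a3 * ?R1) / \<gamma>"
    unfolding \<gamma>_def by (rule linear_2x2_solve) (use \<gamma> in \<open>simp add: \<gamma>_def\<close>)
  also have "\<dots> \<longleftrightarrow> F = ?F \<and> G = ?G" unfolding di F G ..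
  finally show ?thesis unfolding di .
qed

lemma partial_square_difference:
  assumes "g differentiable (at r)" "h differentiable (at r)"
  shows "partial e (\<lambda>s. (h s)\<^sup>2 - \<delta> * (g s)\<^sup>2) r = 2 * h r * partial e h r - \<delta> * (2 * g r * partial e g r)"
proof -
  have d: "(g has_derivative (\<lambda>e. partial e g r)) (at r)" "(h has_derivative (\<lambda>e. partial e h r)) (at r)"
    using assms unfolding frechet_derivative_works partial_def by auto
  have "((\<lambda>s. (h s)\<^sup>2 - \<delta> * (g s)\<^sup>2) has_derivative (\<lambda>e. 2 * h r * partial e h r - \<delta> * (2 * g r * partial e g r))) (at r)"
    unfolding power2_eq_square by (rule derivative_eq_intros d refl)+ (simp add: fun_eq_iff algebra_simps)
  then show ?thesis by (rule partial_eqI)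
qed

text \<open>
  In case (i) the second identity says \<open>\<phi>' * (b z1 + a y1) = \<phi>' * (\<mu> g - \<lambda> h)\<close> and holds by the relation between
  \<open>g\<close> and \<open>h\<close>; the last conclusion therefore lists only the first and the third.
\<close>

lemma case_i_derivatives:
  assumes V: "open V" and ab: "a\<^sup>2 + b\<^sup>2 \<noteq> 0"
    and g: "smooth_on (proj_z1y1 ` V) g" and h: "smooth_on (proj_z1y1 ` V) h" and \<phi>: "smooth_on (xi a b ` V) \<phi>"
    and assoc: "assoc_i \<eta> V f a b \<mu> lam g h \<phi>"
    and rel: "\<forall>(z1, y1) \<in> proj_z1y1 ` V. \<mu> * g (z1, y1) - lam * h (z1, y1) = a * y1 + b * z1"
  shows "\<forall>i\<in>{1,2,3}. \<forall>j\<in>{1,2}. smooth_on V (f i j)" "separated V f" "\<forall>P\<in>V. f 2 1 P = \<eta>"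
    "\<And>P. P \<in> V \<Longrightarrow> jac f P = W_of g h (proj_z1y1 P)"
    "\<And>P. P \<in> V \<Longrightarrow> \<mu> * D1 g (proj_z1y1 P) - lam * D1 h (proj_z1y1 P) = b"
    "\<And>P. P \<in> V \<Longrightarrow> \<mu> * D2 g (proj_z1y1 P) - lam * D2 h (proj_z1y1 P) = a"
    "\<And>z z1 y y1 F G. (z, z1, y, y1) \<in> V \<Longrightarrow> reduced_eqs \<delta> \<eta> f (z, z1, y, y1) F G \<longleftrightarrow>
       (lam * deriv (deriv \<phi>) (a * y + b * z) * (b * z1 + a * y1) - D1 g (z1, y1) * F - D2 g (z1, y1) * G
          = h (z1, y1) * \<phi> (a * y + b * z) - \<mu> * deriv \<phi> (a * y + b * z) * \<eta> \<and>
        \<mu> * deriv (deriv \<phi>) (a * y + b * z) * (b * z1 + a * y1) - D1 h (z1, y1) * F - D2 h (z1, y1) * G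
          = \<delta> * (g (z1, y1) * \<phi> (a * y + b * z) - lam * deriv \<phi> (a * y + b * z) * \<eta>))"
proof -
  have o\<xi>: "open (xi a b ` V)" by (rule open_xi_image[OF V ab])
  note \<phi>1 = smooth_on_deriv[OF o\<xi> \<phi>]
  have eqs: "f 1 1 P = g (proj_z1y1 P)" "f 1 2 P = lam * deriv \<phi> (xi a b P)" "f 2 1 P = \<eta>" "f 2 2 P = \<phi> (xi a b P)"
    "f 3 1 P = h (proj_z1y1 P)" "f 3 2 P = \<mu> * deriv \<phi> (xi a b P)" if "P \<in> V" for P
  proof -
    obtain z z1 y y1 where "P = (z, z1, y, y1)" by (cases P)
    then show "f 1 1 P = g (proj_z1y1 P)" "f 1 2 P = lam * deriv \<phi> (xi a b P)" "f 2 1 P = \<eta>" "f 2 2 P = \<phi> (xi a b P)"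
      "f 3 1 P = h (proj_z1y1 P)" "f 3 2 P = \<mu> * deriv \<phi> (xi a b P)"
      using assoc that unfolding assoc_i_def Let_def by (auto simp: proj_z1y1_def xi_def)
  qed
  have smc: "smooth_on (xi a b ` V) (\<lambda>s. c * deriv \<phi> s)" for c
    by (intro smooth_on_mult smooth_on_const \<phi>1 o\<xi>)
  have pull: "smooth_on V (\<lambda>P. k (L P))" if "smooth_on (L ` V) k" "bounded_linear L" for L :: "jet \<Rightarrow> 'b::euclidean_space" and k
    using smooth_on_compose_linear[OF V that, of 0] by simp
  have "smooth_on V (f 1 1)" by (rule smooth_on_cong[OF V _ pull[OF g bounded_linear_proj(1)]]) (erule eqs(1)[symmetric])
  moreover have "smooth_on V (f 1 2)" by (rule smooth_on_cong[OF V _ pull[OF smc bounded_linear_proj(3)]]) (erule eqs(2)[symmetric])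
  moreover have "smooth_on V (f 2 1)" by (rule smooth_on_cong[OF V _ smooth_on_const[OF V]]) (erule eqs(3)[symmetric])
  moreover have "smooth_on V (f 2 2)" by (rule smooth_on_cong[OF V _ pull[OF \<phi> bounded_linear_proj(3)]]) (erule eqs(4)[symmetric])
  moreover have "smooth_on V (f 3 1)" by (rule smooth_on_cong[OF V _ pull[OF h bounded_linear_proj(1)]]) (erule eqs(5)[symmetric])
  moreover have "smooth_on V (f 3 2)" by (rule smooth_on_cong[OF V _ pull[OF smc bounded_linear_proj(3)]]) (erule eqs(6)[symmetric])
  ultimately show sm: "\<forall>i\<in>{1,2,3}. \<forall>j\<in>{1,2}. smooth_on V (f i j)" by auto
  show eta: "\<forall>P\<in>V. f 2 1 P = \<eta>" by (simp add: eqs)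
  have dg: "g differentiable (at (proj_z1y1 P))" "h differentiable (at (proj_z1y1 P))" if "P \<in> V" for P
    using smooth_on_differentiable g h that by blast+
  have dp: "\<phi> differentiable (at (xi a b P))" "(\<lambda>s. c * deriv \<phi> s) differentiable (at (xi a b P))" if "P \<in> V" for P c
    using smooth_on_differentiable \<phi> smc that by blast+
  note p11 = partials_z1y1[OF V _ eqs(1) dg(1)]
  note p31 = partials_z1y1[OF V _ eqs(5) dg(2)]
  note p12 = partials_xi[OF V _ eqs(2) dp(2)[of _ lam]]
  note p22 = partials_xi[OF V _ eqs(4) dp(1)]
  note p32 = partials_xi[OF V _ eqs(6) dp(2)[of _ \<mu>]]
  have p21: "partial e (f 2 1) P = 0" if "P \<in> V" for P e
    by (rule partial_eq_0_of_const[OF V that eta])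
  show "separated V f"
    by (auto simp: separated_def p11 p31 p12 p22 p32 p21)
  show "jac f P = W_of g h (proj_z1y1 P)" if "P \<in> V" for P
    using that by (simp add: jac_def W_of_def p11 p31)
  have dc: "deriv (\<lambda>s. c * deriv \<phi> s) (xi a b P) = c * deriv (deriv \<phi>) (xi a b P)" if "P \<in> V" for P c
    by (rule deriv_cmult) (use smooth_on_differentiable[OF \<phi>1, of "xi a b P"] that in \<open>simp add: field_differentiable_def real_differentiable_def\<close>)
  have rel0: "\<mu> * partial e (f 1 1) P - lam * partial e (f 3 1) P = partial e (\<lambda>P. a * snd (snd (snd P)) + b * fst (snd P)) P" 
    if P: "P \<in> V" for P e
  proof -
    have d: "(f i 1 has_derivative (\<lambda>e. partial e (f i 1) P)) (at P)" if "i \<in> {1,3}" for i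
      using smooth_on_differentiable[of V "f i 1" P] sm that P unfolding frechet_derivative_works partial_def by auto
    have "((\<lambda>P. \<mu> * f 1 1 P - lam * f 3 1 P) has_derivative (\<lambda>e. \<mu> * partial e (f 1 1) P - lam * partial e (f 3 1) P)) (at P)"
      by (intro derivative_intros d) auto
    then have "partial e (\<lambda>P. \<mu> * f 1 1 P - lam * f 3 1 P) P = \<mu> * partial e (f 1 1) P - lam * partial e (f 3 1) P"
      by (rule partial_eqI)
    moreover have "partial e (\<lambda>P. \<mu> * f 1 1 P - lam * f 3 1 P) P = partial e (\<lambda>P. a * snd (snd (snd P)) + b * fst (snd P)) P"
      by (rule partial_cong[OF V P]) (use rel in \<open>auto simp: eqs proj_z1y1_def split: prod.splits\<close>)
    ultimately show ?thesis by simp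
  qed
  have lin: "partial e (\<lambda>P. a * snd (snd (snd P)) + b * fst (snd P)) P = a * snd (snd (snd e)) + b * fst (snd e)" for e P :: jet
    by (rule partial_eqI) (auto intro!: derivative_eq_intros)
  show rb: "\<mu> * D1 g (proj_z1y1 P) - lam * D1 h (proj_z1y1 P) = b" if "P \<in> V" for P
    using rel0[OF that, of "(0, 1, 0, 0)"] that by (simp add: lin p11 p31)
  show ra: "\<mu> * D2 g (proj_z1y1 P) - lam * D2 h (proj_z1y1 P) = a" if "P \<in> V" for P
    using rel0[OF that, of "(0, 0, 0, 1)"] that by (simp add: lin p11 p31)
  fix z z1 y y1 F G assume P: "(z, z1, y, y1) \<in> V"
  have "\<mu> * g (z1, y1) - lam * h (z1, y1) = a * y1 + b * z1"
    using rel P by (force simp: proj_z1y1_def)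
  then have "b * deriv \<phi> (a * y + b * z) * z1 + a * deriv \<phi> (a * y + b * z) * y1 =
      g (z1, y1) * (\<mu> * deriv \<phi> (a * y + b * z)) - lam * deriv \<phi> (a * y + b * z) * h (z1, y1)"
    by algebra
  then show "reduced_eqs \<delta> \<eta> f (z, z1, y, y1) F G \<longleftrightarrow>
       (lam * deriv (deriv \<phi>) (a * y + b * z) * (b * z1 + a * y1) - D1 g (z1, y1) * F - D2 g (z1, y1) * G
          = h (z1, y1) * \<phi> (a * y + b * z) - \<mu> * deriv \<phi> (a * y + b * z) * \<eta> \<and>
        \<mu> * deriv (deriv \<phi>) (a * y + b * z) * (b * z1 + a * y1) - D1 h (z1, y1) * F - D2 h (z1, y1) * G
          = \<delta> * (g (z1, y1) * \<phi> (a * y + b * z) - lam * deriv \<phi> (a * y + b * z) * \<eta>))"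
    using P
    by (simp add: reduced_eqs_def Let_def p11[OF P] p31[OF P] p12[OF P] p22[OF P] p32[OF P] dc[OF P] eqs[OF P],
        simp add: proj_z1y1_def xi_def algebra_simps)
qed

lemma open_proj_image:
  assumes "open V"
  shows "open (proj_zy ` V)" "open (proj_z1y1 ` V)"
proof -
  have "surj proj_zy" unfolding surj_def proj_zy_def by auto
  then show "open (proj_zy ` V)"
    by (rule open_surjective_linear_image[OF assms bounded_linear.linear[OF bounded_linear_proj(2)]])
  have "surj proj_z1y1" unfolding surj_def proj_z1y1_def by auto
  then show "open (proj_z1y1 ` V)"
    by (rule open_surjective_linear_image[OF assms bounded_linear.linear[OF bounded_linear_proj(1)]])
qed

lemma partial_lincomb:
  assumes "k differentiable (at x)" "l differentiable (at x)"
  shows "partial e (\<lambda>x. c * (m * k x + n * l x)) x = c * (m * partial e k x + n * partial e l x)"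
proof -
  have d: "(k has_derivative (\<lambda>e. partial e k x)) (at x)" "(l has_derivative (\<lambda>e. partial e l x)) (at x)"
    using assms unfolding frechet_derivative_works partial_def by auto
  have "((\<lambda>x. c * (m * k x + n * l x)) has_derivative (\<lambda>e. c * (m * partial e k x + n * partial e l x))) (at x)"
    by (rule derivative_eq_intros d refl)+ (simp add: fun_eq_iff algebra_simps)
  then show ?thesis by (rule partial_eqI)
qed

lemma smooth_on_linear: "open S \<Longrightarrow> bounded_linear L \<Longrightarrow> smooth_on S L"
  by (simp add: smooth_iff_Ck Ck_linear)

lemma bounded_linear_fst_snd: "bounded_linear (\<lambda>r :: real \<times> real. m * fst r + n * snd r)"
  by (intro bounded_linear_add bounded_linear_const_mult bounded_linear_fst bounded_linear_snd)

lemma partial_fst_snd: "partial e (\<lambda>r :: real \<times> real. m * fst r + n * snd r) x = m * fst e + n * snd e"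
  by (rule partial_eqI) (rule bounded_linear_imp_has_derivative[OF bounded_linear_fst_snd])

lemma smooth_on_pullback:
  assumes "open V" "smooth_on (L ` V) k" "bounded_linear L" "\<And>P. P \<in> V \<Longrightarrow> f P = k (L P)"
  shows "smooth_on V f"
  by (rule smooth_on_cong[OF assms(1) _ smooth_on_compose_linear[OF assms(1-3), of 0]]) (simp_all add: assms(4))

text \<open>
  In case (ii) the second identity holds by the definition of \<open>\<gamma>\<close>, and the last conclusion lists the first and the
  third. The formulas for \<open>F\<close> and \<open>G\<close> contain \<open>p\<^sub>z\<^sub>y\<close> in one order of differentiation only, so the symmetry of second
  derivatives enters here.
\<close>

lemma case_ii_derivatives:
  fixes a1 b1 a3 b3 :: real
  defines "\<gamma> \<equiv> a1 * b3 - b1 * a3"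
  assumes V: "open V" and \<gamma>: "\<gamma> \<noteq> 0" and p: "smooth_on (proj_zy ` V) p" and assoc: "assoc_ii \<eta> V f a1 b1 a3 b3 p"
  shows "\<forall>i\<in>{1,2,3}. \<forall>j\<in>{1,2}. smooth_on V (f i j)" "separated V f" "\<forall>P\<in>V. f 2 1 P = \<eta>"
    "\<And>P. P \<in> V \<Longrightarrow> jac f P = \<gamma>"
    "\<And>P. P \<in> V \<Longrightarrow> f 1 1 P = a1 * fst (snd P) + b1 * snd (snd (snd P))"
    "\<And>P. P \<in> V \<Longrightarrow> f 1 2 P = 1 / \<gamma> * (b1 * D1 p (proj_zy P) - a1 * D2 p (proj_zy P))"
    "\<And>P. P \<in> V \<Longrightarrow> f 2 2 P = p (proj_zy P)"
    "\<And>z z1 y y1 F G. (z, z1, y, y1) \<in> V \<Longrightarrow> reduced_eqs \<delta> \<eta> f (z, z1, y, y1) F G \<longleftrightarrow>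
     ((b1 * D1 (D1 p) (z, y) - a1 * D2 (D1 p) (z, y)) / \<gamma> * z1 + (b1 * D2 (D1 p) (z, y) - a1 * D2 (D2 p) (z, y)) / \<gamma> * y1 - a1 * F - b1 * G
        = (a3 * z1 + b3 * y1) * p (z, y) - (b3 * D1 p (z, y) - a3 * D2 p (z, y)) / \<gamma> * \<eta> \<and>
      (b3 * D1 (D1 p) (z, y) - a3 * D2 (D1 p) (z, y)) / \<gamma> * z1 + (b3 * D2 (D1 p) (z, y) - a3 * D2 (D2 p) (z, y)) / \<gamma> * y1 - a3 * F - b3 * G
        = \<delta> * ((a1 * z1 + b1 * y1) * p (z, y) - (b1 * D1 p (z, y) - a1 * D2 p (z, y)) / \<gamma> * \<eta>))"
proof -
  have oZ: "open (proj_zy ` V)" "open (proj_z1y1 ` V)" by (rule open_proj_image[OF V])+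
  note pd = smooth_on_plane_partials[OF p]
  let ?lin = "\<lambda>m n (r :: real \<times> real). m * fst r + n * snd r"
  let ?cmb = "\<lambda>m n s. 1 / \<gamma> * (m * D1 p s + n * D2 p s)"
  have eqs: "f 1 1 P = ?lin a1 b1 (proj_z1y1 P)" "f 1 2 P = ?cmb b1 (- a1) (proj_zy P)" "f 2 1 P = \<eta>" "f 2 2 P = p (proj_zy P)"
    "f 3 1 P = ?lin a3 b3 (proj_z1y1 P)" "f 3 2 P = ?cmb b3 (- a3) (proj_zy P)" if "P \<in> V" for P
  proof -
    obtain z z1 y y1 where "P = (z, z1, y, y1)" by (cases P)
    then show "f 1 1 P = ?lin a1 b1 (proj_z1y1 P)" "f 1 2 P = ?cmb b1 (- a1) (proj_zy P)" "f 2 1 P = \<eta>" "f 2 2 P = p (proj_zy P)"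
      "f 3 1 P = ?lin a3 b3 (proj_z1y1 P)" "f 3 2 P = ?cmb b3 (- a3) (proj_zy P)"
      using assoc that unfolding assoc_ii_def Let_def \<gamma>_def by (auto simp: proj_z1y1_def proj_zy_def)
  qed
  have sl: "smooth_on (proj_z1y1 ` V) (?lin m n)" for m n
    by (rule smooth_on_linear[OF oZ(2) bounded_linear_fst_snd])
  have sc: "smooth_on (proj_zy ` V) (?cmb m n)" for m n
    by (intro smooth_on_mult smooth_on_add smooth_on_const pd oZ)
  have "smooth_on V (f 1 1)" by (rule smooth_on_pullback[OF V sl bounded_linear_proj(1) eqs(1)])
  moreover have "smooth_on V (f 1 2)" by (rule smooth_on_pullback[OF V sc bounded_linear_proj(2) eqs(2)])
  moreover have "smooth_on V (f 2 1)" by (rule smooth_on_cong[OF V _ smooth_on_const[OF V]]) (erule eqs(3)[symmetric])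
  moreover have "smooth_on V (f 2 2)" by (rule smooth_on_pullback[OF V p bounded_linear_proj(2) eqs(4)])
  moreover have "smooth_on V (f 3 1)" by (rule smooth_on_pullback[OF V sl bounded_linear_proj(1) eqs(5)])
  moreover have "smooth_on V (f 3 2)" by (rule smooth_on_pullback[OF V sc bounded_linear_proj(2) eqs(6)])
  ultimately show sm: "\<forall>i\<in>{1,2,3}. \<forall>j\<in>{1,2}. smooth_on V (f i j)" by auto
  show eta: "\<forall>P\<in>V. f 2 1 P = \<eta>" by (simp add: eqs)
  have dl: "?lin m n differentiable (at (proj_z1y1 P))" if "P \<in> V" for P m n
    using smooth_on_differentiable[OF sl] that by blast
  have dc: "?cmb m n differentiable (at (proj_zy P))" if "P \<in> V" for P m n
    using smooth_on_differentiable[OF sc] that by blast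
  have dp: "p differentiable (at (proj_zy P))" "D1 p differentiable (at (proj_zy P))" "D2 p differentiable (at (proj_zy P))" if "P \<in> V" for P
    using smooth_on_differentiable[OF p] smooth_on_differentiable[OF pd(1)] smooth_on_differentiable[OF pd(2)] that by blast+
  note p11 = partials_z1y1[OF V _ eqs(1) dl]
  note p31 = partials_z1y1[OF V _ eqs(5) dl]
  note p12 = partials_zy[OF V _ eqs(2) dc]
  note p22 = partials_zy[OF V _ eqs(4) dp(1)]
  note p32 = partials_zy[OF V _ eqs(6) dc]
  have p21: "partial e (f 2 1) P = 0" if "P \<in> V" for P e
    by (rule partial_eq_0_of_const[OF V that eta])
  show "separated V f"
    by (auto simp: separated_def p11 p31 p12 p22 p32 p21)
  show "jac f P = \<gamma>" if "P \<in> V" for P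
    using that by (simp add: jac_def p11 p31 partial_fst_snd \<gamma>_def)
  show "f 1 1 P = a1 * fst (snd P) + b1 * snd (snd (snd P))" "f 1 2 P = 1 / \<gamma> * (b1 * D1 p (proj_zy P) - a1 * D2 p (proj_zy P))"
    "f 2 2 P = p (proj_zy P)" if "P \<in> V" for P
    using that by (simp_all add: eqs proj_z1y1_def case_prod_unfold)
  fix z z1 y y1 F G assume P: "(z, z1, y, y1) \<in> V"
  have zy: "(z, y) \<in> proj_zy ` V" using P by (force simp: proj_zy_def)
  note comm = D1_D2_commute[OF oZ(1) p zy]
  have "D1 p (z, y) * z1 + D2 p (z, y) * y1 =
      (a1 * z1 + b1 * y1) * (1 / \<gamma> * (b3 * D1 p (z, y) + - a3 * D2 p (z, y))) - 1 / \<gamma> * (b1 * D1 p (z, y) + - a1 * D2 p (z, y)) * (a3 * z1 + b3 * y1)"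
  proof -
    have "(a1 * z1 + b1 * y1) * (b3 * D1 p (z, y) + - a3 * D2 p (z, y)) - (b1 * D1 p (z, y) + - a1 * D2 p (z, y)) * (a3 * z1 + b3 * y1)
      = \<gamma> * (D1 p (z, y) * z1 + D2 p (z, y) * y1)" by (simp add: \<gamma>_def algebra_simps)
    note E = this
    have pull: "A * (i * X) - i * Y * B = i * (A * X - Y * B)" for A B X Y i :: real
      by (simp add: algebra_simps)
    show ?thesis unfolding pull E using \<gamma> by simp
  qed
  then show "reduced_eqs \<delta> \<eta> f (z, z1, y, y1) F G \<longleftrightarrow>
     ((b1 * D1 (D1 p) (z, y) - a1 * D2 (D1 p) (z, y)) / \<gamma> * z1 + (b1 * D2 (D1 p) (z, y) - a1 * D2 (D2 p) (z, y)) / \<gamma> * y1 - a1 * F - b1 * G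
        = (a3 * z1 + b3 * y1) * p (z, y) - (b3 * D1 p (z, y) - a3 * D2 p (z, y)) / \<gamma> * \<eta> \<and>
      (b3 * D1 (D1 p) (z, y) - a3 * D2 (D1 p) (z, y)) / \<gamma> * z1 + (b3 * D2 (D1 p) (z, y) - a3 * D2 (D2 p) (z, y)) / \<gamma> * y1 - a3 * F - b3 * G
        = \<delta> * ((a1 * z1 + b1 * y1) * p (z, y) - (b1 * D1 p (z, y) - a1 * D2 p (z, y)) / \<gamma> * \<eta>))"
    by (simp only: reduced_eqs_def Let_def P p11 p31 p12 p22 p32 eqs partial_lincomb[OF dp(2,3)[OF P]] partial_fst_snd)
      (simp add: proj_z1y1_def proj_zy_def comm)
qed

text \<open>
  Both non-vanishing conditions are open, so one point where they hold yields a cube on which \<open>f\<close> describes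
  the system.
\<close>

lemma describes_on_cube:
  assumes V2: "open V2" "V2 \<subseteq> V" and P0: "P0 \<in> V2"
    and sm: "\<forall>i\<in>{1,2,3}. \<forall>j\<in>{1,2}. smooth_on V (f i j)" and sep: "separated V f" and eta: "\<forall>P\<in>V. f 2 1 P = \<eta>"
    and nz: "jac f P0 \<noteq> 0" "f 1 1 P0 * f 2 2 P0 - f 1 2 P0 * f 2 1 P0 \<noteq> 0"
    and red: "\<And>P. P \<in> V2 \<Longrightarrow> jac f P \<noteq> 0 \<Longrightarrow> reduced_eqs \<delta> \<eta> f P (F P) (G P)"
  shows "\<exists>V'. subdomain V' V2 \<and> describes_with_eta \<delta> \<eta> V' F G f"
proof -
  have sm2: "\<forall>i\<in>{1,2,3}. \<forall>j\<in>{1,2}. smooth_on V2 (f i j)" using sm smooth_on_subset V2(2) by blast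
  define k where "k P = jac f P * (f 1 1 P * f 2 2 P - f 1 2 P * f 2 1 P)" for P
  have "continuous_on V2 k"
    unfolding k_def[abs_def] using sm2
    by (intro continuous_intros jac_continuous smooth_on_continuous) auto
  then have o: "open {P \<in> V2. k P \<noteq> 0}" by (rule open_nonzero[OF V2(1)])
  have "P0 \<in> {P \<in> V2. k P \<noteq> 0}" using P0 nz by (simp add: k_def)
  then obtain \<epsilon> where \<epsilon>: "\<epsilon> > 0" "cube P0 \<epsilon> \<subseteq> {P \<in> V2. k P \<noteq> 0}" using cube_in_open[OF o] by blast
  have "describes_with_eta \<delta> \<eta> (cube P0 \<epsilon>) F G f"
  proof (rule describes_of_reduced_eqs[OF cube_open])
    show "\<forall>i\<in>{1,2,3}. \<forall>j\<in>{1,2}. smooth_on (cube P0 \<epsilon>) (f i j)" using sm2 smooth_on_subset \<epsilon>(2) by blast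
    show "separated (cube P0 \<epsilon>) f" using sep V2(2) \<epsilon>(2) unfolding separated_def by blast
    show "\<forall>P\<in>cube P0 \<epsilon>. f 2 1 P = \<eta>" using eta V2(2) \<epsilon>(2) by blast
    show j: "jac f P \<noteq> 0" "f 1 1 P * f 2 2 P - f 1 2 P * f 2 1 P \<noteq> 0" if "P \<in> cube P0 \<epsilon>" for P
      using that \<epsilon>(2) unfolding k_def by auto
    show "reduced_eqs \<delta> \<eta> f P (F P) (G P)" if "P \<in> cube P0 \<epsilon>" for P
      using red[OF _ j(1)[OF that]] that \<epsilon>(2) by blast
  qed
  then show ?thesis using cube_subdomain[OF \<epsilon>(1), of P0 V2] \<epsilon>(2) by blast
qed

lemma case_i_describes:
  assumes V: "open V" and ci: "case_i \<delta> \<eta> V F G a b \<mu> lam g h \<phi>" and assoc: "assoc_i \<eta> V f a b \<mu> lam g h \<phi>"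
    and V2: "subdomain V2 V"
  shows "\<exists>V'. subdomain V' V2 \<and> describes_with_eta \<delta> \<eta> V' F G f"
proof -
  have oV2: "open V2" "V2 \<noteq> {}" "V2 \<subseteq> V" using V2 by (auto simp: subdomain_def)
  have g: "smooth_on (proj_z1y1 ` V) g" and h: "smooth_on (proj_z1y1 ` V) h" and \<phi>: "smooth_on (xi a b ` V) \<phi>"
    and mono: "strict_mono_on (xi a b ` V) \<phi> \<or> strict_antimono_on (xi a b ` V) \<phi>"
    and ab: "a\<^sup>2 + b\<^sup>2 \<noteq> 0" and W: "ae_on V (\<lambda>P. W_of g h (proj_z1y1 P) \<noteq> 0)"
    and rel: "\<forall>(z1, y1) \<in> proj_z1y1 ` V. \<mu> * g (z1, y1) - lam * h (z1, y1) = a * y1 + b * z1"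
    and gne: "ae_on V (\<lambda>P. g (proj_z1y1 P) \<noteq> lam * \<eta> * (deriv \<phi> (xi a b P) / \<phi> (xi a b P)))"
    using ci unfolding case_i_def by blast+
  note der = case_i_derivatives[OF V ab g h \<phi> assoc rel]
  have eqs: "f 1 1 P = g (proj_z1y1 P)" "f 1 2 P = lam * deriv \<phi> (xi a b P)" "f 2 2 P = \<phi> (xi a b P)" if "P \<in> V" for P
  proof -
    obtain z z1 y y1 where "P = (z, z1, y, y1)" by (cases P)
    then show "f 1 1 P = g (proj_z1y1 P)" "f 1 2 P = lam * deriv \<phi> (xi a b P)" "f 2 2 P = \<phi> (xi a b P)"
      using assoc that unfolding assoc_i_def Let_def by (auto simp: proj_z1y1_def xi_def)
  qed
  have inj: "inj_on \<phi> (xi a b ` V)"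
    using mono by (auto simp: inj_on_def monotone_on_def) (metis linorder_less_linear order_less_irrefl)+
  \<comment> \<open>Off the zero set of \<open>\<phi>\<close>, the condition \<open>g \<noteq> \<lambda> \<eta> \<phi>' / \<phi>\<close> is \<open>f\<^sub>1\<^sub>1 f\<^sub>2\<^sub>2 - f\<^sub>1\<^sub>2 f\<^sub>2\<^sub>1 \<noteq> 0\<close>. Since \<open>\<phi>\<close> is injective,
    \<open>\<phi> (\<xi>)\<close> cannot vanish at two points with different \<open>\<xi>\<close>.\<close>
  have "\<exists>P\<in>V2. f 2 2 P \<noteq> 0"
  proof (rule ccontr)
    assume zero: "\<not> ?thesis"
    obtain P where P: "P \<in> V2" using oV2(2) by blast
    obtain \<epsilon> where \<epsilon>: "\<epsilon> > 0" "cube P \<epsilon> \<subseteq> V2" using cube_in_open[OF oV2(1) P] by blast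
    obtain z z1 y y1 where P': "P = (z, z1, y, y1)" by (cases P)
    define Q where "Q = (if b \<noteq> 0 then (z + \<epsilon> / 2, z1, y, y1) else (z, z1, y + \<epsilon> / 2, y1))"
    have Q: "Q \<in> V2" using \<epsilon> unfolding Q_def P' by (auto simp: mem_cube subset_iff)
    have "xi a b Q \<noteq> xi a b P" using ab \<epsilon>(1) by (auto simp: Q_def P' xi_def)
    moreover have "\<phi> (xi a b Q) = \<phi> (xi a b P)" using zero P Q oV2(3) eqs(3) by (metis subsetD)
    ultimately show False using inj P Q oV2(3) unfolding inj_on_def by blast
  qed
  then have ne: "{P \<in> V2. f 2 2 P \<noteq> 0} \<noteq> {}" by blast
  have o3: "open {P \<in> V2. f 2 2 P \<noteq> 0}"
    by (rule open_nonzero[OF oV2(1)], rule smooth_on_continuous, rule smooth_on_subset[OF _ oV2(3)]) (use der(1) in simp)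
  obtain P0 where P0: "P0 \<in> V2" "f 2 2 P0 \<noteq> 0" "W_of g h (proj_z1y1 P0) \<noteq> 0"
    "g (proj_z1y1 P0) \<noteq> lam * \<eta> * (deriv \<phi> (xi a b P0) / \<phi> (xi a b P0))"
    using ae_on_witness[OF ae_on_conj[OF W gne] o3 ne] oV2(3) by blast
  have P0V: "P0 \<in> V" using P0(1) oV2(3) by blast
  show ?thesis
  proof (rule describes_on_cube[OF oV2(1,3) P0(1) der(1-3)])
    show "jac f P0 \<noteq> 0" using P0(3) der(4)[OF P0V] by simp
    show "f 1 1 P0 * f 2 2 P0 - f 1 2 P0 * f 2 1 P0 \<noteq> 0"
      using P0(2,4) der(3) P0V by (auto simp: eqs field_simps)
    fix P assume P: "P \<in> V2" and jac: "jac f P \<noteq> 0"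
    obtain z z1 y y1 where P': "P = (z, z1, y, y1)" by (cases P)
    have PV: "(z, z1, y, y1) \<in> V" using P P' oV2(3) by auto
    have W0: "W_of g h (z1, y1) \<noteq> 0" using jac der(4)[OF PV] by (simp add: P' proj_z1y1_def)
    have W0': "D1 g (z1, y1) * D2 h (z1, y1) - D2 g (z1, y1) * D1 h (z1, y1) \<noteq> 0" using W0 by (simp add: W_of_def)
    have ba: "\<mu> * D1 g (z1, y1) - lam * D1 h (z1, y1) = b" "\<mu> * D2 g (z1, y1) - lam * D2 h (z1, y1) = a"
      using der(5,6)[OF PV] by (simp_all add: proj_z1y1_def)
    have r: "(z1, y1) \<in> proj_z1y1 ` V" using PV by (force simp: proj_z1y1_def)
    note dsq = partial_square_difference[OF smooth_on_differentiable[OF g r] smooth_on_differentiable[OF h r]]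
    show "reduced_eqs \<delta> \<eta> f P (F P) (G P)"
      unfolding P' der(7)[OF PV] case_i_solve[OF W0' ba]
      using ci PV W0 unfolding case_i_def Let_def by (auto simp: dsq W_of_def)
  qed
qed

text \<open>
  Only \<open>f\<^sub>1\<^sub>1 f\<^sub>2\<^sub>2 - f\<^sub>1\<^sub>2 f\<^sub>2\<^sub>1 \<noteq> 0\<close> needs an argument. If \<open>(a1 z1 + b1 y1) p - \<eta> f\<^sub>1\<^sub>2\<close> vanished on an open set, then
  \<open>a1 p = b1 p = 0\<close> and hence \<open>p = 0\<close> there, since \<open>(a1, b1) \<noteq> 0\<close> by \<open>\<gamma> \<noteq> 0\<close>. The system would be \<open>F = G = 0\<close>, which is
  degenerate.
\<close>

lemma case_ii_describes:
  assumes V: "open V" and cii: "case_ii \<delta> \<eta> V F G a1 b1 a3 b3 p" and assoc: "assoc_ii \<eta> V f a1 b1 a3 b3 p"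
    and V2: "subdomain V2 V" and nd: "nondegenerate V2 F G"
  shows "\<exists>V'. subdomain V' V2 \<and> describes_with_eta \<delta> \<eta> V' F G f"
proof -
  have oV2: "open V2" "V2 \<noteq> {}" "V2 \<subseteq> V" using V2 by (auto simp: subdomain_def)
  define \<gamma> where "\<gamma> = a1 * b3 - b1 * a3"
  have \<gamma>: "\<gamma> \<noteq> 0" and p: "smooth_on (proj_zy ` V) p"
    using cii unfolding case_ii_def Let_def \<gamma>_def by blast+
  note der = case_ii_derivatives[OF V \<gamma>[unfolded \<gamma>_def] p assoc, folded \<gamma>_def]
  have oZ: "open (proj_zy ` V2)" by (rule open_proj_image[OF oV2(1)])
  have "\<exists>P\<in>V2. f 1 1 P * f 2 2 P - f 1 2 P * f 2 1 P \<noteq> 0"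
  proof (rule ccontr)
    assume zero: "\<not> ?thesis"
    have p0: "p (proj_zy P) = 0" if P: "P \<in> V2" for P
    proof -
      obtain z z1 y y1 where P': "P = (z, z1, y, y1)" by (cases P)
      obtain \<epsilon> where \<epsilon>: "\<epsilon> > 0" "cube P \<epsilon> \<subseteq> V2" using cube_in_open[OF oV2(1) P] by blast
      define K where "K = 1 / \<gamma> * (b1 * D1 p (z, y) - a1 * D2 p (z, y)) * \<eta>"
      have E: "(a1 * w1 + b1 * x1) * p (z, y) - K = 0" if "(z, w1, y, x1) \<in> cube P \<epsilon>" for w1 x1
      proof -
        have Q: "(z, w1, y, x1) \<in> V2" "(z, w1, y, x1) \<in> V" using that \<epsilon>(2) oV2(3) by auto
        then show ?thesis
          using zero der(3) der(5,6,7)[OF Q(2)] by (auto simp: K_def proj_zy_def)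
      qed
      have "(a1 * z1 + b1 * y1) * p (z, y) - K = 0" "(a1 * (z1 + \<epsilon> / 2) + b1 * y1) * p (z, y) - K = 0"
        "(a1 * z1 + b1 * (y1 + \<epsilon> / 2)) * p (z, y) - K = 0"
        by (rule E; use \<epsilon>(1) in \<open>simp add: P' mem_cube\<close>)+
      then have "(a1 * p (z, y)) * (\<epsilon> / 2) = 0" "(b1 * p (z, y)) * (\<epsilon> / 2) = 0" by algebra+
      then have "a1 * p (z, y) = 0" "b1 * p (z, y) = 0" using \<epsilon>(1) by simp_all
      then show ?thesis using \<gamma> by (auto simp: \<gamma>_def P' proj_zy_def)
    qed
    have p0': "p s = 0" if "s \<in> proj_zy ` V2" for s using p0 that by blast
    have d1: "partial e p s = 0" if "s \<in> proj_zy ` V2" for s e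
      by (rule partial_eq_0_of_const[OF oZ that]) (use p0' in blast)
    have d2: "partial e (partial e' p) s = 0" if "s \<in> proj_zy ` V2" for s e e'
      by (rule partial_eq_0_of_const[OF oZ that]) (use d1 in blast)
    have FG: "F P = 0 \<and> G P = 0" if P: "P \<in> V2" for P
    proof -
      obtain z z1 y y1 where P': "P = (z, z1, y, y1)" by (cases P)
      have s: "(z, y) \<in> proj_zy ` V2" using P P' by (force simp: proj_zy_def)
      have "(z, z1, y, y1) \<in> V" using P P' oV2(3) by blast
      then show ?thesis
        using cii p0'[OF s] d1[OF s] d2[OF s] unfolding case_ii_def Let_def P' by auto
    qed
    have "partial e F P = 0" "partial e G P = 0" if "P \<in> V2" for P e
      using partial_eq_0_of_const[OF oV2(1) that] FG by blast+
    moreover obtain P where "P \<in> V2" "(partial (1, 0, 0, 0) F P)\<^sup>2 + (partial (0, 0, 1, 0) F P)\<^sup>2 +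
                   (partial (1, 0, 0, 0) G P)\<^sup>2 + (partial (0, 0, 1, 0) G P)\<^sup>2 \<noteq> 0"
      using nd ae_on_witness[OF _ oV2(1,2) order_refl] unfolding nondegenerate_def Let_def by blast
    ultimately show False by simp
  qed
  then obtain P0 where P0: "P0 \<in> V2" "f 1 1 P0 * f 2 2 P0 - f 1 2 P0 * f 2 1 P0 \<noteq> 0" by blast
  have P0V: "P0 \<in> V" using P0(1) oV2(3) by blast
  show ?thesis
  proof (rule describes_on_cube[OF oV2(1,3) P0(1) der(1-3) _ P0(2)])
    show "jac f P0 \<noteq> 0" using \<gamma> der(4)[OF P0V] by simp
    fix P assume P: "P \<in> V2"
    obtain z z1 y y1 where P': "P = (z, z1, y, y1)" by (cases P)
    have PV: "(z, z1, y, y1) \<in> V" using P P' oV2(3) by auto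
    have FG: "F (z, z1, y, y1) = - (z1 / \<gamma>) * (D2 (D1 p) (z, y) + (a3 * b3 - \<delta> * a1 * b1) * p (z, y))
         - y1 / \<gamma> * (D2 (D2 p) (z, y) + (b3\<^sup>2 - \<delta> * b1\<^sup>2) * p (z, y))
         + \<eta> / \<gamma>\<^sup>2 * ((b3\<^sup>2 - \<delta> * b1\<^sup>2) * D1 p (z, y) - (a3 * b3 - \<delta> * a1 * b1) * D2 p (z, y)) \<and>
      G (z, z1, y, y1) = z1 / \<gamma> * (D1 (D1 p) (z, y) + (a3\<^sup>2 - \<delta> * a1\<^sup>2) * p (z, y))
         + y1 / \<gamma> * (D2 (D1 p) (z, y) + (a3 * b3 - \<delta> * a1 * b1) * p (z, y))
         - \<eta> / \<gamma>\<^sup>2 * ((a3 * b3 - \<delta> * a1 * b1) * D1 p (z, y) - (a3\<^sup>2 - \<delta> * a1\<^sup>2) * D2 p (z, y))"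
      using cii PV unfolding case_ii_def Let_def \<gamma>_def by blast
    show "reduced_eqs \<delta> \<eta> f P (F P) (G P)"
      unfolding P' der(8)[OF PV] using case_ii_solve[OF \<gamma>[unfolded \<gamma>_def]] FG unfolding \<gamma>_def by blast
  qed
qed

section \<open>Classification\<close>

lemma constant_along_segment:
  fixes k :: "'a::real_normed_vector \<Rightarrow> real"
  assumes "convex S" "a \<in> S" "b \<in> S" "\<And>x. x \<in> S \<Longrightarrow> k differentiable (at x)"
    "\<And>x. x \<in> S \<Longrightarrow> frechet_derivative k (at x) (b - a) = 0"
  shows "k b = k a"
proof -
  have in_S: "a + s *\<^sub>R (b - a) \<in> S" if "s \<in> {0..1}" for s
    using convexD_alt[OF assms(1-3), of s] that by (simp add: algebra_simps)
  have d: "((\<lambda>s. k (a + s *\<^sub>R (b - a))) has_derivative (\<lambda>h. h * 0)) (at s within {0..1})" if "s \<in> {0..1}" for s :: real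
  proof -
    let ?D = "frechet_derivative k (at (a + s *\<^sub>R (b - a)))"
    have D: "(k has_derivative ?D) (at (a + s *\<^sub>R (b - a)))"
      using assms(4)[OF in_S[OF that]] by (simp only: frechet_derivative_works)
    have "((\<lambda>s. a + s *\<^sub>R (b - a)) has_derivative (\<lambda>h. h *\<^sub>R (b - a))) (at s within {0..1})"
      by (auto intro!: derivative_eq_intros)
    from has_derivative_compose[OF this D]
    have "((\<lambda>s. k (a + s *\<^sub>R (b - a))) has_derivative (\<lambda>h. ?D (h *\<^sub>R (b - a)))) (at s within {0..1})" .
    moreover have "(\<lambda>h. ?D (h *\<^sub>R (b - a))) = (\<lambda>h. h * 0)"
      using linear_scale[OF has_derivative_linear[OF D], of _ "b - a"] assms(5)[OF in_S[OF that]] by simp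
    ultimately show ?thesis by (simp only:)
  qed
  have "k (a + 1 *\<^sub>R (b - a)) = k (a + 0 *\<^sub>R (b - a))"
    using mvt_simple[of 0 1 "\<lambda>s. k (a + s *\<^sub>R (b - a))" "\<lambda>s h. h * 0"] d by auto
  then show ?thesis by simp
qed

text \<open>
  A cube on which all generic conditions hold. The functions \<open>g\<close>, \<open>h\<close> of \<open>(z1, y1)\<close> and \<open>p\<close>, \<open>r\<close>, \<open>s\<close> of
  \<open>(z, y)\<close> are the slices of \<open>f\<^sub>1\<^sub>1\<close>, \<open>f\<^sub>3\<^sub>1\<close>, \<open>f\<^sub>2\<^sub>2\<close>, \<open>f\<^sub>3\<^sub>2\<close>, \<open>f\<^sub>1\<^sub>2\<close> through the centre; since the associated functions are
  separated, they agree with these slices on the whole cube.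
\<close>

locale separated_cube =
  fixes \<delta> \<eta> c1 c2 c3 c4 \<epsilon> :: real and f :: "nat \<Rightarrow> nat \<Rightarrow> jet \<Rightarrow> real" and F G :: "jet \<Rightarrow> real"
    and C :: "jet set" and g h p r s :: "real \<times> real \<Rightarrow> real"
  defines "C \<equiv> cube (c1, c2, c3, c4) \<epsilon>"
    and "g \<equiv> \<lambda>v. f 1 1 (c1, fst v, c3, snd v)" and "h \<equiv> \<lambda>v. f 3 1 (c1, fst v, c3, snd v)"
    and "p \<equiv> \<lambda>v. f 2 2 (fst v, c2, snd v, c4)" and "r \<equiv> \<lambda>v. f 3 2 (fst v, c2, snd v, c4)"
    and "s \<equiv> \<lambda>v. f 1 2 (fst v, c2, snd v, c4)"
  assumes \<epsilon>: "\<epsilon> > 0"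
    and sm: "\<forall>i\<in>{1,2,3}. \<forall>j\<in>{1,2}. smooth_on C (f i j)"
    and sep: "separated C f" and eta: "\<forall>P\<in>C. f 2 1 P = \<eta>"
    and jac: "\<And>P. P \<in> C \<Longrightarrow> jac f P \<noteq> 0"
    and det: "\<And>P. P \<in> C \<Longrightarrow> f 1 1 P * f 2 2 P - f 1 2 P * f 2 1 P \<noteq> 0"
    and red: "\<And>P. P \<in> C \<Longrightarrow> reduced_eqs \<delta> \<eta> f P (F P) (G P)"
    and smF: "smooth_on C F" and smG: "smooth_on C G" and nd: "nondegenerate C F G"
begin

lemma C_open: "open C" and C_convex: "convex C"
  by (simp_all add: C_def cube_open cube_convex)

abbreviation Z where "Z \<equiv> proj_zy ` C"
abbreviation Y where "Y \<equiv> proj_z1y1 ` C"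

lemma Z_iff: "(z, y) \<in> Z \<longleftrightarrow> \<bar>z - c1\<bar> < \<epsilon> \<and> \<bar>y - c3\<bar> < \<epsilon>"
proof
  assume "\<bar>z - c1\<bar> < \<epsilon> \<and> \<bar>y - c3\<bar> < \<epsilon>"
  then have "(z, c2, y, c4) \<in> C" using \<epsilon> by (simp add: C_def mem_cube)
  then show "(z, y) \<in> Z" by (force simp: proj_zy_def)
qed (auto simp: C_def mem_cube proj_zy_def)

lemma Y_iff: "(z1, y1) \<in> Y \<longleftrightarrow> \<bar>z1 - c2\<bar> < \<epsilon> \<and> \<bar>y1 - c4\<bar> < \<epsilon>"
proof
  assume "\<bar>z1 - c2\<bar> < \<epsilon> \<and> \<bar>y1 - c4\<bar> < \<epsilon>"
  then have "(c1, z1, c3, y1) \<in> C" using \<epsilon> by (simp add: C_def mem_cube)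
  then show "(z1, y1) \<in> Y" by (force simp: proj_z1y1_def)
qed (auto simp: C_def mem_cube proj_z1y1_def)

lemma C_iff: "(z, z1, y, y1) \<in> C \<longleftrightarrow> (z, y) \<in> Z \<and> (z1, y1) \<in> Y"
  unfolding Z_iff Y_iff by (auto simp: C_def mem_cube)

lemma Z_open: "open Z" and Y_open: "open Y"
  using open_proj_image[OF C_open] by auto

lemma Z_convex: "convex Z"
  by (rule convex_linear_image[OF bounded_linear.linear[OF bounded_linear_proj(2)] C_convex])

lemma center: "(c1, c3) \<in> Z" "(c2, c4) \<in> Y"
  using \<epsilon> by (simp_all add: Z_iff Y_iff)

lemma of_z1y1:
  assumes k: "smooth_on C k" and k0: "\<And>P. P \<in> C \<Longrightarrow> J\<^sub>z k P = 0 \<and> J\<^sub>y k P = 0" and P: "P \<in> C"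
  shows "k P = k (c1, fst (proj_z1y1 P), c3, snd (proj_z1y1 P))"
proof -
  obtain z z1 y y1 where P': "P = (z, z1, y, y1)" by (cases P)
  have "k (c1, z1, c3, y1) = k P"
  proof (rule constant_along_segment[OF C_convex P])
    show "(c1, z1, c3, y1) \<in> C" using P center(1) unfolding P' C_iff by simp
    show "frechet_derivative k (at Q) ((c1, z1, c3, y1) - P) = 0" if "Q \<in> C" for Q
      using k0[OF that] frechet_derivative_jet[OF smooth_on_differentiable[OF k that]] by (simp add: P')
  qed (rule smooth_on_differentiable[OF k])
  then show ?thesis by (simp add: P' proj_z1y1_def)
qed

lemma of_zy:
  assumes k: "smooth_on C k" and k0: "\<And>P. P \<in> C \<Longrightarrow> J\<^sub>z\<^sub>1 k P = 0 \<and> J\<^sub>y\<^sub>1 k P = 0" and P: "P \<in> C"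
  shows "k P = k (fst (proj_zy P), c2, snd (proj_zy P), c4)"
proof -
  obtain z z1 y y1 where P': "P = (z, z1, y, y1)" by (cases P)
  have "k (z, c2, y, c4) = k P"
  proof (rule constant_along_segment[OF C_convex P])
    show "(z, c2, y, c4) \<in> C" using P center(2) unfolding P' C_iff by simp
    show "frechet_derivative k (at Q) ((z, c2, y, c4) - P) = 0" if "Q \<in> C" for Q
      using k0[OF that] frechet_derivative_jet[OF smooth_on_differentiable[OF k that]] by (simp add: P')
  qed (rule smooth_on_differentiable[OF k])
  then show ?thesis by (simp add: P' proj_zy_def)
qed

lemma slice_z1y1:
  assumes "smooth_on C k"
  shows "smooth_on Y (\<lambda>v. k (c1, fst v, c3, snd v))"
proof -
  have bl: "bounded_linear (\<lambda>v :: real \<times> real. (0 :: real, fst v, 0 :: real, snd v))"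
    by (intro bounded_linear_Pair bounded_linear_zero bounded_linear_fst bounded_linear_snd)
  have "(0, fst v, 0, snd v) + (c1, 0, c3, 0) \<in> C" if "v \<in> Y" for v
    using that center(1) C_iff[of c1 "fst v" c3 "snd v"] by simp
  from smooth_on_compose_linear[OF Y_open assms bl this] show ?thesis by simp
qed

lemma slice_zy:
  assumes "smooth_on C k"
  shows "smooth_on Z (\<lambda>v. k (fst v, c2, snd v, c4))"
proof -
  have bl: "bounded_linear (\<lambda>v :: real \<times> real. (fst v, 0 :: real, snd v, 0 :: real))"
    by (intro bounded_linear_Pair bounded_linear_zero bounded_linear_fst bounded_linear_snd)
  have "(fst v, 0, snd v, 0) + (0, c2, 0, c4) \<in> C" if "v \<in> Z" for v
    using that center(2) C_iff[of "fst v" c2 "snd v" c4] by simp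
  from smooth_on_compose_linear[OF Z_open assms bl this] show ?thesis by simp
qed

lemma smooth_parts: "smooth_on Y g" "smooth_on Y h" "smooth_on Z p" "smooth_on Z r" "smooth_on Z s"
  unfolding g_def h_def p_def r_def s_def using sm by (auto intro!: slice_z1y1 slice_zy)

lemma f_parts:
  assumes "P \<in> C"
  shows "f 1 1 P = g (proj_z1y1 P)" "f 3 1 P = h (proj_z1y1 P)"
    "f 2 2 P = p (proj_zy P)" "f 3 2 P = r (proj_zy P)" "f 1 2 P = s (proj_zy P)"
  using sep assms sm unfolding g_def h_def p_def r_def s_def separated_def
  by (auto intro!: of_z1y1 of_zy)

lemma diff_parts:
  assumes "P \<in> C"
  shows "g differentiable (at (proj_z1y1 P))" "h differentiable (at (proj_z1y1 P))"
    "p differentiable (at (proj_zy P))" "r differentiable (at (proj_zy P))" "s differentiable (at (proj_zy P))"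
  using smooth_parts[THEN smooth_on_differentiable] assms by blast+

lemmas partials_parts = partials_z1y1[OF C_open _ f_parts(1) diff_parts(1)] partials_z1y1[OF C_open _ f_parts(2) diff_parts(2)]
  partials_zy[OF C_open _ f_parts(3) diff_parts(3)] partials_zy[OF C_open _ f_parts(4) diff_parts(4)]
  partials_zy[OF C_open _ f_parts(5) diff_parts(5)]

lemma W_nonzero: "P \<in> C \<Longrightarrow> W_of g h (proj_z1y1 P) \<noteq> 0"
  using jac by (simp add: jac_def W_of_def partials_parts)

lemma pointwise_eqs:
  assumes "q \<in> Z" "v \<in> Y"
  defines "P \<equiv> (fst q, fst v, snd q, snd v)"
  shows "D1 s q * fst v + D2 s q * snd v - D1 g v * F P - D2 g v * G P = h v * p q - r q * \<eta>"
    "D1 p q * fst v + D2 p q * snd v = g v * r q - s q * h v"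
    "D1 r q * fst v + D2 r q * snd v - D1 h v * F P - D2 h v * G P = \<delta> * (g v * p q - s q * \<eta>)"
proof -
  have P: "P \<in> C" using assms(1,2) by (simp add: P_def C_iff)
  have pr: "proj_zy P = q" "proj_z1y1 P = v" "fst (snd P) = fst v" "snd (snd (snd P)) = snd v"
    by (simp_all add: P_def proj_zy_def proj_z1y1_def)
  show "D1 s q * fst v + D2 s q * snd v - D1 g v * F P - D2 g v * G P = h v * p q - r q * \<eta>"
    "D1 p q * fst v + D2 p q * snd v = g v * r q - s q * h v"
    "D1 r q * fst v + D2 r q * snd v - D1 h v * F P - D2 h v * G P = \<delta> * (g v * p q - s q * \<eta>)"
    using red[OF P] by (simp_all only: reduced_eqs_def Let_def P partials_parts f_parts pr)
qed

text \<open>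
  A linear form that vanishes on a neighbourhood vanishes identically. This is how identities are compared
  coefficient by coefficient in \<open>(z1, y1)\<close>.
\<close>

lemma linear_vanish:
  assumes "\<And>v. v \<in> Y \<Longrightarrow> A * fst v + B * snd v = 0"
  shows "A = 0 \<and> B = 0"
proof -
  have "(c2 + \<epsilon> / 2, c4) \<in> Y" "(c2, c4 + \<epsilon> / 2) \<in> Y" using \<epsilon> by (simp_all add: Y_iff)
  from assms[OF this(1)] assms[OF this(2)] assms[OF center(2)]
  have "A * (c2 + \<epsilon> / 2) + B * c4 = 0" "A * c2 + B * (c4 + \<epsilon> / 2) = 0" "A * c2 + B * c4 = 0" by simp_all
  then have "A * (\<epsilon> / 2) = 0" "B * (\<epsilon> / 2) = 0" by algebra+
  then show ?thesis using \<epsilon> by simp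
qed

text \<open>
  At two points \<open>q\<close>, \<open>q'\<close> with linearly independent values of \<open>(r, s)\<close>, the second identity is a linear system
  for \<open>(g, h)\<close> with constant coefficients, so \<open>g\<close> and \<open>h\<close> are linear forms \<open>a1 z1 + b1 y1\<close> and
  \<open>a3 z1 + b3 y1\<close>. Comparing coefficients then gives \<open>p\<^sub>z = a1 r - a3 s\<close> and \<open>p\<^sub>y = b1 r - b3 s\<close>, which
  is solved for \<open>r\<close> and \<open>s\<close>.
\<close>

lemma normal_form_ii:
  assumes "lin_indep_on Z r s"
  shows "\<exists>a1 b1 a3 b3. case_ii \<delta> \<eta> C F G a1 b1 a3 b3 p \<and> assoc_ii \<eta> C f a1 b1 a3 b3 p"
proof -
  obtain q q' where q: "q \<in> Z" "q' \<in> Z" and \<Delta>: "r q * s q' - r q' * s q \<noteq> 0"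
  proof -
    have "\<exists>q\<in>Z. r q \<noteq> 0 \<or> s q \<noteq> 0"
      using assms unfolding lin_indep_on_def by (metis mult_zero_right add_0 zero_neq_one)
    then obtain q where q: "q \<in> Z" "r q \<noteq> 0 \<or> s q \<noteq> 0" by blast
    have "\<exists>q'\<in>Z. r q * s q' - r q' * s q \<noteq> 0"
    proof (rule ccontr)
      assume "\<not> ?thesis"
      then have "\<forall>q'\<in>Z. (- s q) * r q' + r q * s q' = 0" by (auto simp: algebra_simps)
      then have "- s q = 0 \<and> r q = 0" using assms unfolding lin_indep_on_def by blast
      then show False using q(2) by simp
    qed
    then show thesis using that q(1) by blast
  qed
  define \<Delta> where "\<Delta> = r q * s q' - r q' * s q"
  have \<Delta>0: "\<Delta> \<noteq> 0" using \<Delta> by (simp add: \<Delta>_def)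
  \<comment> \<open>Cramer's rule for the second identity at \<open>q\<close> and \<open>q'\<close>.\<close>
  define a1 b1 a3 b3 where "a1 = (s q' * D1 p q - s q * D1 p q') / \<Delta>" and "b1 = (s q' * D2 p q - s q * D2 p q') / \<Delta>"
    and "a3 = (r q' * D1 p q - r q * D1 p q') / \<Delta>" and "b3 = (r q' * D2 p q - r q * D2 p q') / \<Delta>"
  have mul: "a1 * \<Delta> = s q' * D1 p q - s q * D1 p q'" "b1 * \<Delta> = s q' * D2 p q - s q * D2 p q'"
    "a3 * \<Delta> = r q' * D1 p q - r q * D1 p q'" "b3 * \<Delta> = r q' * D2 p q - r q * D2 p q'"
    using \<Delta>0 by (simp_all add: a1_def b1_def a3_def b3_def)
  have gh: "g v = a1 * fst v + b1 * snd v" "h v = a3 * fst v + b3 * snd v" if v: "v \<in> Y" for v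
  proof -
    note E = pointwise_eqs(2)[OF q(1) v] pointwise_eqs(2)[OF q(2) v]
    have "\<Delta> * (g v - (a1 * fst v + b1 * snd v)) = 0" "\<Delta> * (h v - (a3 * fst v + b3 * snd v)) = 0"
      using E mul unfolding \<Delta>_def by algebra+
    then show "g v = a1 * fst v + b1 * snd v" "h v = a3 * fst v + b3 * snd v" using \<Delta>0 by simp_all
  qed
  have pd: "D1 p w = a1 * r w - a3 * s w \<and> D2 p w = b1 * r w - b3 * s w" if w: "w \<in> Z" for w
  proof -
    have "(D1 p w - (a1 * r w - a3 * s w)) * fst v + (D2 p w - (b1 * r w - b3 * s w)) * snd v = 0" if v: "v \<in> Y" for v
      using pointwise_eqs(2)[OF w v] unfolding gh[OF v] by (simp add: algebra_simps)
    from linear_vanish[OF this] show ?thesis by simp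
  qed
  define \<gamma> where "\<gamma> = a1 * b3 - b1 * a3"
  have C0: "(c1, c2, c3, c4) \<in> C" using center by (simp add: C_iff)
  have \<gamma>: "\<gamma> \<noteq> 0"
  proof -
    have "D1 g (c2, c4) = a1" "D2 g (c2, c4) = b1" "D1 h (c2, c4) = a3" "D2 h (c2, c4) = b3"
      using partial_cong[OF Y_open center(2) gh(1)] partial_cong[OF Y_open center(2) gh(2)] 
      by (simp_all add: partial_fst_snd)
    then show ?thesis using W_nonzero[OF C0] by (simp add: \<gamma>_def W_of_def proj_z1y1_def)
  qed
  have rs: "s w = 1 / \<gamma> * (b1 * D1 p w - a1 * D2 p w)" "r w = 1 / \<gamma> * (b3 * D1 p w - a3 * D2 p w)" if "w \<in> Z" for w
  proof -
    have "b1 * D1 p w - a1 * D2 p w = \<gamma> * s w" "b3 * D1 p w - a3 * D2 p w = \<gamma> * r w"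
      unfolding conjunct1[OF pd[OF that]] conjunct2[OF pd[OF that]] by (simp_all add: \<gamma>_def algebra_simps)
    then show "s w = 1 / \<gamma> * (b1 * D1 p w - a1 * D2 p w)" "r w = 1 / \<gamma> * (b3 * D1 p w - a3 * D2 p w)" using \<gamma> by simp_all
  qed
  have assoc: "assoc_ii \<eta> C f a1 b1 a3 b3 p"
    unfolding assoc_ii_def
  proof (clarify, goal_cases)
    case (1 z z1 y y1)
    then have "(z, y) \<in> Z" "(z1, y1) \<in> Y" by (simp_all add: C_iff)
    then show ?case
      using f_parts[OF 1] eta 1 gh[of "(z1, y1)"] rs[of "(z, y)"] 
      by (simp add: Let_def proj_zy_def proj_z1y1_def \<gamma>_def)
  qed
  have indep: "lin_indep_on Z (D1 p) (D2 p)"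
    unfolding lin_indep_on_def
  proof (intro allI impI)
    fix c d assume "\<forall>w\<in>Z. c * D1 p w + d * D2 p w = 0"
    then have "\<forall>w\<in>Z. (c * a1 + d * b1) * r w + (- (c * a3 + d * b3)) * s w = 0" using pd by (simp add: algebra_simps)
    then have "c * a1 + d * b1 = 0 \<and> - (c * a3 + d * b3) = 0" using assms unfolding lin_indep_on_def by blast
    then have "c * a1 + d * b1 = 0" "c * a3 + d * b3 = 0" by simp_all
    then have "\<gamma> * c = 0" "\<gamma> * d = 0" unfolding \<gamma>_def by algebra+
    then show "c = 0 \<and> d = 0" using \<gamma> by simp
  qed
  note der = case_ii_derivatives[OF C_open \<gamma>[unfolded \<gamma>_def] smooth_parts(3) assoc]
  have "case_ii \<delta> \<eta> C F G a1 b1 a3 b3 p"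
    unfolding case_ii_def Let_def
  proof (intro conjI smooth_parts(3) indep \<gamma>[unfolded \<gamma>_def], clarify, goal_cases)
    case (1 z z1 y y1)
    show ?case
      using red[OF 1] unfolding der(8)[OF 1] by (rule case_ii_solve[OF \<gamma>[unfolded \<gamma>_def], THEN iffD1])
  qed
  then show ?thesis using assoc by blast
qed

text \<open>
  If \<open>r\<close> and \<open>s\<close> vanish, the second identity makes \<open>p\<close> constant, and the other two determine \<open>F\<close> and \<open>G\<close> as
  functions of \<open>(z1, y1)\<close> alone: the system is degenerate.
\<close>

lemma f12_f32_not_both_zero:
  "\<exists>w\<in>Z. r w \<noteq> 0 \<or> s w \<noteq> 0"
proof (rule ccontr)
  assume "\<not> ?thesis"
  then have zero: "r w = 0" "s w = 0" if "w \<in> Z" for w using that by auto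
  have dz: "partial e r w = 0" "partial e s w = 0" if "w \<in> Z" for e w
    by (rule partial_eq_0_of_const[OF Z_open that], use zero in blast)+
  have dp: "D1 p w = 0 \<and> D2 p w = 0" if "w \<in> Z" for w
    by (rule linear_vanish) (use pointwise_eqs(2)[OF that] zero[OF that] in simp)
  have pc: "p w = p (c1, c3)" if "w \<in> Z" for w
  proof (rule constant_along_segment[OF Z_convex center(1) that])
    show pdiff: "p differentiable (at x)" if "x \<in> Z" for x using smooth_on_differentiable[OF smooth_parts(3) that] .
    show "frechet_derivative p (at x) (w - (c1, c3)) = 0" if "x \<in> Z" for x
      using frechet_derivative_pair[OF pdiff[OF that], of "fst w - c1" "snd w - c3"] dp[OF that] by (cases w) simp
  qed
  define F0 G0 where "F0 v = F (c1, fst v, c3, snd v)" and "G0 v = G (c1, fst v, c3, snd v)" for v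
  have FG: "F P = F0 (proj_z1y1 P)" "G P = G0 (proj_z1y1 P)" if P: "P \<in> C" for P
  proof -
    obtain z z1 y y1 where P': "P = (z, z1, y, y1)" by (cases P)
    have zy: "(z, y) \<in> Z" and v: "(z1, y1) \<in> Y" using P by (simp_all add: P' C_iff)
    note E = pointwise_eqs(1,3)[OF zy v] pointwise_eqs(1,3)[OF center(1) v]
    let ?W = "D1 g (z1, y1) * D2 h (z1, y1) - D2 g (z1, y1) * D1 h (z1, y1)"
    have W: "?W \<noteq> 0" using W_nonzero[OF P] by (simp add: W_of_def P' proj_z1y1_def)
    have "D1 g (z1, y1) * F P + D2 g (z1, y1) * G P = - h (z1, y1) * p (c1, c3) \<and>
        D1 h (z1, y1) * F P + D2 h (z1, y1) * G P = - \<delta> * (g (z1, y1) * p (c1, c3))"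
      using E(1,2) by (simp add: P' dz[OF zy] zero[OF zy] pc[OF zy])
    moreover have "D1 g (z1, y1) * F (c1, z1, c3, y1) + D2 g (z1, y1) * G (c1, z1, c3, y1) = - h (z1, y1) * p (c1, c3) \<and>
        D1 h (z1, y1) * F (c1, z1, c3, y1) + D2 h (z1, y1) * G (c1, z1, c3, y1) = - \<delta> * (g (z1, y1) * p (c1, c3))"
      using E(3,4) by (simp add: dz[OF center(1)] zero[OF center(1)])
    ultimately show "F P = F0 (proj_z1y1 P)" "G P = G0 (proj_z1y1 P)"
      unfolding linear_2x2_solve[OF W] by (simp_all add: F0_def G0_def P' proj_z1y1_def)
  qed
  have sl: "smooth_on Y F0" "smooth_on Y G0"
    unfolding F0_def[abs_def] G0_def[abs_def] by (intro slice_z1y1 smF smG)+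
  have "J\<^sub>z F P = 0" "J\<^sub>y F P = 0" "J\<^sub>z G P = 0" "J\<^sub>y G P = 0" if P: "P \<in> C" for P
  proof -
    have v: "proj_z1y1 P \<in> Y" using P by blast
    note d = smooth_on_differentiable[OF sl(1) v] smooth_on_differentiable[OF sl(2) v]
    show "J\<^sub>z F P = 0" by (rule partials_z1y1(1)[OF C_open P _ d(1)]) (erule FG(1))
    show "J\<^sub>y F P = 0" by (rule partials_z1y1(3)[OF C_open P _ d(1)]) (erule FG(1))
    show "J\<^sub>z G P = 0" by (rule partials_z1y1(1)[OF C_open P _ d(2)]) (erule FG(2))
    show "J\<^sub>y G P = 0" by (rule partials_z1y1(3)[OF C_open P _ d(2)]) (erule FG(2))
  qed
  moreover obtain P where "P \<in> C" "(J\<^sub>z F P)\<^sup>2 + (J\<^sub>y F P)\<^sup>2 + (J\<^sub>z G P)\<^sup>2 + (J\<^sub>y G P)\<^sup>2 \<noteq> 0"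
  proof (rule ae_on_witness[OF nd[unfolded nondegenerate_def Let_def] C_open _ order_refl])
    show "C \<noteq> {}" using center(1) by auto
  qed
  ultimately show False by simp
qed

text \<open>
  Here \<open>r = \<mu> \<psi>\<close> and \<open>s = \<lambda> \<psi>\<close>. The second identity at one point with \<open>\<psi> \<noteq> 0\<close> shows that \<open>\<mu> g - \<lambda> h\<close> is a linear form
  \<open>a y1 + b z1\<close>, nonzero because the Jacobian is; then the identity at the other points gives \<open>p\<^sub>z = b \<psi>\<close> and
  \<open>p\<^sub>y = a \<psi>\<close>. The derivative of \<open>p\<close> in the direction \<open>(a, - b)\<close> vanishes, so \<open>p = \<phi> (\<xi>)\<close> with
  \<open>\<phi>' = \<psi>\<close>.
\<close>

lemma normal_form_i:
  assumes "\<not> lin_indep_on Z r s"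
  shows "\<exists>V' a b \<mu> lam g h \<phi>. subdomain V' C \<and> case_i \<delta> \<eta> V' F G a b \<mu> lam g h \<phi> \<and> assoc_i \<eta> V' f a b \<mu> lam g h \<phi>"
proof -
  obtain cc dd where cd: "cc \<noteq> 0 \<or> dd \<noteq> 0" "\<And>w. w \<in> Z \<Longrightarrow> cc * r w + dd * s w = 0"
    using assms unfolding lin_indep_on_def by blast
  define \<mu> lam N where "\<mu> = dd" and "lam = - cc" and "N = cc\<^sup>2 + dd\<^sup>2"
  have N: "N \<noteq> 0" using cd(1) by (simp add: N_def)
  define \<psi> where "\<psi> w = (dd * r w - cc * s w) / N" for w
  have rs: "r w = \<mu> * \<psi> w \<and> s w = lam * \<psi> w" if "w \<in> Z" for w
  proof -
    have "N * r w = dd * (dd * r w - cc * s w)" "N * s w = - cc * (dd * r w - cc * s w)"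
      using cd(2)[OF that] unfolding N_def by algebra+
    then have "r w = dd * (dd * r w - cc * s w) / N" "s w = - cc * (dd * r w - cc * s w) / N"
      using N by (simp_all add: field_simps)
    then show ?thesis unfolding \<psi>_def \<mu>_def lam_def by (metis times_divide_eq_right)
  qed
  have \<psi>cont: "continuous_on Z \<psi>"
    unfolding \<psi>_def[abs_def] by (intro continuous_intros smooth_on_continuous smooth_parts) (use N in simp)
  obtain q1 where q1: "q1 \<in> Z" "\<psi> q1 \<noteq> 0"
    using f12_f32_not_both_zero rs by (metis mult_zero_right)
  define a b where "a = D2 p q1 / \<psi> q1" and "b = D1 p q1 / \<psi> q1"
  have E2: "D1 p w * fst v + D2 p w * snd v = \<psi> w * (\<mu> * g v - lam * h v)" if "w \<in> Z" "v \<in> Y" for w v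
    using pointwise_eqs(2)[OF that] rs[OF that(1)] by (simp add: algebra_simps)
  have m: "\<mu> * g v - lam * h v = a * snd v + b * fst v" if "v \<in> Y" for v
    using E2[OF q1(1) that] q1(2) by (simp add: a_def b_def field_simps)
  have dp: "D1 p w = b * \<psi> w \<and> D2 p w = a * \<psi> w" if w: "w \<in> Z" for w
  proof -
    have "(D1 p w - b * \<psi> w) * fst v + (D2 p w - a * \<psi> w) * snd v = 0" if v: "v \<in> Y" for v
      using E2[OF w v] unfolding m[OF v] by (simp add: algebra_simps)
    from linear_vanish[OF this] show ?thesis by simp
  qed
  have C0: "(c1, c2, c3, c4) \<in> C" using center by (simp add: C_iff)
  have ab0: "a \<noteq> 0 \<or> b \<noteq> 0"
  proof (rule ccontr)
    assume "\<not> ?thesis"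
    then have z: "\<forall>v\<in>Y. 1 * (\<mu> * g v + (- lam) * h v) = 0" using m by simp
    have "g differentiable (at (c2, c4))" "h differentiable (at (c2, c4))"
      using smooth_on_differentiable[OF smooth_parts(1) center(2)] smooth_on_differentiable[OF smooth_parts(2) center(2)] by auto
    note lc = partial_lincomb[OF this, of _ 1 \<mu> "- lam"]
    have "\<mu> * partial e g (c2, c4) = lam * partial e h (c2, c4)" for e
      using lc[of e] unfolding partial_eq_0_of_const[OF Y_open center(2) z] by simp
    from this[of "(1, 0)"] this[of "(0, 1)"]
    have "\<mu> * W_of g h (c2, c4) = 0" "lam * W_of g h (c2, c4) = 0" unfolding W_of_def by algebra+
    then show False using W_nonzero[OF C0] cd(1) by (auto simp: proj_z1y1_def \<mu>_def lam_def)
  qed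
  define M where "M = a\<^sup>2 + b\<^sup>2"
  have M: "M > 0" using ab0 by (simp add: M_def sum_power2_gt_zero_iff)
  have \<psi>open: "open {w \<in> Z. \<psi> w * \<psi> q1 > 0}"
  proof -
    have "open (Z \<inter> (\<lambda>w. \<psi> w * \<psi> q1) -` {0<..})"
      using continuous_on_open_vimage[OF Z_open, of "\<lambda>w. \<psi> w * \<psi> q1"] \<psi>cont
      by (auto simp: Int_commute intro!: continuous_intros)
    moreover have "Z \<inter> (\<lambda>w. \<psi> w * \<psi> q1) -` {0<..} = {w \<in> Z. \<psi> w * \<psi> q1 > 0}" by auto
    ultimately show ?thesis by simp
  qed
  let ?Zp = "{w \<in> Z. \<psi> w * \<psi> q1 > 0}"
  have q1p: "q1 \<in> ?Zp" using q1 by (auto simp: zero_less_mult_iff linorder_neq_iff)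
  \<comment> \<open>The final cube lies where \<open>\<psi>\<close> keeps its sign, for the monotonicity of \<open>\<phi>\<close>, and where \<open>p \<noteq> 0\<close>, to divide by \<open>\<phi>\<close>.\<close>
  obtain q2 where q2: "q2 \<in> ?Zp" "p q2 \<noteq> 0"
  proof -
    have "\<exists>w\<in>?Zp. p w \<noteq> 0"
    proof (rule ccontr)
      assume "\<not> ?thesis"
      then have "\<forall>w\<in>?Zp. p w = 0" by blast
      from partial_eq_0_of_const[OF \<psi>open q1p this] dp[OF q1(1)] q1(2) ab0 show False by auto
    qed
    then show thesis using that by blast
  qed
  let ?Zn = "{w \<in> ?Zp. p w \<noteq> 0}"
  have Zn: "open ?Zn"
    by (rule open_nonzero[OF \<psi>open continuous_on_subset[OF smooth_on_continuous[OF smooth_parts(3)]]]) auto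
  obtain z2 y2 where z2: "q2 = (z2, y2)" by (cases q2)
  have oU: "open (C \<inter> proj_zy -` ?Zn)"
    by (intro open_Int C_open open_vimage Zn linear_continuous_on bounded_linear_proj(2))
  have "(z2, c2, y2, c4) \<in> C \<inter> proj_zy -` ?Zn" using q2 center(2) by (simp add: C_iff z2 proj_zy_def)
  then obtain e where e: "e > 0" and cubee: "cube (z2, c2, y2, c4) e \<subseteq> C \<inter> proj_zy -` ?Zn"
    using cube_in_open[OF oU] by blast
  \<comment> \<open>\<open>\<phi>\<close> is read off along the line through the centre in the direction \<open>(b, a)\<close>. Halving the cube ensures that
    this line stays in the larger cube for all values that \<open>\<xi>\<close> takes on \<open>V'\<close>.\<close>
  define V' where "V' = cube (z2, c2, y2, c4) (e / 2)"
  have V'sub: "V' \<subseteq> cube (z2, c2, y2, c4) e" using e by (auto simp: V'_def mem_cube)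
  have V'C: "V' \<subseteq> C" and V'Z: "\<And>P. P \<in> V' \<Longrightarrow> proj_zy P \<in> ?Zn" using V'sub cubee by blast+
  have V': "open V'" "convex V'" "subdomain V' C"
    unfolding V'_def using cube_open cube_convex cube_subdomain[of "e / 2"] e V'C V'_def by auto
  define \<xi>2 where "\<xi>2 = a * y2 + b * z2"
  define \<zeta> where "\<zeta> x = (z2 + (x - \<xi>2) / M * b, y2 + (x - \<xi>2) / M * a)" for x
  define \<phi> where "\<phi> x = p (\<zeta> x)" for x
  have bigZ: "(z, y) \<in> Z" if "\<bar>z - z2\<bar> < e" "\<bar>y - y2\<bar> < e" for z y
  proof -
    have "(z, c2, y, c4) \<in> cube (z2, c2, y2, c4) e" using that e by (simp add: mem_cube)
    then show ?thesis using cubee by (auto simp: C_iff)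
  qed
  have close: "\<bar>(x - \<xi>2) / M * b\<bar> < e \<and> \<bar>(x - \<xi>2) / M * a\<bar> < e" if x: "x \<in> xi a b ` V'" for x
  proof -
    obtain z z1 y y1 where P: "(z, z1, y, y1) \<in> V'" "x = a * y + b * z" using x by (auto simp: xi_def)
    define d where "d = max \<bar>z - z2\<bar> \<bar>y - y2\<bar>"
    have d: "d < e / 2" "\<bar>z - z2\<bar> \<le> d" "\<bar>y - y2\<bar> \<le> d" "d \<ge> 0" using P(1) by (auto simp: d_def V'_def mem_cube)
    have "\<bar>x - \<xi>2\<bar> = \<bar>a * (y - y2) + b * (z - z2)\<bar>" by (simp add: P(2) \<xi>2_def algebra_simps)
    also have "\<dots> \<le> \<bar>a\<bar> * \<bar>y - y2\<bar> + \<bar>b\<bar> * \<bar>z - z2\<bar>" unfolding abs_mult[symmetric] by (rule abs_triangle_ineq)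
    also have "\<dots> \<le> \<bar>a\<bar> * d + \<bar>b\<bar> * d" by (intro add_mono mult_left_mono d) auto
    finally have x1: "\<bar>x - \<xi>2\<bar> \<le> (\<bar>a\<bar> + \<bar>b\<bar>) * d" by (simp add: algebra_simps)
    have bound: "\<bar>(x - \<xi>2) / M * k\<bar> < e" if k: "(\<bar>a\<bar> + \<bar>b\<bar>) * \<bar>k\<bar> \<le> 2 * M" for k
    proof -
      have "\<bar>x - \<xi>2\<bar> * \<bar>k\<bar> \<le> (\<bar>a\<bar> + \<bar>b\<bar>) * d * \<bar>k\<bar>" by (rule mult_right_mono[OF x1]) simp
      also have "\<dots> = ((\<bar>a\<bar> + \<bar>b\<bar>) * \<bar>k\<bar>) * d" by simp
      also have "\<dots> \<le> 2 * M * d" by (rule mult_right_mono[OF k d(4)])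
      also have "\<dots> < e * M" using d(1) M by (simp add: algebra_simps)
      finally show ?thesis using M by (simp add: abs_mult abs_divide pos_divide_less_eq)
    qed
    have am: "2 * (\<bar>a\<bar> * \<bar>b\<bar>) \<le> M" 
      using sum_squares_bound[of "\<bar>a\<bar>" "\<bar>b\<bar>"] by (simp add: M_def)
    have "(\<bar>a\<bar> + \<bar>b\<bar>) * \<bar>a\<bar> \<le> 2 * M" "(\<bar>a\<bar> + \<bar>b\<bar>) * \<bar>b\<bar> \<le> 2 * M"
    proof -
      have "(\<bar>a\<bar> + \<bar>b\<bar>) * \<bar>a\<bar> = a\<^sup>2 + \<bar>a\<bar> * \<bar>b\<bar>" "(\<bar>a\<bar> + \<bar>b\<bar>) * \<bar>b\<bar> = b\<^sup>2 + \<bar>a\<bar> * \<bar>b\<bar>"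
        by (simp_all add: algebra_simps power2_eq_square)
      moreover have "a\<^sup>2 \<le> M" "b\<^sup>2 \<le> M" "0 \<le> \<bar>a\<bar> * \<bar>b\<bar>" by (simp_all add: M_def)
      ultimately show "(\<bar>a\<bar> + \<bar>b\<bar>) * \<bar>a\<bar> \<le> 2 * M" "(\<bar>a\<bar> + \<bar>b\<bar>) * \<bar>b\<bar> \<le> 2 * M" using am by linarith+
    qed
    then show ?thesis using bound by blast
  qed
  have \<zeta>Z: "\<zeta> x \<in> Z" if "x \<in> xi a b ` V'" for x
    unfolding \<zeta>_def by (rule bigZ) (use close[OF that] in auto)
  have o\<xi>: "open (xi a b ` V')" by (rule open_xi_image[OF V'(1)]) (use M in \<open>auto simp: M_def\<close>)
  have sm\<phi>: "smooth_on (xi a b ` V') \<phi>"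
  proof -
    have bl: "bounded_linear (\<lambda>x. (x * (b / M), x * (a / M)))"
      by (intro bounded_linear_Pair bounded_linear_mult_left)
    have \<zeta>eq: "\<zeta> x = (x * (b / M), x * (a / M)) + (z2 - \<xi>2 / M * b, y2 - \<xi>2 / M * a)" for x
      by (simp add: \<zeta>_def diff_divide_distrib algebra_simps)
    show ?thesis
      using smooth_on_compose_linear[OF o\<xi> smooth_parts(3) bl, of "(z2 - \<xi>2 / M * b, y2 - \<xi>2 / M * a)"] \<zeta>Z
      unfolding \<zeta>eq[symmetric] \<phi>_def[abs_def] by blast
  qed
  have f22: "f 2 2 P = \<phi> (xi a b P)" if P: "P \<in> V'" for P
  proof -
    obtain z z1 y y1 where P': "P = (z, z1, y, y1)" by (cases P)
    have \<xi>: "xi a b P \<in> xi a b ` V'" using P by blast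
    have zy: "(z, y) \<in> Z" using V'Z[OF P] by (simp add: P' proj_zy_def)
    have "p (\<zeta> (xi a b P)) = p (z, y)"
    proof (rule constant_along_segment[OF Z_convex zy \<zeta>Z[OF \<xi>]])
      show pdiff: "p differentiable (at x)" if "x \<in> Z" for x using smooth_on_differentiable[OF smooth_parts(3) that] .
      show "frechet_derivative p (at x) (\<zeta> (xi a b P) - (z, y)) = 0" if x: "x \<in> Z" for x
      proof -
        let ?t = "(a * y + b * z - \<xi>2) / M"
        have comb: "b * (z2 + t * b - z) + a * (y2 + t * a - y) = t * M - (a * y + b * z - \<xi>2)" for t
          by (simp add: M_def \<xi>2_def algebra_simps power2_eq_square)
        have tM: "?t * M = a * y + b * z - \<xi>2" using M by simp
        have "\<zeta> (xi a b P) - (z, y) = (z2 + ?t * b - z, y2 + ?t * a - y)" by (simp add: \<zeta>_def P' xi_def)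
        then have "frechet_derivative p (at x) (\<zeta> (xi a b P) - (z, y)) = \<psi> x * (b * (z2 + ?t * b - z) + a * (y2 + ?t * a - y))"
          using frechet_derivative_pair[OF pdiff[OF x]] dp[OF x] by (simp add: algebra_simps)
        then show ?thesis unfolding comb tM by simp
      qed
    qed
    then show ?thesis using f_parts(3)[of P] P V'C by (auto simp: \<phi>_def P' proj_zy_def)
  qed
  have \<phi>': "deriv \<phi> (xi a b P) = \<psi> (proj_zy P)" if P: "P \<in> V'" for P
  proof -
    have PC: "P \<in> C" using P V'C by blast
    have "\<phi> differentiable (at (xi a b P))" using smooth_on_differentiable[OF sm\<phi>] P by blast
    note px = partials_xi[OF V'(1) P f22 this]
    have pz: "J\<^sub>z (f 2 2) P = D1 p (proj_zy P)" "J\<^sub>y (f 2 2) P = D2 p (proj_zy P)"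
      using PC by (simp_all add: partials_parts)
    have "b * deriv \<phi> (xi a b P) = b * \<psi> (proj_zy P)" "a * deriv \<phi> (xi a b P) = a * \<psi> (proj_zy P)"
      using px(1,3) pz dp[of "proj_zy P"] V'Z[OF P] by simp_all
    then show ?thesis using ab0 by auto
  qed
  have assoc: "assoc_i \<eta> V' f a b \<mu> lam g h \<phi>"
    unfolding assoc_i_def
  proof (clarify, goal_cases)
    case (1 z z1 y y1)
    have PC: "(z, z1, y, y1) \<in> C" using 1 V'C by blast
    have "(z, y) \<in> Z" using PC by (simp add: C_iff)
    then show ?case
      using f_parts[OF PC] f22[OF 1] \<phi>'[OF 1] eta PC rs[of "(z, y)"] by (simp add: Let_def proj_zy_def proj_z1y1_def xi_def)
  qed
  have Y': "proj_z1y1 ` V' \<subseteq> Y" using V'C by blast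
  have smg: "smooth_on (proj_z1y1 ` V') g" "smooth_on (proj_z1y1 ` V') h"
    using smooth_parts(1,2) Y' smooth_on_subset by blast+
  have rel: "\<forall>(z1, y1) \<in> proj_z1y1 ` V'. \<mu> * g (z1, y1) - lam * h (z1, y1) = a * y1 + b * z1"
    using m Y' by fastforce
  have M': "a\<^sup>2 + b\<^sup>2 \<noteq> 0" using M by (auto simp: M_def)
  note der = case_i_derivatives[OF V'(1) M' smg sm\<phi> assoc rel]
  have mono: "strict_mono_on (xi a b ` V') \<phi> \<or> strict_antimono_on (xi a b ` V') \<phi>"
  proof -
    have conv: "convex (xi a b ` V')"
      by (rule convex_linear_image[OF bounded_linear.linear[OF bounded_linear_proj(3)] V'(2)])
    have seg: "t \<in> xi a b ` V'" if "x \<in> xi a b ` V'" "x' \<in> xi a b ` V'" "x \<le> t" "t \<le> x'" for x x' t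
      using conv that mem_is_interval_1_I is_interval_convex_1 by blast
    have D: "(\<phi> has_real_derivative deriv \<phi> x) (at x)" if "x \<in> xi a b ` V'" for x
      using smooth_on_differentiable[OF sm\<phi> that] by (simp add: DERIV_deriv_iff_real_differentiable)
    have sgn: "deriv \<phi> x * \<psi> q1 > 0" if "x \<in> xi a b ` V'" for x
      using that \<phi>' V'Z by auto
    show ?thesis
    proof (cases "\<psi> q1 > 0")
      case True
      have "\<phi> x < \<phi> x'" if "x \<in> xi a b ` V'" "x' \<in> xi a b ` V'" "x < x'" for x x'
        by (rule DERIV_pos_imp_increasing[OF that(3)])
          (use D sgn seg[OF that(1,2)] True in \<open>metis zero_less_mult_pos2\<close>)
      then show ?thesis by (simp add: monotone_on_def)
    next
      case False
      then have neg: "deriv \<phi> x < 0" if "x \<in> xi a b ` V'" for x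
        using sgn[OF that] q1(2) by (auto simp: zero_less_mult_iff)
      have "\<phi> x > \<phi> x'" if "x \<in> xi a b ` V'" "x' \<in> xi a b ` V'" "x < x'" for x x'
        by (rule DERIV_neg_imp_decreasing[OF that(3)]) (use D neg seg[OF that(1,2)] in blast)
      then show ?thesis by (simp add: monotone_on_def)
    qed
  qed
  have ae: "ae_on V' Q" if "\<And>P. P \<in> V' \<Longrightarrow> Q P" for Q
  proof -
    have "{P \<in> V'. \<not> Q P} = {}" using that by blast
    then show ?thesis unfolding ae_on_def by (simp only: negligible_empty)
  qed
  have "case_i \<delta> \<eta> V' F G a b \<mu> lam g h \<phi>"
    unfolding case_i_def
  proof (intro conjI smg sm\<phi> mono M' rel)
    show "\<mu>\<^sup>2 + lam\<^sup>2 \<noteq> 0" using cd(1) by (auto simp: \<mu>_def lam_def)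
    show "ae_on V' (\<lambda>P. W_of g h (proj_z1y1 P) \<noteq> 0)"
      by (rule ae, rule W_nonzero) (use V'C in blast)
    show "ae_on V' (\<lambda>P. g (proj_z1y1 P) \<noteq> lam * \<eta> * (deriv \<phi> (xi a b P) / \<phi> (xi a b P)))"
    proof (rule ae)
      fix P assume P: "P \<in> V'"
      have PC: "P \<in> C" using P V'C by blast
      have "\<phi> (xi a b P) \<noteq> 0" using V'Z[OF P] f_parts(3)[OF PC] f22[OF P] by simp
      moreover have "g (proj_z1y1 P) * \<phi> (xi a b P) - lam * deriv \<phi> (xi a b P) * \<eta> \<noteq> 0"
        using det[OF PC] f_parts[OF PC] f22[OF P] \<phi>'[OF P] rs[of "proj_zy P"] V'Z[OF P] eta PC by simp
      ultimately show "g (proj_z1y1 P) \<noteq> lam * \<eta> * (deriv \<phi> (xi a b P) / \<phi> (xi a b P))"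
        by (auto simp: field_simps)
    qed
    show "\<forall>(z, z1, y, y1) \<in> V'.
        let r = (z1, y1); \<xi> = a * y + b * z; W = W_of g h r;
            \<phi>0 = \<phi> \<xi>; \<phi>1 = deriv \<phi> \<xi>; \<phi>2 = deriv (deriv \<phi>) \<xi>;
            k = (\<lambda>s. (h s)\<^sup>2 - \<delta> * (g s)\<^sup>2)
        in W \<noteq> 0 \<longrightarrow>
           F (z, z1, y, y1) = 1 / W *
             (- (a * b * z1 + a\<^sup>2 * y1) * \<phi>2 + \<eta> * (\<mu> * D2 h r - \<delta> * lam * D2 g r) * \<phi>1
              - 1 / 2 * D2 k r * \<phi>0) \<and>
           G (z, z1, y, y1) = 1 / W *
             ((b\<^sup>2 * z1 + a * b * y1) * \<phi>2 - \<eta> * (\<mu> * D1 h r - \<delta> * lam * D1 g r) * \<phi>1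
              + 1 / 2 * D1 k r * \<phi>0)"
    proof (clarify, goal_cases)
      case (1 z z1 y y1)
      have PC: "(z, z1, y, y1) \<in> C" using 1 V'C by blast
      have v: "(z1, y1) \<in> Y" using PC by (simp add: C_iff)
      have W: "D1 g (z1, y1) * D2 h (z1, y1) - D2 g (z1, y1) * D1 h (z1, y1) \<noteq> 0"
        using W_nonzero[OF PC] by (simp add: W_of_def proj_z1y1_def)
      have ba: "\<mu> * D1 g (z1, y1) - lam * D1 h (z1, y1) = b" "\<mu> * D2 g (z1, y1) - lam * D2 h (z1, y1) = a"
        using der(5,6)[OF 1] by (simp_all add: proj_z1y1_def)
      note dsq = partial_square_difference[OF smooth_on_differentiable[OF smooth_parts(1) v] smooth_on_differentiable[OF smooth_parts(2) v]]
      show ?case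
        using red[OF PC] unfolding der(7)[OF 1] case_i_solve[OF W ba] Let_def dsq W_of_def by blast
    qed
  qed
  then show ?thesis using assoc V'(3) by blast
qed

lemma normal_form:
  "\<exists>V'. subdomain V' C \<and>
     ((\<exists>a b \<mu> lam g h \<phi>. case_i \<delta> \<eta> V' F G a b \<mu> lam g h \<phi> \<and> assoc_i \<eta> V' f a b \<mu> lam g h \<phi>) \<or>
      (\<exists>a1 b1 a3 b3 p. case_ii \<delta> \<eta> V' F G a1 b1 a3 b3 p \<and> assoc_ii \<eta> V' f a1 b1 a3 b3 p))"
proof (cases "lin_indep_on Z r s")
  case True
  have "subdomain C C"
    unfolding C_def by (rule cube_subdomain[OF \<epsilon>]) simp
  then show ?thesis using normal_form_ii[OF True] by blast
next
  case False
  from normal_form_i[OF this] show ?thesis by blast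
qed

end

lemma nondegenerate_subset: "nondegenerate U F G \<Longrightarrow> V \<subseteq> U \<Longrightarrow> nondegenerate V F G"
  unfolding nondegenerate_def Let_def by (rule ae_on_subset)

lemma subdomain_trans: "subdomain V' V \<Longrightarrow> subdomain V U \<Longrightarrow> subdomain V' U"
  by (auto simp: subdomain_def)

lemma subdomain_refl: "subdomain V U \<Longrightarrow> subdomain V V"
  by (simp add: subdomain_def)

text \<open>
  The two non-vanishing conditions are met one after the other: the Jacobian is nonzero somewhere, hence on a
  nonempty open set, and this set is not negligible, so it contains a point where
  \<open>f\<^sub>1\<^sub>1 f\<^sub>2\<^sub>2 - f\<^sub>1\<^sub>2 f\<^sub>2\<^sub>1 \<noteq> 0\<close> as well.
\<close>

lemma describes_normal_form:
  assumes desc: "describes_with_eta \<delta> \<eta> V F G f" and V: "open V" "V \<noteq> {}"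
    and FG: "smooth_on V F" "smooth_on V G" and nd: "nondegenerate V F G"
  shows "\<exists>V'. subdomain V' V \<and>
     ((\<exists>a b \<mu> lam g h \<phi>. case_i \<delta> \<eta> V' F G a b \<mu> lam g h \<phi> \<and> assoc_i \<eta> V' f a b \<mu> lam g h \<phi>) \<or>
      (\<exists>a1 b1 a3 b3 p. case_ii \<delta> \<eta> V' F G a1 b1 a3 b3 p \<and> assoc_ii \<eta> V' f a1 b1 a3 b3 p))"
proof -
  have ds: "describes_surfaces \<delta> V F G f" and eta: "\<forall>P\<in>V. f 2 1 P = \<eta>"
    using desc by (auto simp: describes_with_eta_def)
  then have sm: "\<forall>i\<in>{1,2,3}. \<forall>j\<in>{1,2}. smooth_on V (f i j)"
    and ae: "ae_on V (\<lambda>P. f 1 1 P * f 2 2 P - f 1 2 P * f 2 1 P \<noteq> 0)" by (auto simp: describes_surfaces_def)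
  have sep: "separated V f" by (rule describes_imp_separated[OF ds V(1) FG])
  have red: "reduced_eqs \<delta> \<eta> f P (F P) (G P)" if "P \<in> V" for P
    using describes_imp_struct_eqs[OF ds V(1) FG that] struct_eqs_separated[OF sep V(1) that eta] by blast
  let ?d = "\<lambda>P. f 1 1 P * f 2 2 P - f 1 2 P * f 2 1 P"
  have o1: "open {P \<in> V. jac f P \<noteq> 0}" by (rule open_nonzero[OF V(1) jac_continuous[OF sm]])
  have "{P \<in> V. jac f P \<noteq> 0} \<noteq> {}" using jac_nonzero_somewhere[OF desc V FG] by blast
  then obtain P0 where P0: "P0 \<in> V" "jac f P0 \<noteq> 0" "?d P0 \<noteq> 0"
    using ae_on_witness[OF ae o1] by blast
  have "continuous_on V (\<lambda>P. jac f P * ?d P)"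
    using sm by (intro continuous_intros jac_continuous smooth_on_continuous) auto
  then have o2: "open {P \<in> V. jac f P * ?d P \<noteq> 0}" by (rule open_nonzero[OF V(1)])
  have "P0 \<in> {P \<in> V. jac f P * ?d P \<noteq> 0}" using P0 by simp
  then obtain \<epsilon> where \<epsilon>: "\<epsilon> > 0" "cube P0 \<epsilon> \<subseteq> {P \<in> V. jac f P * ?d P \<noteq> 0}" using cube_in_open[OF o2] by blast
  obtain c1 c2 c3 c4 where c: "P0 = (c1, c2, c3, c4)" by (cases P0)
  let ?C = "cube (c1, c2, c3, c4) \<epsilon>"
  have C: "?C \<subseteq> V" "\<And>P. P \<in> ?C \<Longrightarrow> jac f P \<noteq> 0" "\<And>P. P \<in> ?C \<Longrightarrow> ?d P \<noteq> 0"
    using \<epsilon>(2) unfolding c by auto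
  have "separated_cube \<delta> \<eta> c1 c2 c3 c4 \<epsilon> f F G"
  proof
    show "\<forall>i\<in>{1,2,3}. \<forall>j\<in>{1,2}. smooth_on ?C (f i j)" using sm smooth_on_subset C(1) by blast
    show "separated ?C f" using sep C(1) unfolding separated_def by blast
    show "\<forall>P\<in>?C. f 2 1 P = \<eta>" using eta C(1) by blast
    show "reduced_eqs \<delta> \<eta> f P (F P) (G P)" if "P \<in> ?C" for P using red that C(1) by blast
    show "smooth_on ?C F" "smooth_on ?C G" using FG smooth_on_subset C(1) by blast+
    show "nondegenerate ?C F G" by (rule nondegenerate_subset[OF nd C(1)])
  qed (use \<epsilon>(1) C(2,3) in auto)
  from separated_cube.normal_form[OF this]
  show ?thesis using subdomain_trans[OF _ cube_subdomain[OF \<epsilon>(1) C(1)]] by blast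
qed

section \<open>The theorem\<close>

lemma assoc_i_exists: "\<exists>f. assoc_i \<eta> V f a b \<mu> lam g h \<phi>"
proof
  show "assoc_i \<eta> V (\<lambda>i j P. case P of (z, z1, y, y1) \<Rightarrow>
      if i = 1 then (if j = 1 then g (z1, y1) else lam * deriv \<phi> (a * y + b * z))
      else if i = 2 then (if j = 1 then \<eta> else \<phi> (a * y + b * z))
      else (if j = 1 then h (z1, y1) else \<mu> * deriv \<phi> (a * y + b * z))) a b \<mu> lam g h \<phi>"
    by (auto simp: assoc_i_def)
qed

lemma assoc_ii_exists: "\<exists>f. assoc_ii \<eta> V f a1 b1 a3 b3 p"
proof
  show "assoc_ii \<eta> V (\<lambda>i j P. case P of (z, z1, y, y1) \<Rightarrow>
      if i = 1 then (if j = 1 then a1 * z1 + b1 * y1 else 1 / (a1 * b3 - b1 * a3) * (b1 * D1 p (z, y) - a1 * D2 p (z, y)))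
      else if i = 2 then (if j = 1 then \<eta> else p (z, y))
      else (if j = 1 then a3 * z1 + b3 * y1 else 1 / (a1 * b3 - b1 * a3) * (b3 * D1 p (z, y) - a3 * D2 p (z, y)))) a1 b1 a3 b3 p"
    by (auto simp: assoc_ii_def Let_def)
qed

theorem theorem3p12:
  fixes \<delta> \<eta> :: real and U :: "jet set" and F G :: "jet \<Rightarrow> real"
  assumes "\<delta> = 1 \<or> \<delta> = -1"
    and "open U" "connected U" "U \<noteq> {}"
    and "smooth_on U F" "smooth_on U G"
    and "nondegenerate U F G"
  shows
    "(gen_locally U (\<lambda>V. \<exists>f. describes_with_eta \<delta> \<eta> V F G f)
      \<longleftrightarrow>
      gen_locally U (\<lambda>V.
        (\<exists>a b \<mu> lam g h \<phi>. case_i \<delta> \<eta> V F G a b \<mu> lam g h \<phi>) \<or>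
        (\<exists>a1 b1 a3 b3 p. case_ii \<delta> \<eta> V F G a1 b1 a3 b3 p)))
     \<and>
     (\<forall>V f. subdomain V U \<longrightarrow> describes_with_eta \<delta> \<eta> V F G f \<longrightarrow>
        gen_locally V (\<lambda>V'.
          (\<exists>a b \<mu> lam g h \<phi>. case_i \<delta> \<eta> V' F G a b \<mu> lam g h \<phi> \<and>
                              assoc_i \<eta> V' f a b \<mu> lam g h \<phi>) \<or>
          (\<exists>a1 b1 a3 b3 p. case_ii \<delta> \<eta> V' F G a1 b1 a3 b3 p \<and>
                            assoc_ii \<eta> V' f a1 b1 a3 b3 p)))
     \<and>
     (\<forall>V f a b \<mu> lam g h \<phi>. subdomain V U \<longrightarrow>
        case_i \<delta> \<eta> V F G a b \<mu> lam g h \<phi> \<longrightarrow> assoc_i \<eta> V f a b \<mu> lam g h \<phi> \<longrightarrow>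
        gen_locally V (\<lambda>V'. describes_with_eta \<delta> \<eta> V' F G f))
     \<and>
     (\<forall>V f a1 b1 a3 b3 p. subdomain V U \<longrightarrow>
        case_ii \<delta> \<eta> V F G a1 b1 a3 b3 p \<longrightarrow> assoc_ii \<eta> V f a1 b1 a3 b3 p \<longrightarrow>
        gen_locally V (\<lambda>V'. describes_with_eta \<delta> \<eta> V' F G f))"
    (is "(?desc \<longleftrightarrow> ?cases) \<and> ?necessary \<and> ?sufficient_i \<and> ?sufficient_ii")
proof -
  have necessary: ?necessary
  proof (intro allI impI)
    fix V f assume V: "subdomain V U" and desc: "describes_with_eta \<delta> \<eta> V F G f"
    show "gen_locally V (\<lambda>V'.
          (\<exists>a b \<mu> lam g h \<phi>. case_i \<delta> \<eta> V' F G a b \<mu> lam g h \<phi> \<and>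
                              assoc_i \<eta> V' f a b \<mu> lam g h \<phi>) \<or>
          (\<exists>a1 b1 a3 b3 p. case_ii \<delta> \<eta> V' F G a1 b1 a3 b3 p \<and>
                            assoc_ii \<eta> V' f a1 b1 a3 b3 p))"
      unfolding gen_locally_def
    proof (intro allI impI)
      fix V2 assume V2: "subdomain V2 V"
      then have sub: "V2 \<subseteq> V" "V2 \<subseteq> U" "open V2" "V2 \<noteq> {}" using V by (auto simp: subdomain_def)
      show "\<exists>V'. subdomain V' V2 \<and>
        ((\<exists>a b \<mu> lam g h \<phi>. case_i \<delta> \<eta> V' F G a b \<mu> lam g h \<phi> \<and> assoc_i \<eta> V' f a b \<mu> lam g h \<phi>) \<or>
         (\<exists>a1 b1 a3 b3 p. case_ii \<delta> \<eta> V' F G a1 b1 a3 b3 p \<and> assoc_ii \<eta> V' f a1 b1 a3 b3 p))"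
        by (rule describes_normal_form[OF describes_with_eta_subset[OF desc sub(1)] sub(3,4)
              smooth_on_subset[OF assms(5) sub(2)] smooth_on_subset[OF assms(6) sub(2)] nondegenerate_subset[OF assms(7) sub(2)]])
    qed
  qed
  have sufficient_i: ?sufficient_i
    unfolding gen_locally_def
  proof (intro allI impI)
    fix V f a b \<mu> lam g h \<phi> V2
    assume V: "subdomain V U" and ci: "case_i \<delta> \<eta> V F G a b \<mu> lam g h \<phi>" "assoc_i \<eta> V f a b \<mu> lam g h \<phi>"
      and V2: "subdomain V2 V"
    have "open V" using V by (simp add: subdomain_def)
    from case_i_describes[OF this ci V2]
    show "\<exists>V'. subdomain V' V2 \<and> describes_with_eta \<delta> \<eta> V' F G f" .
  qed
  have sufficient_ii: ?sufficient_ii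
    unfolding gen_locally_def
  proof (intro allI impI)
    fix V f a1 b1 a3 b3 p V2
    assume V: "subdomain V U" and cii: "case_ii \<delta> \<eta> V F G a1 b1 a3 b3 p" "assoc_ii \<eta> V f a1 b1 a3 b3 p"
      and V2: "subdomain V2 V"
    have "open V" "V2 \<subseteq> U" using V V2 by (auto simp: subdomain_def)
    from case_ii_describes[OF this(1) cii V2 nondegenerate_subset[OF assms(7) this(2)]]
    show "\<exists>V'. subdomain V' V2 \<and> describes_with_eta \<delta> \<eta> V' F G f" .
  qed
  have "?cases" if D: ?desc
    unfolding gen_locally_def
  proof (intro allI impI)
    fix V assume V: "subdomain V U"
    then obtain V1 f where V1: "subdomain V1 V" "describes_with_eta \<delta> \<eta> V1 F G f"
      using D unfolding gen_locally_def by blast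
    from necessary[rule_format, OF subdomain_trans[OF V1(1) V] V1(2), unfolded gen_locally_def, rule_format,
        OF subdomain_refl[OF V1(1)]]
    obtain V' where "subdomain V' V1" "(\<exists>a b \<mu> lam g h \<phi>. case_i \<delta> \<eta> V' F G a b \<mu> lam g h \<phi>) \<or>
        (\<exists>a1 b1 a3 b3 p. case_ii \<delta> \<eta> V' F G a1 b1 a3 b3 p)"
      by blast
    then show "\<exists>V'. subdomain V' V \<and> ((\<exists>a b \<mu> lam g h \<phi>. case_i \<delta> \<eta> V' F G a b \<mu> lam g h \<phi>) \<or>
        (\<exists>a1 b1 a3 b3 p. case_ii \<delta> \<eta> V' F G a1 b1 a3 b3 p))"
      using subdomain_trans[OF _ V1(1)] by blast
  qed
  moreover have "?desc" if D: ?cases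
    unfolding gen_locally_def
  proof (intro allI impI)
    fix V assume V: "subdomain V U"
    from D[unfolded gen_locally_def, rule_format, OF V]
    obtain V1 where V1: "subdomain V1 V"
      and cases: "(\<exists>a b \<mu> lam g h \<phi>. case_i \<delta> \<eta> V1 F G a b \<mu> lam g h \<phi>) \<or>
        (\<exists>a1 b1 a3 b3 p. case_ii \<delta> \<eta> V1 F G a1 b1 a3 b3 p)"
      by blast
    note V1U = subdomain_trans[OF V1 V]
    have "\<exists>f. gen_locally V1 (\<lambda>V'. describes_with_eta \<delta> \<eta> V' F G f)"
      using cases
    proof (elim disjE exE)
      fix a b \<mu> lam g h \<phi> assume ci: "case_i \<delta> \<eta> V1 F G a b \<mu> lam g h \<phi>"
      obtain f where "assoc_i \<eta> V1 f a b \<mu> lam g h \<phi>" using assoc_i_exists by blast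
      then show ?thesis using sufficient_i V1U ci by blast
    next
      fix a1 b1 a3 b3 p assume cii: "case_ii \<delta> \<eta> V1 F G a1 b1 a3 b3 p"
      obtain f where "assoc_ii \<eta> V1 f a1 b1 a3 b3 p" using assoc_ii_exists by blast
      then show ?thesis using sufficient_ii V1U cii by blast
    qed
    then obtain f V' where "subdomain V' V1" "describes_with_eta \<delta> \<eta> V' F G f"
      unfolding gen_locally_def using subdomain_refl[OF V1] by blast
    then show "\<exists>V'. subdomain V' V \<and> (\<exists>f. describes_with_eta \<delta> \<eta> V' F G f)"
      using subdomain_trans[OF _ V1] by blast
  qed
  ultimately show ?thesis using necessary sufficient_i sufficient_ii by blast
qed

end
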